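(* Let $k$ be a field. Any infinite-dimensional chain coalgebra over $k$ is coreflexive and hence isomorphic to the finite dual of a left noetherian chain domain (which is a $k$-algebra).
   Context: Coalgebras are coassociative and counital over $k$. A right coideal of a coalgebra $C$ is a right $C$-subcomodule of $C$. A chain coalgebra is a coalgebra whose right coideals are linearly ordered by inclusion (equivalently, whose left coideals are linearly ordered by inclusion). $C^*=\mathrm{Hom}_k(C,k)$ is an algebra under the convolution product $(f*g)(x)=\sum f(x_i)g(x_i')$ for $\Delta(x)=\sum x_i\otimes x_i'$. For a $k$-algebra $A$, the finite dual $A^\circ$ is the coalgebra of all $f\in A^*$ whose kernel contains a two-sided ideal of finite codimension. A coalgebra $C$ is coreflexive if the natural coalgebra map $C\to (C^* )^\circ$, $c\mapsto (f\mapsto f(c))$, is an isomorphism. A left noetherian chain domain is a (not necessarily commutative) ring without zero divisors which is left noetherian and whose left ideals are linearly ordered by inclusion. *)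

theory Defs
  imports "HOL-Algebra.Module" "HOL-Algebra.Ideal"
begin

section \<open>Vector spaces\<close>

text \<open>
  All structures are HOL-Algebra records. For a mere vector space the fields
  \<open>mult\<close> and \<open>one\<close>, which the record type \<open>module\<close> inherits from \<open>ring\<close>, are
  irrelevant. Spaces of functions consist of functions that are \<^const>\<open>undefined\<close>
  outside the carrier of their domain, so that functions agreeing on the carrier are equal.
\<close>

locale vspace = module K V + field K for K (structure) and V (structure)

definition linear_maps ::
  "('k, 'e) ring_scheme \<Rightarrow> ('k, 'v, 'm) module_scheme \<Rightarrow> ('k, 'w, 'n) module_scheme \<Rightarrow> ('v \<Rightarrow> 'w) set"
  where "linear_maps K V W =
    {f \<in> carrier V \<rightarrow> carrier W.
       (\<forall>x\<in>carrier V. \<forall>y\<in>carrier V. f (x \<oplus>\<^bsub>V\<^esub> y) = f x \<oplus>\<^bsub>W\<^esub> f y) \<and>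
       (\<forall>a\<in>carrier K. \<forall>x\<in>carrier V. f (a \<odot>\<^bsub>V\<^esub> x) = a \<odot>\<^bsub>W\<^esub> f x)}"

definition lin_span ::
  "('k, 'e) ring_scheme \<Rightarrow> ('k, 'v, 'm) module_scheme \<Rightarrow> 'v set \<Rightarrow> 'v set"
  where "lin_span K V S = \<Inter>{H. submodule H K V \<and> S \<subseteq> H}"

definition finite_dimensional ::
  "('k, 'e) ring_scheme \<Rightarrow> ('k, 'v, 'm) module_scheme \<Rightarrow> bool"
  where "finite_dimensional K V \<longleftrightarrow>
    (\<exists>S. finite S \<and> S \<subseteq> carrier V \<and> lin_span K V S = carrier V)"

text \<open>The quotient \<open>V / I\<close> is spanned by the classes of the elements of a finite set \<open>S\<close>.\<close>

definition finite_codimension ::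
  "('k, 'e) ring_scheme \<Rightarrow> ('k, 'v, 'm) module_scheme \<Rightarrow> 'v set \<Rightarrow> bool"
  where "finite_codimension K V I \<longleftrightarrow>
    (\<exists>S. finite S \<and> S \<subseteq> carrier V \<and> I <+>\<^bsub>V\<^esub> lin_span K V S = carrier V)"

definition scalar_space :: "('k, 'e) ring_scheme \<Rightarrow> ('k, 'k) module"
  where "scalar_space K =
    \<lparr>carrier = carrier K, mult = mult K, one = one K, zero = zero K, add = add K,
     smult = mult K\<rparr>"

definition dual_space ::
  "('k, 'e) ring_scheme \<Rightarrow> ('k, 'v, 'm) module_scheme \<Rightarrow> ('k, 'v \<Rightarrow> 'k) module"
  where "dual_space K V =
    \<lparr>carrier = linear_maps K V (scalar_space K) \<inter> extensional (carrier V),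
     mult = undefined, one = undefined,
     zero = (\<lambda>x\<in>carrier V. \<zero>\<^bsub>K\<^esub>),
     add = (\<lambda>f g. \<lambda>x\<in>carrier V. f x \<oplus>\<^bsub>K\<^esub> g x),
     smult = (\<lambda>a f. \<lambda>x\<in>carrier V. a \<otimes>\<^bsub>K\<^esub> f x)\<rparr>"


section \<open>Tensor products\<close>

text \<open>
  The list \<open>[(v\<^sub>1, w\<^sub>1), \<dots>, (v\<^sub>n, w\<^sub>n)]\<close> stands for the formal sum
  \<open>v\<^sub>1 \<otimes> w\<^sub>1 + \<dots> + v\<^sub>n \<otimes> w\<^sub>n\<close>. The tensor product of \<open>V\<close> and \<open>W\<close> over \<open>K\<close> is the quotient
  of the monoid of these lists by the congruence generated by commutativity and
  the bilinearity relations. Scalar coefficients and negatives are not needed in the formal sums,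
  as they can be absorbed into the left factors.
\<close>

inductive tensor_eq ::
  "('k, 'e) ring_scheme \<Rightarrow> ('k, 'v, 'm) module_scheme \<Rightarrow> ('k, 'w, 'n) module_scheme \<Rightarrow>
    ('v \<times> 'w) list \<Rightarrow> ('v \<times> 'w) list \<Rightarrow> bool"
  for K V W
  where
    refl: "xs \<in> lists (carrier V \<times> carrier W) \<Longrightarrow> tensor_eq K V W xs xs"
  | sym: "tensor_eq K V W xs ys \<Longrightarrow> tensor_eq K V W ys xs"
  | trans: "tensor_eq K V W xs ys \<Longrightarrow> tensor_eq K V W ys zs \<Longrightarrow> tensor_eq K V W xs zs"
  | append: "tensor_eq K V W xs xs' \<Longrightarrow> tensor_eq K V W ys ys' \<Longrightarrow>
      tensor_eq K V W (xs @ ys) (xs' @ ys')"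
  | commute: "xs \<in> lists (carrier V \<times> carrier W) \<Longrightarrow> ys \<in> lists (carrier V \<times> carrier W) \<Longrightarrow>
      tensor_eq K V W (xs @ ys) (ys @ xs)"
  | add_left: "v \<in> carrier V \<Longrightarrow> v' \<in> carrier V \<Longrightarrow> w \<in> carrier W \<Longrightarrow>
      tensor_eq K V W [(v \<oplus>\<^bsub>V\<^esub> v', w)] [(v, w), (v', w)]"
  | add_right: "v \<in> carrier V \<Longrightarrow> w \<in> carrier W \<Longrightarrow> w' \<in> carrier W \<Longrightarrow>
      tensor_eq K V W [(v, w \<oplus>\<^bsub>W\<^esub> w')] [(v, w), (v, w')]"
  | balanced: "a \<in> carrier K \<Longrightarrow> v \<in> carrier V \<Longrightarrow> w \<in> carrier W \<Longrightarrow>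
      tensor_eq K V W [(a \<odot>\<^bsub>V\<^esub> v, w)] [(v, a \<odot>\<^bsub>W\<^esub> w)]"
  | zero_left: "w \<in> carrier W \<Longrightarrow> tensor_eq K V W [(\<zero>\<^bsub>V\<^esub>, w)] []"

definition tensor_class ::
  "('k, 'e) ring_scheme \<Rightarrow> ('k, 'v, 'm) module_scheme \<Rightarrow> ('k, 'w, 'n) module_scheme \<Rightarrow>
    ('v \<times> 'w) list \<Rightarrow> ('v \<times> 'w) list set"
  where "tensor_class K V W xs = {ys. tensor_eq K V W xs ys}"

definition tensor ::
  "('k, 'e) ring_scheme \<Rightarrow> ('k, 'v, 'm) module_scheme \<Rightarrow> ('k, 'w, 'n) module_scheme \<Rightarrow>
    ('k, ('v \<times> 'w) list set) module"
  where "tensor K V W =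
    \<lparr>carrier = tensor_class K V W ` lists (carrier V \<times> carrier W),
     mult = undefined, one = undefined,
     zero = tensor_class K V W [],
     add = (\<lambda>s t. \<Union>xs\<in>s. \<Union>ys\<in>t. tensor_class K V W (xs @ ys)),
     smult = (\<lambda>a t. \<Union>xs\<in>t. tensor_class K V W (map (\<lambda>(v, w). (a \<odot>\<^bsub>V\<^esub> v, w)) xs))\<rparr>"

definition pure_tensor ::
  "('k, 'e) ring_scheme \<Rightarrow> ('k, 'v, 'm) module_scheme \<Rightarrow> ('k, 'w, 'n) module_scheme \<Rightarrow>
    'v \<Rightarrow> 'w \<Rightarrow> ('v \<times> 'w) list set"
  where "pure_tensor K V W v w = tensor_class K V W [(v, w)]"

text \<open>
  For a bilinear map \<open>\<beta>\<close> into \<open>U\<close> this is the induced linear map on the tensor product, sending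
  \<open>\<Sum> v\<^sub>i \<otimes> w\<^sub>i\<close> to \<open>\<Sum> \<beta> v\<^sub>i w\<^sub>i\<close>; the value does not depend on the representative of \<open>t\<close>
  (lemma \<open>tensor_lift_class\<close> below).
\<close>

definition tensor_sum :: "('u, 'n) ring_scheme \<Rightarrow> ('v \<Rightarrow> 'w \<Rightarrow> 'u) \<Rightarrow> ('v \<times> 'w) list \<Rightarrow> 'u"
  where "tensor_sum U \<beta> xs = foldr (\<lambda>(v, w) u. \<beta> v w \<oplus>\<^bsub>U\<^esub> u) xs \<zero>\<^bsub>U\<^esub>"

definition tensor_lift :: "('u, 'n) ring_scheme \<Rightarrow> ('v \<Rightarrow> 'w \<Rightarrow> 'u) \<Rightarrow> ('v \<times> 'w) list set \<Rightarrow> 'u"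
  where "tensor_lift U \<beta> t = tensor_sum U \<beta> (SOME xs. xs \<in> t)"

text \<open>The map \<open>f \<otimes> g\<close> into the tensor product of \<open>V\<close> and \<open>W\<close>.\<close>

definition tensor_map ::
  "('k, 'e) ring_scheme \<Rightarrow> ('k, 'v, 'm) module_scheme \<Rightarrow> ('k, 'w, 'n) module_scheme \<Rightarrow>
    ('a \<Rightarrow> 'v) \<Rightarrow> ('b \<Rightarrow> 'w) \<Rightarrow> ('a \<times> 'b) list set \<Rightarrow> ('v \<times> 'w) list set"
  where "tensor_map K V W f g =
    tensor_lift (tensor K V W) (\<lambda>a b. pure_tensor K V W (f a) (g b))"

text \<open>The associativity isomorphism \<open>(U \<otimes> V) \<otimes> W \<rightarrow> U \<otimes> (V \<otimes> W)\<close>.\<close>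

definition tensor_assoc ::
  "('k, 'e) ring_scheme \<Rightarrow> ('k, 'u, 'l) module_scheme \<Rightarrow> ('k, 'v, 'm) module_scheme \<Rightarrow>
    ('k, 'w, 'n) module_scheme \<Rightarrow>
    (('u \<times> 'v) list set \<times> 'w) list set \<Rightarrow> ('u \<times> ('v \<times> 'w) list set) list set"
  where "tensor_assoc K U V W =
    (let T = tensor K U (tensor K V W) in
      tensor_lift T (\<lambda>s w.
        tensor_lift T (\<lambda>u v. pure_tensor K U (tensor K V W) u (pure_tensor K V W v w)) s))"

lemma tensor_eq_lists:
  assumes "tensor_eq K V W xs ys" "vspace K V" "vspace K W"
  shows "xs \<in> lists (carrier V \<times> carrier W) \<and> ys \<in> lists (carrier V \<times> carrier W)"
proof -
  interpret V: vspace K V by fact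
  interpret W: vspace K W by fact
  show ?thesis using assms(1) by induction auto
qed

lemma tensor_sum_closed:
  assumes "abelian_monoid U" "\<And>v w. v \<in> A \<Longrightarrow> w \<in> B \<Longrightarrow> \<beta> v w \<in> carrier U"
    "xs \<in> lists (A \<times> B)"
  shows "tensor_sum U \<beta> xs \<in> carrier U"
proof -
  interpret abelian_monoid U by fact
  show ?thesis using assms(3)
    by (induction xs) (auto simp: tensor_sum_def assms(2))
qed

lemma tensor_sum_append:
  assumes "abelian_monoid U" "\<And>v w. v \<in> A \<Longrightarrow> w \<in> B \<Longrightarrow> \<beta> v w \<in> carrier U"
    "xs \<in> lists (A \<times> B)" "ys \<in> lists (A \<times> B)"
  shows "tensor_sum U \<beta> (xs @ ys) = tensor_sum U \<beta> xs \<oplus>\<^bsub>U\<^esub> tensor_sum U \<beta> ys"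
proof -
  interpret abelian_monoid U by fact
  have closed: "tensor_sum U \<beta> zs \<in> carrier U" if "zs \<in> lists (A \<times> B)" for zs
    by (rule tensor_sum_closed[OF assms(1,2) that])
  from assms(3) show ?thesis
  proof (induction xs)
    case Nil
    then show ?case using closed[OF assms(4)] by (simp add: tensor_sum_def)
  next
    case (Cons p xs)
    obtain v w where p: "p = (v, w)" by force
    have step: "tensor_sum U \<beta> ((v, w) # zs) = \<beta> v w \<oplus>\<^bsub>U\<^esub> tensor_sum U \<beta> zs" for zs
      by (simp add: tensor_sum_def)
    show ?case
      using Cons p closed[of xs] closed[OF assms(4)] assms(2)[of v w]
      by (simp add: p step a_assoc)
  qed
qed

lemma tensor_sum_cong:
  assumes "tensor_eq K V W xs ys" "vspace K V" "vspace K W" "abelian_group U"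
    and closed: "\<And>v w. v \<in> carrier V \<Longrightarrow> w \<in> carrier W \<Longrightarrow> \<beta> v w \<in> carrier U"
    and add_left: "\<And>v v' w. v \<in> carrier V \<Longrightarrow> v' \<in> carrier V \<Longrightarrow> w \<in> carrier W \<Longrightarrow>
      \<beta> (v \<oplus>\<^bsub>V\<^esub> v') w = \<beta> v w \<oplus>\<^bsub>U\<^esub> \<beta> v' w"
    and add_right: "\<And>v w w'. v \<in> carrier V \<Longrightarrow> w \<in> carrier W \<Longrightarrow> w' \<in> carrier W \<Longrightarrow>
      \<beta> v (w \<oplus>\<^bsub>W\<^esub> w') = \<beta> v w \<oplus>\<^bsub>U\<^esub> \<beta> v w'"
    and balanced: "\<And>a v w. a \<in> carrier K \<Longrightarrow> v \<in> carrier V \<Longrightarrow> w \<in> carrier W \<Longrightarrow>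
      \<beta> (a \<odot>\<^bsub>V\<^esub> v) w = \<beta> v (a \<odot>\<^bsub>W\<^esub> w)"
  shows "tensor_sum U \<beta> xs = tensor_sum U \<beta> ys"
proof -
  interpret V: vspace K V by fact
  interpret W: vspace K W by fact
  interpret U: abelian_group U by fact
  have sum_closed: "tensor_sum U \<beta> zs \<in> carrier U"
    if "zs \<in> lists (carrier V \<times> carrier W)" for zs
    by (rule tensor_sum_closed[OF U.abelian_monoid_axioms closed that])
  have sum_append: "tensor_sum U \<beta> (zs @ zs') = tensor_sum U \<beta> zs \<oplus>\<^bsub>U\<^esub> tensor_sum U \<beta> zs'"
    if "zs \<in> lists (carrier V \<times> carrier W)" "zs' \<in> lists (carrier V \<times> carrier W)" for zs zs'
    by (rule tensor_sum_append[OF U.abelian_monoid_axioms closed that])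
  note lists = tensor_eq_lists[OF _ assms(2,3)]
  show ?thesis using assms(1)
  proof induction
    case (append xs xs' ys ys')
    then show ?case
      using lists[of xs xs'] lists[of ys ys'] by (simp add: sum_append)
  next
    case (commute xs ys)
    then show ?case using sum_append[of xs ys] sum_append[of ys xs] sum_closed[of xs] sum_closed[of ys]
      by (simp add: U.a_comm)
  next
    case (zero_left w)
    have "\<beta> \<zero>\<^bsub>V\<^esub> w \<oplus>\<^bsub>U\<^esub> \<beta> \<zero>\<^bsub>V\<^esub> w = \<beta> \<zero>\<^bsub>V\<^esub> w"
      using add_left[of "\<zero>\<^bsub>V\<^esub>" "\<zero>\<^bsub>V\<^esub>" w] zero_left by simp
    then have "\<beta> \<zero>\<^bsub>V\<^esub> w = \<zero>\<^bsub>U\<^esub>"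
      using closed[of "\<zero>\<^bsub>V\<^esub>" w] zero_left by (simp add: U.add.l_cancel_one')
    then show ?case by (simp add: tensor_sum_def)
  qed (auto simp: tensor_sum_def add_left add_right balanced closed)
qed

lemma tensor_lift_class:
  assumes "vspace K V" "vspace K W" "abelian_group U"
    and "\<And>v w. v \<in> carrier V \<Longrightarrow> w \<in> carrier W \<Longrightarrow> \<beta> v w \<in> carrier U"
    and "\<And>v v' w. v \<in> carrier V \<Longrightarrow> v' \<in> carrier V \<Longrightarrow> w \<in> carrier W \<Longrightarrow>
      \<beta> (v \<oplus>\<^bsub>V\<^esub> v') w = \<beta> v w \<oplus>\<^bsub>U\<^esub> \<beta> v' w"
    and "\<And>v w w'. v \<in> carrier V \<Longrightarrow> w \<in> carrier W \<Longrightarrow> w' \<in> carrier W \<Longrightarrow>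
      \<beta> v (w \<oplus>\<^bsub>W\<^esub> w') = \<beta> v w \<oplus>\<^bsub>U\<^esub> \<beta> v w'"
    and "\<And>a v w. a \<in> carrier K \<Longrightarrow> v \<in> carrier V \<Longrightarrow> w \<in> carrier W \<Longrightarrow>
      \<beta> (a \<odot>\<^bsub>V\<^esub> v) w = \<beta> v (a \<odot>\<^bsub>W\<^esub> w)"
    and xs: "xs \<in> lists (carrier V \<times> carrier W)"
  shows "tensor_lift U \<beta> (tensor_class K V W xs) = tensor_sum U \<beta> xs"
proof -
  have "xs \<in> tensor_class K V W xs"
    using xs by (simp add: tensor_class_def tensor_eq.refl)
  then have "tensor_eq K V W xs (SOME ys. ys \<in> tensor_class K V W xs)"
    by (metis (no_types, lifting) mem_Collect_eq someI tensor_class_def)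
  from tensor_sum_cong[of K V W xs _ U \<beta>, OF this assms(1-7)]
  show ?thesis by (simp add: tensor_lift_def)
qed


section \<open>Coalgebras\<close>

record ('k, 'c) coalgebra = "('k, 'c) module" +
  comult :: "'c \<Rightarrow> ('c \<times> 'c) list set"
  counit :: "'c \<Rightarrow> 'k"

locale coalgebra = vspace K C for K (structure) and C (structure) +
  assumes comult_linear: "comult C \<in> linear_maps K C (tensor K C C)"
    and counit_linear: "counit C \<in> linear_maps K C (scalar_space K)"
    and coassoc: "x \<in> carrier C \<Longrightarrow>
      tensor_assoc K C C C (tensor_map K (tensor K C C) C (comult C) id (comult C x)) =
      tensor_map K C (tensor K C C) id (comult C) (comult C x)"
    and counit_left: "x \<in> carrier C \<Longrightarrow>
      tensor_lift C (\<lambda>u v. counit C u \<odot>\<^bsub>C\<^esub> v) (comult C x) = x"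
    and counit_right: "x \<in> carrier C \<Longrightarrow>
      tensor_lift C (\<lambda>u v. counit C v \<odot>\<^bsub>C\<^esub> u) (comult C x) = x"

locale coalgebra_iso = C: coalgebra K C + D: coalgebra K D
  for K (structure) and C (structure) and D (structure) and F +
  assumes linear: "F \<in> linear_maps K C D"
    and comult: "x \<in> carrier C \<Longrightarrow> comult D (F x) = tensor_map K D D F F (comult C x)"
    and counit: "x \<in> carrier C \<Longrightarrow> counit D (F x) = counit C x"
    and bij: "bij_betw F (carrier C) (carrier D)"

text \<open>A right subcomodule of \<open>C\<close>: a subspace \<open>I\<close> whose comultiplication has values in the
  subspace \<open>I \<otimes> C\<close> of \<open>C \<otimes> C\<close>.\<close>

definition right_coideal ::
  "('k, 'e) ring_scheme \<Rightarrow> ('k, 'c, 'm) coalgebra_scheme \<Rightarrow> 'c set \<Rightarrow> bool"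
  where "right_coideal K C I \<longleftrightarrow>
    submodule I K C \<and>
    (\<forall>x\<in>I. comult C x \<in>
      lin_span K (tensor K C C) {pure_tensor K C C u v | u v. u \<in> I \<and> v \<in> carrier C})"

locale chain_coalgebra = coalgebra +
  assumes right_coideals_chain:
    "right_coideal K C I \<Longrightarrow> right_coideal K C J \<Longrightarrow> I \<subseteq> J \<or> J \<subseteq> I"


section \<open>Algebras, duals and coreflexivity\<close>

text \<open>In contrast to the HOL-Algebra locales \<open>algebra\<close> and \<open>domain\<close>, the following do not assume
  that multiplication is commutative.\<close>

locale assoc_algebra = vspace K A + ring A for K (structure) and A (structure) +
  assumes smult_mult_left: "a \<in> carrier K \<Longrightarrow> x \<in> carrier A \<Longrightarrow> y \<in> carrier A \<Longrightarrow>
      (a \<odot>\<^bsub>A\<^esub> x) \<otimes>\<^bsub>A\<^esub> y = a \<odot>\<^bsub>A\<^esub> (x \<otimes>\<^bsub>A\<^esub> y)"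
    and smult_mult_right: "a \<in> carrier K \<Longrightarrow> x \<in> carrier A \<Longrightarrow> y \<in> carrier A \<Longrightarrow>
      x \<otimes>\<^bsub>A\<^esub> (a \<odot>\<^bsub>A\<^esub> y) = a \<odot>\<^bsub>A\<^esub> (x \<otimes>\<^bsub>A\<^esub> y)"

locale left_ideal = additive_subgroup I R + ring R for I and R (structure) +
  assumes left_closed: "x \<in> carrier R \<Longrightarrow> a \<in> I \<Longrightarrow> x \<otimes> a \<in> I"

locale left_noetherian_chain_domain = ring R for R (structure) +
  assumes one_not_zero: "\<one> \<noteq> \<zero>"
    and no_zero_divisors: "a \<in> carrier R \<Longrightarrow> b \<in> carrier R \<Longrightarrow> a \<otimes> b = \<zero> \<Longrightarrow> a = \<zero> \<or> b = \<zero>"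
    and left_noetherian: "(\<And>n::nat. left_ideal (I n) R) \<Longrightarrow> (\<And>n. I n \<subseteq> I (Suc n)) \<Longrightarrow>
      \<exists>m. \<forall>n\<ge>m. I n = I m"
    and left_ideals_chain: "left_ideal J R \<Longrightarrow> left_ideal L R \<Longrightarrow> J \<subseteq> L \<or> L \<subseteq> J"

text \<open>The dual of a coalgebra with the convolution product.\<close>

definition dual_algebra ::
  "('k, 'e) ring_scheme \<Rightarrow> ('k, 'c, 'm) coalgebra_scheme \<Rightarrow> ('k, 'c \<Rightarrow> 'k) module"
  where "dual_algebra K C = (dual_space K C)
    \<lparr>mult := (\<lambda>f g. \<lambda>x\<in>carrier C. tensor_lift K (\<lambda>u v. f u \<otimes>\<^bsub>K\<^esub> g v) (comult C x)),
     one := restrict (counit C) (carrier C)\<rparr>"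

definition finite_dual_space ::
  "('k, 'e) ring_scheme \<Rightarrow> ('k, 'a, 'm) module_scheme \<Rightarrow> ('k, 'a \<Rightarrow> 'k) module"
  where "finite_dual_space K A = (dual_space K A)
    \<lparr>carrier := {f \<in> carrier (dual_space K A).
       \<exists>I. ideal I A \<and> finite_codimension K A I \<and> (\<forall>x\<in>I. f x = \<zero>\<^bsub>K\<^esub>)}\<rparr>"

text \<open>The comultiplication of the finite dual is dual to the multiplication of \<open>A\<close>: the value
  at \<open>f\<close> is the unique \<open>\<Sum> g\<^sub>i \<otimes> h\<^sub>i\<close>, with \<open>g\<^sub>i\<close> and \<open>h\<^sub>i\<close> in the finite dual, such that
  \<open>f (x y) = \<Sum> g\<^sub>i x * h\<^sub>i y\<close> for all \<open>x\<close> and \<open>y\<close>.\<close>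

definition finite_dual ::
  "('k, 'e) ring_scheme \<Rightarrow> ('k, 'a, 'm) module_scheme \<Rightarrow> ('k, 'a \<Rightarrow> 'k) coalgebra"
  where "finite_dual K A =
    (let D = finite_dual_space K A in
      \<lparr>carrier = carrier D, mult = mult D, one = one D, zero = zero D, add = add D,
       smult = smult D,
       comult = (\<lambda>f. THE t. t \<in> carrier (tensor K D D) \<and>
         (\<forall>x\<in>carrier A. \<forall>y\<in>carrier A.
            tensor_lift K (\<lambda>g h. g x \<otimes>\<^bsub>K\<^esub> h y) t = f (x \<otimes>\<^bsub>A\<^esub> y))),
       counit = (\<lambda>f. f \<one>\<^bsub>A\<^esub>)\<rparr>)"

definition evaluation_map ::
  "('k, 'e) ring_scheme \<Rightarrow> ('k, 'c, 'm) coalgebra_scheme \<Rightarrow> 'c \<Rightarrow> ('c \<Rightarrow> 'k) \<Rightarrow> 'k"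
  where "evaluation_map K C c = (\<lambda>f\<in>carrier (dual_algebra K C). f c)"

definition coreflexive :: "('k, 'e) ring_scheme \<Rightarrow> ('k, 'c, 'm) coalgebra_scheme \<Rightarrow> bool"
  where "coreflexive K C \<longleftrightarrow>
    coalgebra_iso K C (finite_dual K (dual_algebra K C)) (evaluation_map K C)"

end

theory Submission
  imports Defs
begin

text \<open>
  The algebra is the dual algebra \<open>A = C\<^sup>*\<close> and the isomorphism is evaluation. Everything is read off from the
  two actions of \<open>A\<close> on \<open>C\<close>, for which \<open>(f \<star> g) x = f (left_action g x) = g (right_action f x)\<close>. Right coideals
  are the subspaces that the left action preserves.

  The hypothesis concerns right coideals, while the conclusion concerns left ideals of \<open>A\<close>, which correspond to
  left coideals. The bridge is that both kinds of coideals coincide. Write \<open>\<Delta> x\<close> as a sum of \<open>u\<^sub>i \<otimes> v\<^sub>i\<close> with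
  independent \<open>u\<^sub>i\<close> and independent \<open>v\<^sub>i\<close>. Then the \<open>u\<^sub>i\<close> are a basis of the left orbit \<open>A x\<close> and the \<open>v\<^sub>i\<close> are a
  basis of the right orbit \<open>x A\<close> (\<open>orbits_rep\<close>), so both orbits have the same finite dimension. If \<open>y\<close> is in
  \<open>x A\<close>, then \<open>A y\<close> is a linear image of \<open>A x\<close>; as \<open>A x\<close> and \<open>A y\<close> are comparable, \<open>A y\<close> is contained in \<open>A x\<close>. Hence
  \<open>x A\<close> is contained in \<open>A x\<close>, and the two are equal (\<open>orbits_equal\<close>).

  A proper coideal is contained in an orbit, so it is finite-dimensional. For \<open>f \<noteq> 0\<close> the kernel of the left
  action of \<open>f\<close> is a proper coideal and its image is a coideal. As \<open>C\<close> has infinite dimension, the image is all of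
  \<open>C\<close> (\<open>left_action_surj\<close>). This has three consequences. First, \<open>A\<close> has no zero divisors. Second, the left ideal
  \<open>A f\<close> is the annihilator of the kernel (\<open>principal_left_ideal\<close>), so that principal left ideals are ordered as the
  kernels are, in reverse; since kernels are finite-dimensional and form a chain, left ideals form a chain and
  satisfy the ascending chain condition. Third, a functional on \<open>A\<close> that vanishes on a nonzero ideal vanishes on
  the annihilator of a finite-dimensional subspace of \<open>C\<close> and is therefore an evaluation
  (\<open>finite_dual_is_evaluation\<close>). Ideals of finite codimension are nonzero, again because \<open>C\<close> has infinite dimension,
  and conversely the evaluation at \<open>c\<close> vanishes on the annihilator of \<open>A c = c A\<close>, which is an ideal of finite
  codimension. So evaluation maps \<open>C\<close> onto the finite dual. It is injective since functionals separate points,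
  and it respects comultiplication because products of functionals separate the points of \<open>C \<otimes> C\<close>; the
  coalgebra axioms of the finite dual are those of \<open>C\<close> transported along it.
\<close>

section \<open>Linear maps, spans and independent sets\<close>

lemma linear_mapsI:
  assumes "\<And>x. x \<in> carrier V \<Longrightarrow> f x \<in> carrier W"
    and "\<And>x y. x \<in> carrier V \<Longrightarrow> y \<in> carrier V \<Longrightarrow> f (x \<oplus>\<^bsub>V\<^esub> y) = f x \<oplus>\<^bsub>W\<^esub> f y"
    and "\<And>a x. a \<in> carrier K \<Longrightarrow> x \<in> carrier V \<Longrightarrow> f (a \<odot>\<^bsub>V\<^esub> x) = a \<odot>\<^bsub>W\<^esub> f x"
  shows "f \<in> linear_maps K V W"
  using assms by (auto simp: linear_maps_def)

lemma linear_map_closed: "f \<in> linear_maps K V W \<Longrightarrow> x \<in> carrier V \<Longrightarrow> f x \<in> carrier W"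
  by (auto simp: linear_maps_def)

lemma linear_map_add: "f \<in> linear_maps K V W \<Longrightarrow> x \<in> carrier V \<Longrightarrow> y \<in> carrier V \<Longrightarrow>
    f (x \<oplus>\<^bsub>V\<^esub> y) = f x \<oplus>\<^bsub>W\<^esub> f y"
  by (auto simp: linear_maps_def)

lemma linear_map_smult: "f \<in> linear_maps K V W \<Longrightarrow> a \<in> carrier K \<Longrightarrow> x \<in> carrier V \<Longrightarrow>
    f (a \<odot>\<^bsub>V\<^esub> x) = a \<odot>\<^bsub>W\<^esub> f x"
  by (auto simp: linear_maps_def)

lemma linear_map_zero:
  assumes "vspace K V" "vspace K W" "f \<in> linear_maps K V W"
  shows "f \<zero>\<^bsub>V\<^esub> = \<zero>\<^bsub>W\<^esub>"
proof -
  interpret V: vspace K V by fact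
  interpret W: vspace K W by fact
  have "f (\<zero>\<^bsub>K\<^esub> \<odot>\<^bsub>V\<^esub> \<zero>\<^bsub>V\<^esub>) = \<zero>\<^bsub>K\<^esub> \<odot>\<^bsub>W\<^esub> f \<zero>\<^bsub>V\<^esub>"
    by (rule linear_map_smult[OF assms(3)]) auto
  then show ?thesis using linear_map_closed[OF assms(3)] by simp
qed

lemma linear_map_minus:
  assumes "vspace K V" "vspace K W" "f \<in> linear_maps K V W" "x \<in> carrier V" "y \<in> carrier V"
  shows "f (x \<ominus>\<^bsub>V\<^esub> y) = f x \<ominus>\<^bsub>W\<^esub> f y"
proof -
  interpret V: vspace K V by fact
  interpret W: vspace K W by fact
  have "f (\<ominus>\<^bsub>V\<^esub> y) = f ((\<ominus>\<^bsub>K\<^esub> \<one>\<^bsub>K\<^esub>) \<odot>\<^bsub>V\<^esub> y)"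
    using assms by (simp add: V.smult_l_minus)
  also have "\<dots> = \<ominus>\<^bsub>W\<^esub> f y"
    using assms linear_map_closed[OF assms(3)] by (simp add: linear_map_smult W.smult_l_minus)
  finally show ?thesis
    using assms by (simp add: a_minus_def linear_map_add)
qed

lemma linear_maps_comp:
  "f \<in> linear_maps K V W \<Longrightarrow> g \<in> linear_maps K W U \<Longrightarrow> (\<lambda>x. g (f x)) \<in> linear_maps K V U"
  by (auto simp: linear_maps_def Pi_iff)

lemma id_linear: "id \<in> linear_maps K V V"
  by (auto simp: linear_maps_def)

lemma vspace_cong:
  assumes "vspace K V" "carrier W = carrier V" "zero W = zero V" "add W = add V" "smult W = smult V"
  shows "vspace K W"
proof -
  interpret V: vspace K V by fact
  have "abelian_group W"
    by (rule abelian_groupI)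
      (auto simp: assms(2-) V.M.a_ac intro: bexI[of _ "\<ominus>\<^bsub>V\<^esub> _"] V.M.l_neg)
  then have "module K W"
    by (intro moduleI V.is_cring)
      (auto simp: assms(2-) V.smult_l_distr V.smult_r_distr V.smult_assoc1)
  then show ?thesis by (rule vspace.intro) (rule V.field_axioms)
qed

context vspace
begin

abbreviation span :: "'c set \<Rightarrow> 'c set"
  where "span \<equiv> lin_span K V"

lemma submodule_minus_freeI:
  assumes "H \<subseteq> carrier V" "\<zero>\<^bsub>V\<^esub> \<in> H" "\<And>x y. x \<in> H \<Longrightarrow> y \<in> H \<Longrightarrow> x \<oplus>\<^bsub>V\<^esub> y \<in> H"
    "\<And>a x. a \<in> carrier K \<Longrightarrow> x \<in> H \<Longrightarrow> a \<odot>\<^bsub>V\<^esub> x \<in> H"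
  shows "submodule H K V"
proof (rule submoduleI)
  fix x assume "x \<in> H"
  then have "(\<ominus>\<^bsub>K\<^esub> \<one>\<^bsub>K\<^esub>) \<odot>\<^bsub>V\<^esub> x \<in> H" "x \<in> carrier V" using assms by auto
  then show "\<ominus>\<^bsub>V\<^esub> x \<in> H" by (simp add: smult_l_minus)
qed (use assms in auto)

lemma submodule_zero: "submodule H K V \<Longrightarrow> \<zero>\<^bsub>V\<^esub> \<in> H"
  by (auto simp: submodule_def dest: subgroup.one_closed)

lemma submodule_sub: "submodule H K V \<Longrightarrow> x \<in> H \<Longrightarrow> y \<in> H \<Longrightarrow> x \<ominus>\<^bsub>V\<^esub> y \<in> H"
  unfolding a_minus_def by (blast intro: submoduleE(3,5))

lemma submodule_cancel:
  assumes "submodule H K V" "x \<oplus>\<^bsub>V\<^esub> y \<in> H" "y \<in> H" "x \<in> carrier V"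
  shows "x \<in> H"
proof -
  have "y \<in> carrier V" using assms submoduleE(1) by blast
  then have "x = (x \<oplus>\<^bsub>V\<^esub> y) \<ominus>\<^bsub>V\<^esub> y"
    using assms(4) by (simp add: a_minus_def M.a_assoc M.r_neg)
  then show ?thesis using submodule_sub[OF assms(1-3)] by simp
qed

lemma span_submodule: "S \<subseteq> carrier V \<Longrightarrow> submodule (span S) K V"
  by (rule submodule_minus_freeI)
    (use carrier_is_submodule in \<open>auto simp: lin_span_def intro: submodule_zero submoduleE(4,5)\<close>)

lemma span_closed: "S \<subseteq> carrier V \<Longrightarrow> x \<in> span S \<Longrightarrow> x \<in> carrier V"
  using submoduleE(1)[OF span_submodule] by blast

lemma span_superset: "x \<in> S \<Longrightarrow> x \<in> span S"
  by (auto simp: lin_span_def)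

lemma span_least: "submodule H K V \<Longrightarrow> S \<subseteq> H \<Longrightarrow> span S \<subseteq> H"
  by (auto simp: lin_span_def)

lemma span_mono: "S \<subseteq> T \<Longrightarrow> span S \<subseteq> span T"
  by (auto simp: lin_span_def)

lemma span_empty: "span {} = {\<zero>\<^bsub>V\<^esub>}"
proof
  show "span {} \<subseteq> {\<zero>\<^bsub>V\<^esub>}"
    by (rule span_least) (auto intro: submodule_minus_freeI)
qed (simp add: submodule_zero span_submodule)

lemma span_insert:
  assumes "insert u S \<subseteq> carrier V"
  shows "span (insert u S) = {a \<odot>\<^bsub>V\<^esub> u \<oplus>\<^bsub>V\<^esub> w | a w. a \<in> carrier K \<and> w \<in> span S}" (is "_ = ?R")
proof
  have S: "submodule (span S) K V" and u: "u \<in> carrier V"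
    using assms by (auto intro: span_submodule)
  note [simp] = submoduleE(4,5)[OF S] submodule_zero[OF S]
  have c [simp]: "w \<in> carrier V" if "w \<in> span S" for w using that assms span_closed by blast
  have "submodule ?R K V"
  proof (rule submodule_minus_freeI)
    show "\<zero>\<^bsub>V\<^esub> \<in> ?R" using u by (intro CollectI exI[of _ "\<zero>\<^bsub>K\<^esub>"] exI[of _ "\<zero>\<^bsub>V\<^esub>"]) simp
    show "?R \<subseteq> carrier V" using u by auto
  next
    fix x y assume "x \<in> ?R" "y \<in> ?R"
    then obtain a w b z where *: "a \<in> carrier K" "w \<in> span S" "b \<in> carrier K" "z \<in> span S"
      "x = a \<odot>\<^bsub>V\<^esub> u \<oplus>\<^bsub>V\<^esub> w" "y = b \<odot>\<^bsub>V\<^esub> u \<oplus>\<^bsub>V\<^esub> z" by blast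
    then have "x \<oplus>\<^bsub>V\<^esub> y = (a \<oplus>\<^bsub>K\<^esub> b) \<odot>\<^bsub>V\<^esub> u \<oplus>\<^bsub>V\<^esub> (w \<oplus>\<^bsub>V\<^esub> z)"
      using u by (simp add: smult_l_distr M.a_ac)
    then show "x \<oplus>\<^bsub>V\<^esub> y \<in> ?R" using *
      by (intro CollectI exI[of _ "a \<oplus>\<^bsub>K\<^esub> b"] exI[of _ "w \<oplus>\<^bsub>V\<^esub> z"]) simp
  next
    fix c x assume "c \<in> carrier K" "x \<in> ?R"
    then obtain a w where *: "a \<in> carrier K" "w \<in> span S" "x = a \<odot>\<^bsub>V\<^esub> u \<oplus>\<^bsub>V\<^esub> w" by blast
    then have "c \<odot>\<^bsub>V\<^esub> x = (c \<otimes>\<^bsub>K\<^esub> a) \<odot>\<^bsub>V\<^esub> u \<oplus>\<^bsub>V\<^esub> c \<odot>\<^bsub>V\<^esub> w"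
      using u \<open>c \<in> carrier K\<close> by (simp add: smult_r_distr smult_assoc1)
    then show "c \<odot>\<^bsub>V\<^esub> x \<in> ?R" using * \<open>c \<in> carrier K\<close>
      by (intro CollectI exI[of _ "c \<otimes>\<^bsub>K\<^esub> a"] exI[of _ "c \<odot>\<^bsub>V\<^esub> w"]) simp
  qed
  moreover have "insert u S \<subseteq> ?R"
  proof
    fix x assume "x \<in> insert u S"
    then show "x \<in> ?R"
    proof
      assume "x = u"
      then show ?thesis using u by (intro CollectI exI[of _ "\<one>\<^bsub>K\<^esub>"] exI[of _ "\<zero>\<^bsub>V\<^esub>"]) simp
    next
      assume "x \<in> S"
      then show ?thesis using u assms
        by (intro CollectI exI[of _ "\<zero>\<^bsub>K\<^esub>"] exI[of _ x]) (auto simp: span_superset)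
    qed
  qed
  ultimately show "span (insert u S) \<subseteq> ?R" by (rule span_least)
next
  have I: "submodule (span (insert u S)) K V" by (rule span_submodule[OF assms])
  show "?R \<subseteq> span (insert u S)"
    using span_mono[of S "insert u S"] span_superset[of u "insert u S"]
    by (auto intro!: submoduleE(4,5)[OF I])
qed

text \<open>
  The coefficient of \<open>u\<close> in \<open>x\<close> cannot vanish, so the relation can be solved for \<open>u\<close>. All of the
  dimension theory below rests on this property and on \<open>span\<close> being a closure operator.
\<close>

lemma span_exchange:
  assumes "insert x (insert u S) \<subseteq> carrier V" "x \<in> span (insert u S)" "x \<notin> span S"
  shows "u \<in> span (insert x S)"
proof -
  have sub: "submodule (span (insert x S)) K V" using assms by (intro span_submodule) auto
  obtain a w where *: "a \<in> carrier K" "w \<in> span S" "x = a \<odot>\<^bsub>V\<^esub> u \<oplus>\<^bsub>V\<^esub> w"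
    using assms span_insert[of u S] by auto
  have w: "w \<in> carrier V" using * assms span_closed[of S] by blast
  have u: "u \<in> carrier V" using assms by simp
  have "a \<noteq> \<zero>\<^bsub>K\<^esub>" using * assms w u by auto
  then have inv: "inv\<^bsub>K\<^esub> a \<in> carrier K" "inv\<^bsub>K\<^esub> a \<otimes>\<^bsub>K\<^esub> a = \<one>\<^bsub>K\<^esub>"
    using * field_Units by auto
  have "a \<odot>\<^bsub>V\<^esub> u \<in> span (insert x S)"
  proof (rule submodule_cancel[OF sub])
    show "a \<odot>\<^bsub>V\<^esub> u \<oplus>\<^bsub>V\<^esub> w \<in> span (insert x S)" using * by (simp add: span_superset)
    show "w \<in> span (insert x S)" using * span_mono[of S "insert x S"] by auto
    show "a \<odot>\<^bsub>V\<^esub> u \<in> carrier V" using * u by simp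
  qed
  then have "inv\<^bsub>K\<^esub> a \<odot>\<^bsub>V\<^esub> (a \<odot>\<^bsub>V\<^esub> u) \<in> span (insert x S)"
    using inv submoduleE(4)[OF sub] by blast
  then show ?thesis using inv * u by (simp flip: smult_assoc1)
qed

lemma span_insert_redundant:
  assumes "S \<subseteq> carrier V" "x \<in> span S" shows "span (insert x S) = span S"
  by (intro equalityI span_least span_mono span_submodule assms)
    (use assms span_superset in auto)

definition indep :: "'c set \<Rightarrow> bool"
  where "indep S \<longleftrightarrow> S \<subseteq> carrier V \<and> (\<forall>x\<in>S. x \<notin> span (S - {x}))"

lemma indep_subset: "indep S \<Longrightarrow> T \<subseteq> S \<Longrightarrow> indep T"
  unfolding indep_def by (meson Diff_mono order_refl span_mono subsetD subset_trans)

lemma indep_insert: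
  assumes "indep S" "x \<in> carrier V" "x \<notin> span S"
  shows "indep (insert x S)"
  unfolding indep_def
proof (intro conjI ballI)
  show "insert x S \<subseteq> carrier V" using assms by (auto simp: indep_def)
  fix b assume b: "b \<in> insert x S"
  have "x \<notin> S" using assms span_superset by blast
  show "b \<notin> span (insert x S - {b})"
  proof (cases "b = x")
    case True
    then show ?thesis using assms \<open>x \<notin> S\<close> by simp
  next
    case False
    show ?thesis
    proof
      assume "b \<in> span (insert x S - {b})"
      then have "b \<in> span (insert x (S - {b}))" using False by (simp add: insert_Diff_if)
      moreover have "b \<notin> span (S - {b})" using assms b False by (auto simp: indep_def)
      ultimately have "x \<in> span (insert b (S - {b}))"
        using span_exchange[of b x "S - {b}"] assms b False
          by (auto simp: indep_def simp del: insert_Diff_single)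
      then show False using assms b False by (simp add: insert_absorb)
    qed
  qed
qed

text \<open>
  The vectors of \<open>S\<close> are traded one by one for vectors of \<open>T\<close> without enlarging the spanning set. The two
  lemmas after it are the forms in which this is used: an independent set in a span is at most as
  large as the spanning set, and spans the same space if it is as large.
\<close>

lemma steinitz_exchange:
  assumes "finite S" "indep S" "finite T" "T \<subseteq> carrier V" "S \<subseteq> span T"
  shows "\<exists>T'. finite T' \<and> T' \<subseteq> carrier V \<and> card T' \<le> card T \<and> S \<subseteq> T' \<and> span T \<subseteq> span T'"
  using assms(1,2,5)
proof induction
  case empty
  then show ?case using assms by blast
next
  case (insert s S)
  then obtain T' where T': "finite T'" "T' \<subseteq> carrier V" "card T' \<le> card T" "S \<subseteq> T'" "span T \<subseteq> span T'"
    using indep_subset[of "insert s S" S] by auto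
  have s: "s \<in> carrier V" "s \<in> span T'" "s \<notin> span S"
    using insert T' by (auto simp: indep_def)
  \<comment> \<open>A minimal part of \<open>T'\<close> that contains \<open>S\<close> and spans \<open>s\<close> shows which vector \<open>t\<close> to trade for \<open>s\<close>.\<close>
  define Qs where "Qs = {Q. S \<subseteq> Q \<and> Q \<subseteq> T' \<and> s \<in> span Q}"
  have "finite Qs" "Qs \<noteq> {}"
    using s T' by (auto simp: Qs_def intro: finite_subset[of _ "Pow T'"])
  then obtain Q where Q: "Q \<in> Qs" "\<And>Q'. Q' \<in> Qs \<Longrightarrow> Q' \<subseteq> Q \<Longrightarrow> Q' = Q"
    by (metis finite_has_minimal)
  then have "S \<subseteq> Q" "s \<in> span Q" by (auto simp: Qs_def)
  then have "Q \<noteq> S" using s by blast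
  with \<open>S \<subseteq> Q\<close> obtain t where t: "t \<in> Q" "t \<notin> S" by blast
  have sub: "insert s (insert t (Q - {t})) \<subseteq> carrier V" using s t T' Q(1) unfolding Qs_def by blast
  have "s \<notin> span (Q - {t})"
  proof
    assume "s \<in> span (Q - {t})"
    then have "Q - {t} \<in> Qs" using Q(1) t by (auto simp: Qs_def)
    with Q(2)[of "Q - {t}"] t show False by blast
  qed
  moreover have "s \<in> span (insert t (Q - {t}))" using Q(1) t by (simp add: insert_absorb Qs_def)
  ultimately have "t \<in> span (insert s (Q - {t}))"
    using span_exchange[OF sub] by blast
  moreover have "Q \<subseteq> T'" using Q(1) by (auto simp: Qs_def)
  ultimately have tin: "t \<in> span (insert s (T' - {t}))"
    using span_mono[of "insert s (Q - {t})" "insert s (T' - {t})"] by auto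
  let ?T = "insert s (T' - {t})"
  have "T' \<subseteq> insert t ?T" by auto
  then have "span T' \<subseteq> span ?T"
    using span_mono[of T' "insert t ?T"] span_insert_redundant[OF _ tin] s T' by auto
  moreover have "card ?T \<le> Suc (card (T' - {t}))" by (simp add: T' card_insert_if)
  then have "card ?T \<le> card T'" using T' \<open>Q \<subseteq> T'\<close> t card_Suc_Diff1[of T' t] by auto
  ultimately show ?case
    using T' s t by (intro exI[of _ ?T]) auto
qed

lemma indep_card_le:
  assumes "finite T" "T \<subseteq> carrier V" "indep S" "S \<subseteq> span T"
  shows "finite S" "card S \<le> card T"
proof -
  have *: "card S' \<le> card T" if S': "finite S'" "S' \<subseteq> S" for S'
  proof -
    obtain T' where "finite T'" "card T' \<le> card T" "S' \<subseteq> T'"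
      using steinitz_exchange[of S' T] S' assms indep_subset[of S S'] by auto
    then show ?thesis using card_mono[of T' S'] by simp
  qed
  show "finite S"
  proof (rule ccontr)
    assume "infinite S"
    then obtain S' where "S' \<subseteq> S" "finite S'" "card S' = Suc (card T)"
      using infinite_arbitrarily_large by blast
    then show False using *[of S'] by simp
  qed
  then show "card S \<le> card T" using * by blast
qed

lemma indep_spans:
  assumes "finite T" "T \<subseteq> carrier V" "indep S" "S \<subseteq> span T" "card T \<le> card S"
  shows "span S = span T"
proof -
  have fin: "finite S" using indep_card_le assms by blast
  then obtain T' where T': "finite T'" "card T' \<le> card T" "S \<subseteq> T'" "span T \<subseteq> span T'"
    using steinitz_exchange[of S T] assms by blast
  then have "S = T'" using assms card_seteq[of T' S] by simp
  then show ?thesis using T' span_least[OF span_submodule[OF assms(2)] assms(4)] by auto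
qed

end

lemma linear_eq_on_span:
  assumes "vspace K V" "vspace K W" "f \<in> linear_maps K V W" "g \<in> linear_maps K V W"
    and "S \<subseteq> carrier V" "\<And>x. x \<in> S \<Longrightarrow> f x = g x" "x \<in> lin_span K V S"
  shows "f x = g x"
proof -
  interpret V: vspace K V by fact
  have "submodule {x \<in> carrier V. f x = g x} K V"
    by (rule V.submodule_minus_freeI)
      (auto simp: linear_map_zero[OF assms(1,2,3)] linear_map_zero[OF assms(1,2,4)]
        linear_map_add[OF assms(3)] linear_map_add[OF assms(4)]
        linear_map_smult[OF assms(3)] linear_map_smult[OF assms(4)])
  moreover have "S \<subseteq> {x \<in> carrier V. f x = g x}" using assms(5,6) by auto
  ultimately show ?thesis using V.span_least assms(7) by blast
qed

lemma linear_vanishes_on_span: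
  assumes "vspace K V" "vspace K W" "f \<in> linear_maps K V W"
    and "S \<subseteq> carrier V" "\<And>x. x \<in> S \<Longrightarrow> f x = \<zero>\<^bsub>W\<^esub>" "x \<in> lin_span K V S"
  shows "f x = \<zero>\<^bsub>W\<^esub>"
proof -
  interpret W: vspace K W by fact
  have "(\<lambda>_. \<zero>\<^bsub>W\<^esub>) \<in> linear_maps K V W" by (rule linear_mapsI) simp_all
  from linear_eq_on_span[OF assms(1-3) this assms(4-6)] show ?thesis .
qed

section \<open>Dual spaces\<close>

lemma (in abelian_group) diff_eq_zero_iff:
  "x \<in> carrier G \<Longrightarrow> y \<in> carrier G \<Longrightarrow> x \<ominus> y = \<zero> \<longleftrightarrow> x = y"
  by (metis minus_equality minus_minus r_neg a_minus_def a_inv_closed)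

lemma scalar_space_simps [simp]:
  "carrier (scalar_space K) = carrier K" "zero (scalar_space K) = zero K"
  "add (scalar_space K) = add K" "smult (scalar_space K) = mult K"
  by (simp_all add: scalar_space_def)

lemma scalar_space_vspace:
  assumes "field K" shows "vspace K (scalar_space K)"
proof -
  interpret field K by fact
  have "abelian_group (scalar_space K)"
    by (rule abelian_groupI) (auto simp: a_ac intro: bexI[of _ "\<ominus>\<^bsub>K\<^esub> _"] l_neg)
  then have "module K (scalar_space K)"
    by (intro moduleI is_cring) (auto simp: l_distr r_distr m_assoc)
  then show ?thesis by (rule vspace.intro) (rule field_axioms)
qed

lemma dual_space_simps:
  "zero (dual_space K V) = (\<lambda>x\<in>carrier V. \<zero>\<^bsub>K\<^esub>)"
  "add (dual_space K V) = (\<lambda>f g. \<lambda>x\<in>carrier V. f x \<oplus>\<^bsub>K\<^esub> g x)"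
  "smult (dual_space K V) = (\<lambda>a f. \<lambda>x\<in>carrier V. a \<otimes>\<^bsub>K\<^esub> f x)"
  by (simp_all add: dual_space_def)

lemma dual_space_apply [simp]:
  "x \<in> carrier V \<Longrightarrow> \<zero>\<^bsub>dual_space K V\<^esub> x = \<zero>\<^bsub>K\<^esub>"
  "x \<in> carrier V \<Longrightarrow> (f \<oplus>\<^bsub>dual_space K V\<^esub> g) x = f x \<oplus>\<^bsub>K\<^esub> g x"
  "x \<in> carrier V \<Longrightarrow> (a \<odot>\<^bsub>dual_space K V\<^esub> f) x = a \<otimes>\<^bsub>K\<^esub> f x"
  by (simp_all add: dual_space_simps)

lemma dual_space_carrier:
  "f \<in> carrier (dual_space K V) \<longleftrightarrow>
    f \<in> linear_maps K V (scalar_space K) \<and> f \<in> extensional (carrier V)"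
  by (simp add: dual_space_def)

context vspace
begin

abbreviation functionals :: "('c \<Rightarrow> 'a) set"
  where "functionals \<equiv> carrier (dual_space K V)"

lemma scalars: "vspace K (scalar_space K)"
  by (rule scalar_space_vspace) (rule field_axioms)

lemma functionalI:
  assumes "\<And>x. x \<in> carrier V \<Longrightarrow> f x \<in> carrier K"
    and "\<And>x y. x \<in> carrier V \<Longrightarrow> y \<in> carrier V \<Longrightarrow> f (x \<oplus>\<^bsub>V\<^esub> y) = f x \<oplus> f y"
    and "\<And>a x. a \<in> carrier K \<Longrightarrow> x \<in> carrier V \<Longrightarrow> f (a \<odot>\<^bsub>V\<^esub> x) = a \<otimes> f x"
  shows "restrict f (carrier V) \<in> functionals"
  using assms by (auto simp: dual_space_carrier intro!: linear_mapsI)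

lemma functional_restrict: "f \<in> linear_maps K V (scalar_space K) \<Longrightarrow> restrict f (carrier V) \<in> functionals"
  by (rule functionalI) (auto simp: linear_maps_def)

lemma functional_linear: "f \<in> functionals \<Longrightarrow> f \<in> linear_maps K V (scalar_space K)"
  by (simp add: dual_space_carrier)

lemma functional_closed [simp]: "f \<in> functionals \<Longrightarrow> x \<in> carrier V \<Longrightarrow> f x \<in> carrier K"
  using linear_map_closed[OF functional_linear] by simp

lemma functional_add: "f \<in> functionals \<Longrightarrow> x \<in> carrier V \<Longrightarrow> y \<in> carrier V \<Longrightarrow>
    f (x \<oplus>\<^bsub>V\<^esub> y) = f x \<oplus> f y"
  using linear_map_add[OF functional_linear] by simp

lemma functional_smult: "f \<in> functionals \<Longrightarrow> a \<in> carrier K \<Longrightarrow> x \<in> carrier V \<Longrightarrow>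
    f (a \<odot>\<^bsub>V\<^esub> x) = a \<otimes> f x"
  using linear_map_smult[OF functional_linear] by simp

lemma functional_zero: "f \<in> functionals \<Longrightarrow> f \<zero>\<^bsub>V\<^esub> = \<zero>"
  using linear_map_zero[OF vspace_axioms scalars functional_linear] by simp

lemma functional_minus: "f \<in> functionals \<Longrightarrow> x \<in> carrier V \<Longrightarrow> y \<in> carrier V \<Longrightarrow>
    f (x \<ominus>\<^bsub>V\<^esub> y) = f x \<ominus> f y"
  using linear_map_minus[OF vspace_axioms scalars functional_linear]
  by (simp add: a_minus_def a_inv_def m_inv_def)

lemma functional_ext: "f \<in> functionals \<Longrightarrow> g \<in> functionals \<Longrightarrow>
    (\<And>x. x \<in> carrier V \<Longrightarrow> f x = g x) \<Longrightarrow> f = g"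
  by (auto simp: dual_space_carrier intro: extensionalityI)

lemma dual_space_vspace: "vspace K (dual_space K V)"
proof -
  note [simp] = functional_add functional_smult functional_zero
  have "abelian_group (dual_space K V)"
  proof (rule abelian_groupI)
    fix f assume f: "f \<in> functionals"
    then have "(\<lambda>x\<in>carrier V. \<ominus> f x) \<in> functionals"
      by (intro functionalI) (auto simp: R.minus_add R.r_minus)
    then show "\<exists>g\<in>functionals. g \<oplus>\<^bsub>dual_space K V\<^esub> f = \<zero>\<^bsub>dual_space K V\<^esub>"
      by (rule bexI[rotated]) (use f in \<open>auto simp: dual_space_simps restrict_def R.l_neg fun_eq_iff\<close>)
  next
    fix f g assume "f \<in> functionals" "g \<in> functionals"
    then show "f \<oplus>\<^bsub>dual_space K V\<^esub> g \<in> functionals"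
      unfolding dual_space_simps by (intro functionalI) (auto simp: R.a_ac R.r_distr)
  next
    show "\<zero>\<^bsub>dual_space K V\<^esub> \<in> functionals"
      unfolding dual_space_simps by (intro functionalI) auto
  qed (auto simp: dual_space_simps R.a_ac restrict_def fun_eq_iff dual_space_carrier[of _ K V] extensional_def
      dest: linear_map_closed)
  then have "module K (dual_space K V)"
  proof (intro moduleI is_cring)
    fix a f assume "a \<in> carrier K" "f \<in> functionals"
    then show "a \<odot>\<^bsub>dual_space K V\<^esub> f \<in> functionals"
      unfolding dual_space_simps by (intro functionalI) (auto simp: R.r_distr R.m_ac)
  qed (auto simp: dual_space_simps R.l_distr R.r_distr R.m_assoc restrict_def fun_eq_iff dual_space_carrier[of _ K V]
      extensional_def dest: linear_map_closed)
  then show ?thesis by (rule vspace.intro) (rule field_axioms)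
qed

lemma eval_linear: "x \<in> carrier V \<Longrightarrow> (\<lambda>f. f x) \<in> linear_maps K (dual_space K V) (scalar_space K)"
  by (rule linear_mapsI) auto

lemma field_inverse: "a \<in> carrier K \<Longrightarrow> a \<noteq> \<zero> \<Longrightarrow> \<exists>b\<in>carrier K. b \<otimes> a = \<one>"
  using field_Units by (intro bexI[of _ "inv\<^bsub>K\<^esub> a"]) auto

lemma span_of_submodule: "submodule H K V \<Longrightarrow> span H = H"
  using span_least[of H H] span_superset by blast

text \<open>
  By Zorn there is a subspace \<open>H\<close> that is maximal among those containing \<open>W\<close> and missing \<open>x\<close>. Maximality
  and the exchange property make \<open>x\<close> span a complement of \<open>H\<close>, and the functional reads off the
  coefficient of \<open>x\<close>.
\<close>

lemma separating_functional:
  assumes W: "submodule W K V" and x: "x \<in> carrier V" "x \<notin> W"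
  shows "\<exists>f\<in>functionals. (\<forall>w\<in>W. f w = \<zero>) \<and> f x = \<one>"
proof -
  define Hs where "Hs = {H. submodule H K V \<and> W \<subseteq> H \<and> x \<notin> H}"
  have "\<exists>H\<in>Hs. \<forall>X\<in>Hs. H \<subseteq> X \<longrightarrow> X = H"
  proof (rule subset_Zorn_nonempty)
    show "Hs \<noteq> {}" using assms by (auto simp: Hs_def)
  next
    fix C assume C: "C \<noteq> {}" "subset.chain Hs C"
    have sub: "submodule H K V" if "H \<in> C" for H
      using that C by (auto simp: subset.chain_def Hs_def)
    have "submodule (\<Union>C) K V"
    proof (rule submodule_minus_freeI)
      show "\<Union>C \<subseteq> carrier V" using submoduleE(1)[OF sub] by blast
      show "\<zero>\<^bsub>V\<^esub> \<in> \<Union>C" using C(1) submodule_zero[OF sub] by blast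
    next
      fix u v assume "u \<in> \<Union>C" "v \<in> \<Union>C"
      then obtain H where "H \<in> C" "u \<in> H" "v \<in> H" using C(2) unfolding subset.chain_def by blast
      then show "u \<oplus>\<^bsub>V\<^esub> v \<in> \<Union>C" using submoduleE(5)[OF sub] by blast
    qed (use submoduleE(4)[OF sub] in blast)
    then show "\<Union>C \<in> Hs" using C by (auto simp: subset.chain_def Hs_def)
  qed
  then obtain H where H: "submodule H K V" "W \<subseteq> H" "x \<notin> H"
    and max: "\<And>X. submodule X K V \<Longrightarrow> H \<subseteq> X \<Longrightarrow> x \<notin> X \<Longrightarrow> X = H"
    by (auto simp: Hs_def)
  note Hc = submoduleE(1)[OF H(1)]
  have decomp: "\<exists>a h. a \<in> carrier K \<and> h \<in> H \<and> y = a \<odot>\<^bsub>V\<^esub> x \<oplus>\<^bsub>V\<^esub> h" if y: "y \<in> carrier V" for y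
  proof -
    have sub: "insert x (insert y H) \<subseteq> carrier V" "insert x H \<subseteq> carrier V" using Hc x y by auto
    have "y \<in> span (insert x H)"
    proof (cases "y \<in> H")
      case True
      then show ?thesis by (simp add: span_superset)
    next
      case False
      have "submodule (span (insert y H)) K V" using sub by (intro span_submodule) simp
      moreover have "H \<subseteq> span (insert y H)" "y \<in> span (insert y H)" by (auto intro: span_superset)
      ultimately have "x \<in> span (insert y H)" using max False by blast
      then show ?thesis using H(3) span_exchange[OF sub(1)] span_of_submodule[OF H(1)] by simp
    qed
    then show ?thesis using span_insert[OF sub(2)] span_of_submodule[OF H(1)] by auto
  qed
  have unique: "a = b" if ab: "a \<in> carrier K" "b \<in> carrier K" "h \<in> H" "k \<in> H"
    "a \<odot>\<^bsub>V\<^esub> x \<oplus>\<^bsub>V\<^esub> h = b \<odot>\<^bsub>V\<^esub> x \<oplus>\<^bsub>V\<^esub> k" for a b h k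
  proof (rule ccontr)
    assume "a \<noteq> b"
    then have "a \<ominus> b \<noteq> \<zero>" using that by (simp add: R.diff_eq_zero_iff)
    then obtain c where c: "c \<in> carrier K" "c \<otimes> (a \<ominus> b) = \<one>"
      using field_inverse[of "a \<ominus> b"] R.minus_closed[of a b] ab by auto
    have hk: "h \<in> carrier V" "k \<in> carrier V" using that Hc by auto
    have "(a \<ominus> b) \<odot>\<^bsub>V\<^esub> x \<oplus>\<^bsub>V\<^esub> h = \<ominus>\<^bsub>V\<^esub> (b \<odot>\<^bsub>V\<^esub> x) \<oplus>\<^bsub>V\<^esub> (a \<odot>\<^bsub>V\<^esub> x \<oplus>\<^bsub>V\<^esub> h)"
      using ab(1,2) x hk by (simp add: a_minus_def smult_l_distr smult_l_minus M.a_ac)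
    also have "\<dots> = k"
      unfolding ab(5) using ab(1,2) x hk by (simp add: M.l_neg flip: M.a_assoc)
    finally have "(a \<ominus> b) \<odot>\<^bsub>V\<^esub> x \<in> H"
      using submodule_cancel[OF H(1), of "(a \<ominus> b) \<odot>\<^bsub>V\<^esub> x" h] that x by simp
    then have "c \<odot>\<^bsub>V\<^esub> ((a \<ominus> b) \<odot>\<^bsub>V\<^esub> x) \<in> H" using c submoduleE(4)[OF H(1)] by blast
    then show False using c x H(3) that by (simp flip: smult_assoc1)
  qed
  define f where "f y = (THE a. a \<in> carrier K \<and> (\<exists>h\<in>H. y = a \<odot>\<^bsub>V\<^esub> x \<oplus>\<^bsub>V\<^esub> h))" for y
  have f_eq: "f (a \<odot>\<^bsub>V\<^esub> x \<oplus>\<^bsub>V\<^esub> h) = a" if "a \<in> carrier K" "h \<in> H" for a h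
    unfolding f_def by (rule the_equality) (use that unique in blast)+
  have "restrict f (carrier V) \<in> functionals"
  proof (rule functionalI)
    fix y assume "y \<in> carrier V"
    then obtain a h where "a \<in> carrier K" "h \<in> H" "y = a \<odot>\<^bsub>V\<^esub> x \<oplus>\<^bsub>V\<^esub> h"
      using decomp by metis
    then show "f y \<in> carrier K" using f_eq by simp
  next
    fix y z assume "y \<in> carrier V" "z \<in> carrier V"
    then obtain a h b k where *: "a \<in> carrier K" "h \<in> H" "b \<in> carrier K" "k \<in> H"
      "y = a \<odot>\<^bsub>V\<^esub> x \<oplus>\<^bsub>V\<^esub> h" "z = b \<odot>\<^bsub>V\<^esub> x \<oplus>\<^bsub>V\<^esub> k"
      using decomp by metis
    then have "h \<in> carrier V" "k \<in> carrier V" using Hc by auto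
    then have "y \<oplus>\<^bsub>V\<^esub> z = (a \<oplus> b) \<odot>\<^bsub>V\<^esub> x \<oplus>\<^bsub>V\<^esub> (h \<oplus>\<^bsub>V\<^esub> k)"
      using * x by (simp add: smult_l_distr M.a_ac)
    then show "f (y \<oplus>\<^bsub>V\<^esub> z) = f y \<oplus> f z"
      using * f_eq submoduleE(5)[OF H(1)] by simp
  next
    fix c y assume c: "c \<in> carrier K" and "y \<in> carrier V"
    then obtain a h where *: "a \<in> carrier K" "h \<in> H" "y = a \<odot>\<^bsub>V\<^esub> x \<oplus>\<^bsub>V\<^esub> h"
      using decomp by metis
    then have "h \<in> carrier V" using Hc by auto
    then have "c \<odot>\<^bsub>V\<^esub> y = (c \<otimes> a) \<odot>\<^bsub>V\<^esub> x \<oplus>\<^bsub>V\<^esub> c \<odot>\<^bsub>V\<^esub> h"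
      using * x c by (simp add: smult_r_distr smult_assoc1)
    then show "f (c \<odot>\<^bsub>V\<^esub> y) = c \<otimes> f y"
      using * c f_eq submoduleE(4)[OF H(1)] by simp
  qed
  moreover have "f w = \<zero>" if "w \<in> W" for w
    using f_eq[of "\<zero>" w] that H(2) Hc x by (auto simp: subset_iff)
  moreover have "f x = \<one>"
    using f_eq[of "\<one>" "\<zero>\<^bsub>V\<^esub>"] submodule_zero[OF H(1)] x by simp
  ultimately show ?thesis
    using x submoduleE(1)[OF W] by (intro bexI[of _ "restrict f (carrier V)"]) auto
qed

lemma functionals_separate_zero:
  assumes "x \<in> carrier V" "\<And>f. f \<in> functionals \<Longrightarrow> f x = \<zero>"
  shows "x = \<zero>\<^bsub>V\<^esub>"
proof (rule ccontr)
  assume "x \<noteq> \<zero>\<^bsub>V\<^esub>"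
  then obtain f where "f \<in> functionals" "f x = \<one>"
    using separating_functional[of "span {}" x] span_submodule[of "{}"] assms span_empty by auto
  then show False using assms(2)[of f] by simp
qed

lemma functionals_separate:
  assumes "x \<in> carrier V" "y \<in> carrier V" "\<And>f. f \<in> functionals \<Longrightarrow> f x = f y"
  shows "x = y"
  proof -
  have "f (x \<ominus>\<^bsub>V\<^esub> y) = \<zero>" if "f \<in> functionals" for f
    using assms(3)[OF that] that assms(1,2) by (simp add: functional_minus R.diff_eq_zero_iff)
  then show ?thesis using functionals_separate_zero[of "x \<ominus>\<^bsub>V\<^esub> y"] assms by (simp add: M.diff_eq_zero_iff)
qed

text \<open>
  The common kernel of finitely many functionals has finite codimension: each new functional that
  does not already vanish on the common kernel of the previous ones costs one more vector. This is
  used for \<open>V = C\<close>, and with evaluations as functionals for the dual of \<open>C\<close>.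
\<close>

lemma finite_functionals_interpolate:
  assumes "finite F" "F \<subseteq> linear_maps K V (scalar_space K)"
  shows "\<exists>S. finite S \<and> S \<subseteq> carrier V \<and> (\<forall>x\<in>carrier V. \<exists>s\<in>span S. \<forall>f\<in>F. f x = f s)"
  using assms
proof induction
  case empty
  then show ?case using span_superset submodule_zero[OF span_submodule[of "{}"]] by (intro exI[of _ "{}"]) auto
next
  case (insert g F)
  then obtain S where S: "finite S" "S \<subseteq> carrier V"
    and Sx: "\<And>x. x \<in> carrier V \<Longrightarrow> \<exists>s\<in>span S. \<forall>f\<in>F. f x = f s" by auto
  have lin: "f \<in> linear_maps K V (scalar_space K)" if "f \<in> insert g F" for f using insert that by blast
  note add = linear_map_add[OF lin, unfolded scalar_space_simps]
    and smult = linear_map_smult[OF lin, unfolded scalar_space_simps]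
    and minus = linear_map_minus[OF vspace_axioms scalars lin]
    and closed = linear_map_closed[OF lin, unfolded scalar_space_simps]
  show ?case
  proof (cases "\<exists>n\<in>carrier V. (\<forall>f\<in>F. f n = \<zero>) \<and> g n \<noteq> \<zero>")
    case False
    have gs: "g x = g s" if x: "x \<in> carrier V" "s \<in> span S" "\<forall>f\<in>F. f x = f s" for x s
    proof -
      have s: "s \<in> carrier V" using x S span_closed by blast
      have eq: "f (x \<ominus>\<^bsub>V\<^esub> s) = f x \<ominus> f s" if "f \<in> insert g F" for f
        using minus[of f x s] that x s by (simp add: a_minus_def a_inv_def m_inv_def)
      then have "\<forall>f\<in>F. f (x \<ominus>\<^bsub>V\<^esub> s) = \<zero>" 
      using eq x(3) s closed by (metis R.diff_eq_zero_iff insertI2)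
      then have "g (x \<ominus>\<^bsub>V\<^esub> s) = \<zero>" using False x s by blast
      then show ?thesis using eq[of g] closed[of g] x s by (simp add: R.diff_eq_zero_iff)
    qed
    have "\<exists>s\<in>span S. \<forall>f\<in>insert g F. f x = f s" if x: "x \<in> carrier V" for x
    proof -
      obtain s where s: "s \<in> span S" "\<forall>f\<in>F. f x = f s" using Sx[OF x] by blast
      then show ?thesis using gs[OF x s] by (intro bexI[of _ s]) simp_all
    qed
    then show ?thesis using S by (intro exI[of _ S]) simp
  next
    case True
    then obtain n where n: "n \<in> carrier V" "\<forall>f\<in>F. f n = \<zero>" "g n \<noteq> \<zero>" by blast
    obtain b where b: "b \<in> carrier K" "b \<otimes> g n = \<one>"
      using field_inverse[of "g n"] n closed by auto
    have "\<exists>s\<in>span (insert n S). \<forall>f\<in>insert g F. f x = f s" if x: "x \<in> carrier V" for x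
    proof -
      obtain s where s: "s \<in> span S" "\<forall>f\<in>F. f x = f s" using Sx x by blast
      have sc: "s \<in> carrier V" using s S span_closed by blast
      define a where "a = (g x \<ominus> g s) \<otimes> b"
      have a: "a \<in> carrier K" "a \<otimes> g n = g x \<ominus> g s"
        using b closed[of g] x sc n by (auto simp: a_def R.m_assoc)
      have f_eq: "f (a \<odot>\<^bsub>V\<^esub> n \<oplus>\<^bsub>V\<^esub> s) = a \<otimes> f n \<oplus> f s" if "f \<in> insert g F" for f
        using add[OF that, of "a \<odot>\<^bsub>V\<^esub> n" s] smult[OF that, of a n] a n sc by simp
      have "\<forall>f\<in>insert g F. f x = f (a \<odot>\<^bsub>V\<^esub> n \<oplus>\<^bsub>V\<^esub> s)"
      proof
        fix f assume f: "f \<in> insert g F"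
        show "f x = f (a \<odot>\<^bsub>V\<^esub> n \<oplus>\<^bsub>V\<^esub> s)"
        proof (cases "f \<in> F")
          case True
          then show ?thesis using f_eq[OF f] bspec[OF n(2) True] bspec[OF s(2) True] a(1) closed[OF f sc] by simp
        next
          case False
          then have "f = g" using f by simp
          then show ?thesis
            using f_eq[OF f] a(2) closed[OF f sc] closed[OF f x] by (simp add: a_minus_def R.a_assoc R.l_neg)
        qed
      qed
      moreover have "a \<odot>\<^bsub>V\<^esub> n \<oplus>\<^bsub>V\<^esub> s \<in> span (insert n S)"
        using span_insert[of n S] a s n S by auto
      ultimately show ?thesis by blast
    qed
    then show ?thesis using S n by (intro exI[of _ "insert n S"]) auto
  qed
qed

text \<open>
  A functional on the dual that kills the annihilator of a finite set \<open>T\<close> comes from a vector. Each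
  element \<open>t\<close> of \<open>T\<close> is removed by subtracting a multiple of the evaluation at \<open>t\<close>.
\<close>

lemma evaluation_of_finitely_supported:
  assumes "finite T" "T \<subseteq> carrier V" "\<phi> \<in> linear_maps K (dual_space K V) (scalar_space K)"
    "\<And>f. f \<in> functionals \<Longrightarrow> (\<And>t. t \<in> T \<Longrightarrow> f t = \<zero>) \<Longrightarrow> \<phi> f = \<zero>"
  shows "\<exists>c\<in>carrier V. \<forall>f\<in>functionals. \<phi> f = f c"
  using assms
proof (induction T arbitrary: \<phi>)
  case empty
  then show ?case by (intro bexI[of _ "\<zero>\<^bsub>V\<^esub>"]) (auto simp: functional_zero)
next
  case (insert t T)
  interpret D: vspace K "dual_space K V" by (rule dual_space_vspace)
  note lin = insert.prems(2)
  note closed = linear_map_closed[OF lin, simplified]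
  have t: "t \<in> carrier V" using insert by simp
  show ?case
  proof (cases "\<exists>f\<in>functionals. (\<forall>s\<in>T. f s = \<zero>) \<and> f t \<noteq> \<zero>")
    case False
    then have "\<phi> f = \<zero>" if "f \<in> functionals" "\<And>s. s \<in> T \<Longrightarrow> f s = \<zero>" for f
      using that insert.prems(3) by blast
    then show ?thesis using insert.IH[of \<phi>] insert.prems by blast
  next
    case True
    then obtain f0 where f0: "f0 \<in> functionals" "\<And>s. s \<in> T \<Longrightarrow> f0 s = \<zero>" "f0 t \<noteq> \<zero>" by blast
    obtain b where b: "b \<in> carrier K" "b \<otimes> f0 t = \<one>"
      using field_inverse[of "f0 t"] f0 t by auto
    define c where "c = \<phi> f0 \<otimes> b"
    have c: "c \<in> carrier K" using b f0 closed by (simp add: c_def)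
    define \<psi> where "\<psi> f = \<phi> f \<oplus> \<ominus> (c \<otimes> f t)" for f
    have "\<psi> \<in> linear_maps K (dual_space K V) (scalar_space K)"
    proof (rule linear_mapsI)
      fix f g assume fg: "f \<in> functionals" "g \<in> functionals"
      then show "\<psi> (f \<oplus>\<^bsub>dual_space K V\<^esub> g) = \<psi> f \<oplus>\<^bsub>scalar_space K\<^esub> \<psi> g"
        using linear_map_add[OF lin fg] closed c t
        by (simp add: \<psi>_def R.r_distr R.minus_add R.a_ac)
    next
      fix a f assume af: "a \<in> carrier K" "f \<in> functionals"
      then show "\<psi> (a \<odot>\<^bsub>dual_space K V\<^esub> f) = a \<odot>\<^bsub>scalar_space K\<^esub> \<psi> f"
        using linear_map_smult[OF lin af] closed c t
        by (simp add: \<psi>_def R.r_distr R.r_minus R.m_lcomm)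
    qed (use closed c t in \<open>auto simp: \<psi>_def\<close>)
    moreover have "\<psi> f = \<zero>" if f: "f \<in> functionals" "\<And>s. s \<in> T \<Longrightarrow> f s = \<zero>" for f
    proof -
      let ?a = "\<ominus> (f t \<otimes> b)"
      let ?g = "f \<oplus>\<^bsub>dual_space K V\<^esub> ?a \<odot>\<^bsub>dual_space K V\<^esub> f0"
      have a: "?a \<in> carrier K" using f t b by simp
      have af0: "?a \<odot>\<^bsub>dual_space K V\<^esub> f0 \<in> functionals" using a f0 by blast
      have "?g \<in> functionals" using af0 f by blast
      moreover have "?g s = \<zero>" if "s \<in> insert t T" for s
        using that insert.prems(1) f f0 b t a
        by (auto simp: R.l_minus R.m_assoc R.r_neg subset_iff)
      ultimately have "\<phi> ?g = \<zero>" by (rule insert.prems(3))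
      moreover have "\<phi> ?g = \<phi> f \<oplus> ?a \<otimes> \<phi> f0"
        using linear_map_add[OF lin f(1) af0] linear_map_smult[OF lin a f0(1)] by simp
      moreover have "?a \<otimes> \<phi> f0 = \<ominus> (c \<otimes> f t)"
        using closed f0 f b t by (simp add: c_def R.l_minus R.r_minus R.m_ac)
      ultimately show ?thesis by (simp add: \<psi>_def)
    qed
    ultimately obtain d where d: "d \<in> carrier V" "\<forall>f\<in>functionals. \<psi> f = f d"
      using insert.IH[of \<psi>] insert.prems(1) by auto
    have "\<phi> f = f (d \<oplus>\<^bsub>V\<^esub> c \<odot>\<^bsub>V\<^esub> t)" if f: "f \<in> functionals" for f
    proof -
      have "f d = \<phi> f \<oplus> \<ominus> (c \<otimes> f t)" using d f by (simp add: \<psi>_def)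
      then show ?thesis using f d c t closed by (simp add: functional_add functional_smult R.a_assoc R.l_neg)
    qed
    then show ?thesis using d c t by blast
  qed
qed

end

section \<open>Tensor products\<close>

definition bilinear_maps ::
  "('k, 'e) ring_scheme \<Rightarrow> ('k, 'v, 'm) module_scheme \<Rightarrow> ('k, 'w, 'n) module_scheme \<Rightarrow>
    ('k, 'u, 'l) module_scheme \<Rightarrow> ('v \<Rightarrow> 'w \<Rightarrow> 'u) set"
  where "bilinear_maps K V W U =
    {\<beta>. (\<forall>v\<in>carrier V. \<beta> v \<in> linear_maps K W U) \<and>
        (\<forall>w\<in>carrier W. (\<lambda>v. \<beta> v w) \<in> linear_maps K V U)}"

lemma bilinear_mapsI:
  assumes "\<And>v w. v \<in> carrier V \<Longrightarrow> w \<in> carrier W \<Longrightarrow> \<beta> v w \<in> carrier U"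
    and "\<And>v v' w. v \<in> carrier V \<Longrightarrow> v' \<in> carrier V \<Longrightarrow> w \<in> carrier W \<Longrightarrow>
      \<beta> (v \<oplus>\<^bsub>V\<^esub> v') w = \<beta> v w \<oplus>\<^bsub>U\<^esub> \<beta> v' w"
    and "\<And>v w w'. v \<in> carrier V \<Longrightarrow> w \<in> carrier W \<Longrightarrow> w' \<in> carrier W \<Longrightarrow>
      \<beta> v (w \<oplus>\<^bsub>W\<^esub> w') = \<beta> v w \<oplus>\<^bsub>U\<^esub> \<beta> v w'"
    and "\<And>a v w. a \<in> carrier K \<Longrightarrow> v \<in> carrier V \<Longrightarrow> w \<in> carrier W \<Longrightarrow>
      \<beta> (a \<odot>\<^bsub>V\<^esub> v) w = a \<odot>\<^bsub>U\<^esub> \<beta> v w"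
    and "\<And>a v w. a \<in> carrier K \<Longrightarrow> v \<in> carrier V \<Longrightarrow> w \<in> carrier W \<Longrightarrow>
      \<beta> v (a \<odot>\<^bsub>W\<^esub> w) = a \<odot>\<^bsub>U\<^esub> \<beta> v w"
  shows "\<beta> \<in> bilinear_maps K V W U"
  using assms by (auto simp: bilinear_maps_def intro!: linear_mapsI)

lemma bilinear_mapsD:
  assumes "\<beta> \<in> bilinear_maps K V W U"
  shows "v \<in> carrier V \<Longrightarrow> w \<in> carrier W \<Longrightarrow> \<beta> v w \<in> carrier U"
    and "v \<in> carrier V \<Longrightarrow> v' \<in> carrier V \<Longrightarrow> w \<in> carrier W \<Longrightarrow>
      \<beta> (v \<oplus>\<^bsub>V\<^esub> v') w = \<beta> v w \<oplus>\<^bsub>U\<^esub> \<beta> v' w"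
    and "v \<in> carrier V \<Longrightarrow> w \<in> carrier W \<Longrightarrow> w' \<in> carrier W \<Longrightarrow>
      \<beta> v (w \<oplus>\<^bsub>W\<^esub> w') = \<beta> v w \<oplus>\<^bsub>U\<^esub> \<beta> v w'"
    and "a \<in> carrier K \<Longrightarrow> v \<in> carrier V \<Longrightarrow> w \<in> carrier W \<Longrightarrow>
      \<beta> (a \<odot>\<^bsub>V\<^esub> v) w = a \<odot>\<^bsub>U\<^esub> \<beta> v w"
    and "a \<in> carrier K \<Longrightarrow> v \<in> carrier V \<Longrightarrow> w \<in> carrier W \<Longrightarrow>
      \<beta> v (a \<odot>\<^bsub>W\<^esub> w) = a \<odot>\<^bsub>U\<^esub> \<beta> v w"
  using assms by (auto simp: bilinear_maps_def linear_maps_def)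

lemma tensor_eq_swap:
  assumes "tensor_eq K V W xs ys" "vspace K V" "vspace K W"
  shows "tensor_eq K W V (map prod.swap xs) (map prod.swap ys)"
proof -
  interpret V: vspace K V by fact
  interpret W: vspace K W by fact
  show ?thesis using assms(1)
  proof induction
    case (refl xs)
    then show ?case by (intro tensor_eq.refl) auto
  next
    case (commute xs ys)
    then show ?case by (simp, intro tensor_eq.commute) auto
  next
    case (balanced a v w)
    then show ?case by (auto intro: tensor_eq.sym tensor_eq.balanced)
  next
    case (zero_left w)
    have "tensor_eq K W V [(\<zero>\<^bsub>K\<^esub> \<odot>\<^bsub>W\<^esub> w, \<zero>\<^bsub>V\<^esub>)] [(w, \<zero>\<^bsub>K\<^esub> \<odot>\<^bsub>V\<^esub> \<zero>\<^bsub>V\<^esub>)]"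
      using zero_left by (intro tensor_eq.balanced) auto
    then have "tensor_eq K W V [(w, \<zero>\<^bsub>V\<^esub>)] [(\<zero>\<^bsub>W\<^esub>, \<zero>\<^bsub>V\<^esub>)]"
      using zero_left by (simp add: tensor_eq.sym)
    moreover have "tensor_eq K W V [(\<zero>\<^bsub>W\<^esub>, \<zero>\<^bsub>V\<^esub>)] []" by (rule tensor_eq.zero_left) simp
    ultimately show ?case by (auto intro: tensor_eq.trans)
  qed (auto intro: tensor_eq.intros)
qed

lemma tensor_eq_smult:
  assumes "tensor_eq K V W xs ys" "vspace K V" "vspace K W" "a \<in> carrier K"
  shows "tensor_eq K V W (map (\<lambda>(v, w). (a \<odot>\<^bsub>V\<^esub> v, w)) xs) (map (\<lambda>(v, w). (a \<odot>\<^bsub>V\<^esub> v, w)) ys)"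
proof -
  interpret V: vspace K V by fact
  interpret W: vspace K W by fact
  have reps: "map (\<lambda>(v, w). (a \<odot>\<^bsub>V\<^esub> v, w)) zs \<in> lists (carrier V \<times> carrier W)"
    if "zs \<in> lists (carrier V \<times> carrier W)" for zs
    using that assms(4) by (induction zs) auto
  show ?thesis using assms(1)
  proof induction
    case (refl xs)
    then show ?case by (intro tensor_eq.refl reps)
  next
    case (commute xs ys)
    then show ?case unfolding map_append by (intro tensor_eq.commute reps)
  next
    case (add_left v v' w)
    then show ?case using assms(4) by (simp add: V.smult_r_distr tensor_eq.add_left)
  next
    case (balanced b v w)
    then have "a \<odot>\<^bsub>V\<^esub> (b \<odot>\<^bsub>V\<^esub> v) = b \<odot>\<^bsub>V\<^esub> (a \<odot>\<^bsub>V\<^esub> v)"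
      using assms(4) by (simp add: V.R.m_comm flip: V.smult_assoc1)
    then show ?case using balanced assms(4) by (simp add: tensor_eq.balanced)
  qed (use assms(4) in \<open>auto intro: tensor_eq.intros\<close>)
qed

locale vspace_pair = V: vspace K V + W: vspace K W
  for K (structure) and V (structure) and W (structure)
begin

abbreviation reps where "reps \<equiv> lists (carrier V \<times> carrier W)"
abbreviation teq where "teq \<equiv> tensor_eq K V W"
abbreviation cls where "cls \<equiv> tensor_class K V W"
abbreviation VW where "VW \<equiv> tensor K V W"
abbreviation pure where "pure \<equiv> pure_tensor K V W"

lemma teq_reps: "teq xs ys \<Longrightarrow> xs \<in> reps \<and> ys \<in> reps"
  by (rule tensor_eq_lists) unfold_locales

lemma cls_eq_iff: "xs \<in> reps \<Longrightarrow> cls xs = cls ys \<longleftrightarrow> teq xs ys"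
  by (auto simp: tensor_class_def set_eq_iff intro: tensor_eq.sym tensor_eq.trans tensor_eq.refl)

lemma cls_eqI: "teq xs ys \<Longrightarrow> cls xs = cls ys"
  using cls_eq_iff teq_reps by blast

lemma cls_closed: "xs \<in> reps \<Longrightarrow> cls xs \<in> carrier VW"
  by (auto simp: tensor_def)

lemma tensorE:
  assumes "t \<in> carrier VW" obtains xs where "xs \<in> reps" "t = cls xs"
  using assms by (auto simp: tensor_def)

lemma tensor_add_cls: "xs \<in> reps \<Longrightarrow> ys \<in> reps \<Longrightarrow> cls xs \<oplus>\<^bsub>VW\<^esub> cls ys = cls (xs @ ys)"
proof -
  assume *: "xs \<in> reps" "ys \<in> reps"
  have "cls (xs' @ ys') = cls (xs @ ys)" if "teq xs xs'" "teq ys ys'" for xs' ys'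
    using that cls_eqI[OF tensor_eq.append] by blast
  then show ?thesis
    using * by (auto simp: tensor_def tensor_class_def[of K V W xs] tensor_class_def[of K V W ys]
        intro: tensor_eq.refl)
qed

lemma tensor_smult_cls: "a \<in> carrier K \<Longrightarrow> xs \<in> reps \<Longrightarrow>
    a \<odot>\<^bsub>VW\<^esub> cls xs = cls (map (\<lambda>(v, w). (a \<odot>\<^bsub>V\<^esub> v, w)) xs)"
proof -
  assume *: "a \<in> carrier K" "xs \<in> reps"
  let ?m = "map (\<lambda>(v, w). (a \<odot>\<^bsub>V\<^esub> v, w))"
  have "cls (?m xs') = cls (?m xs)" if "teq xs xs'" for xs'
    by (rule cls_eqI[symmetric], rule tensor_eq_smult[OF that _ _ *(1)]) unfold_locales
  then show ?thesis
    using * by (auto simp: tensor_def tensor_class_def[of K V W xs] intro: tensor_eq.refl)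
qed

lemma tensor_zero: "\<zero>\<^bsub>VW\<^esub> = cls []"
  by (simp add: tensor_def)

lemma pure_closed: "v \<in> carrier V \<Longrightarrow> w \<in> carrier W \<Longrightarrow> pure v w \<in> carrier VW"
  by (auto simp: pure_tensor_def intro: cls_closed)

lemma cls_Cons: "v \<in> carrier V \<Longrightarrow> w \<in> carrier W \<Longrightarrow> xs \<in> reps \<Longrightarrow>
    cls ((v, w) # xs) = pure v w \<oplus>\<^bsub>VW\<^esub> cls xs"
  by (simp add: pure_tensor_def tensor_add_cls)

lemma tensor_abelian_monoid: "abelian_monoid VW"
proof (rule abelian_monoidI)
  show "\<zero>\<^bsub>VW\<^esub> \<in> carrier VW" by (simp add: tensor_zero cls_closed)
next
  fix s t assume "s \<in> carrier VW" "t \<in> carrier VW"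
  then show "s \<oplus>\<^bsub>VW\<^esub> t \<in> carrier VW"
    by (elim tensorE) (simp add: tensor_add_cls cls_closed)
next
  fix s t u assume "s \<in> carrier VW" "t \<in> carrier VW" "u \<in> carrier VW"
  then show "s \<oplus>\<^bsub>VW\<^esub> t \<oplus>\<^bsub>VW\<^esub> u = s \<oplus>\<^bsub>VW\<^esub> (t \<oplus>\<^bsub>VW\<^esub> u)"
    by (elim tensorE) (simp add: tensor_add_cls)
next
  fix s t assume "s \<in> carrier VW" "t \<in> carrier VW"
  then show "s \<oplus>\<^bsub>VW\<^esub> t = t \<oplus>\<^bsub>VW\<^esub> s"
    by (elim tensorE) (simp add: tensor_add_cls cls_eqI tensor_eq.commute)
next
  fix s assume "s \<in> carrier VW"
  then show "\<zero>\<^bsub>VW\<^esub> \<oplus>\<^bsub>VW\<^esub> s = s"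
    by (elim tensorE) (simp add: tensor_zero tensor_add_cls)
qed

lemma tensor_induct [consumes 1, case_names zero add]:
  assumes "t \<in> carrier VW" "P \<zero>\<^bsub>VW\<^esub>"
    "\<And>v w t. v \<in> carrier V \<Longrightarrow> w \<in> carrier W \<Longrightarrow> t \<in> carrier VW \<Longrightarrow> P t \<Longrightarrow> P (pure v w \<oplus>\<^bsub>VW\<^esub> t)"
  shows "P t"
proof -
  obtain xs where "xs \<in> reps" "t = cls xs" using assms(1) by (rule tensorE)
  moreover have "P (cls xs)" using \<open>xs \<in> reps\<close>
  proof (induction xs)
    case Nil
    then show ?case using assms(2) by (simp add: tensor_zero)
  next
    case (Cons p xs)
    obtain v w where "p = (v, w)" by force
    then show ?case using Cons assms(3)[of v w "cls xs"] by (simp add: cls_Cons cls_closed)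
  qed
  ultimately show ?thesis by simp
qed

lemma pure_add_left: "v \<in> carrier V \<Longrightarrow> v' \<in> carrier V \<Longrightarrow> w \<in> carrier W \<Longrightarrow>
    pure (v \<oplus>\<^bsub>V\<^esub> v') w = pure v w \<oplus>\<^bsub>VW\<^esub> pure v' w"
  by (simp add: pure_tensor_def tensor_add_cls cls_eqI tensor_eq.add_left)

lemma pure_add_right: "v \<in> carrier V \<Longrightarrow> w \<in> carrier W \<Longrightarrow> w' \<in> carrier W \<Longrightarrow>
    pure v (w \<oplus>\<^bsub>W\<^esub> w') = pure v w \<oplus>\<^bsub>VW\<^esub> pure v w'"
  by (simp add: pure_tensor_def tensor_add_cls cls_eqI tensor_eq.add_right)

lemma pure_smult_left: "a \<in> carrier K \<Longrightarrow> v \<in> carrier V \<Longrightarrow> w \<in> carrier W \<Longrightarrow>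
    pure (a \<odot>\<^bsub>V\<^esub> v) w = a \<odot>\<^bsub>VW\<^esub> pure v w"
  by (simp add: pure_tensor_def tensor_smult_cls)

lemma pure_smult_right: "a \<in> carrier K \<Longrightarrow> v \<in> carrier V \<Longrightarrow> w \<in> carrier W \<Longrightarrow>
    pure v (a \<odot>\<^bsub>W\<^esub> w) = a \<odot>\<^bsub>VW\<^esub> pure v w"
  by (simp add: pure_tensor_def tensor_smult_cls cls_eqI tensor_eq.balanced tensor_eq.sym)

lemma pure_zero_left: "w \<in> carrier W \<Longrightarrow> pure \<zero>\<^bsub>V\<^esub> w = \<zero>\<^bsub>VW\<^esub>"
  by (simp add: pure_tensor_def tensor_zero cls_eqI tensor_eq.zero_left)

lemma tensor_vspace: "vspace K VW"
proof -
  interpret T: abelian_monoid VW by (rule tensor_abelian_monoid)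
  have m: "map (\<lambda>(v, w). (a \<odot>\<^bsub>V\<^esub> v, w)) zs \<in> reps" if "zs \<in> reps" "a \<in> carrier K" for a zs
    using that by (induction zs) auto
  have smult_closed: "a \<odot>\<^bsub>VW\<^esub> t \<in> carrier VW" if "a \<in> carrier K" "t \<in> carrier VW" for a t
    using that by (elim tensorE) (simp add: tensor_smult_cls cls_closed m del: in_lists_conv_set)
  have smult_add: "a \<odot>\<^bsub>VW\<^esub> (s \<oplus>\<^bsub>VW\<^esub> t) = a \<odot>\<^bsub>VW\<^esub> s \<oplus>\<^bsub>VW\<^esub> a \<odot>\<^bsub>VW\<^esub> t"
    if ast: "a \<in> carrier K" "s \<in> carrier VW" "t \<in> carrier VW" for a s t
  proof -
    obtain xs where xs: "xs \<in> reps" "s = cls xs" using ast(2) by (rule tensorE)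
    obtain ys where ys: "ys \<in> reps" "t = cls ys" using ast(3) by (rule tensorE)
    note * = xs ys
    have "xs @ ys \<in> reps" using * by simp
    then show ?thesis
      unfolding *(2,4) tensor_add_cls[OF *(1,3)] tensor_smult_cls[OF ast(1) *(1)]
        tensor_smult_cls[OF ast(1) *(3)] tensor_add_cls[OF m[OF *(1) ast(1)] m[OF *(3) ast(1)]]
      by (simp only: tensor_smult_cls[OF ast(1)] map_append)
  qed
  have smult_zero: "a \<odot>\<^bsub>VW\<^esub> \<zero>\<^bsub>VW\<^esub> = \<zero>\<^bsub>VW\<^esub>" if "a \<in> carrier K" for a
    using that by (simp add: tensor_zero tensor_smult_cls)
  have zero_smult: "\<zero>\<^bsub>K\<^esub> \<odot>\<^bsub>VW\<^esub> t = \<zero>\<^bsub>VW\<^esub>" if "t \<in> carrier VW" for t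
    using that
  proof (induction t rule: tensor_induct)
    case (add v w t)
    have "\<zero>\<^bsub>K\<^esub> \<odot>\<^bsub>VW\<^esub> pure v w = \<zero>\<^bsub>VW\<^esub>"
      using add pure_smult_left[of "\<zero>\<^bsub>K\<^esub>" v w] by (simp add: pure_zero_left)
    then show ?case using add by (simp add: smult_add pure_closed)
  qed (simp add: smult_zero)
  have l_distr: "(a \<oplus>\<^bsub>K\<^esub> b) \<odot>\<^bsub>VW\<^esub> t = a \<odot>\<^bsub>VW\<^esub> t \<oplus>\<^bsub>VW\<^esub> b \<odot>\<^bsub>VW\<^esub> t"
    if "a \<in> carrier K" "b \<in> carrier K" "t \<in> carrier VW" for a b t
    using that(3)
  proof (induction t rule: tensor_induct)
    case (add v w t)
    have "(a \<oplus>\<^bsub>K\<^esub> b) \<odot>\<^bsub>VW\<^esub> pure v w = a \<odot>\<^bsub>VW\<^esub> pure v w \<oplus>\<^bsub>VW\<^esub> b \<odot>\<^bsub>VW\<^esub> pure v w"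
      using add that by (simp add: V.smult_l_distr pure_add_left flip: pure_smult_left)
    then show ?case
      using add that by (simp add: smult_add pure_closed smult_closed T.a_ac)
  qed (use that in \<open>simp add: smult_zero\<close>)
  have assoc: "(a \<otimes>\<^bsub>K\<^esub> b) \<odot>\<^bsub>VW\<^esub> t = a \<odot>\<^bsub>VW\<^esub> (b \<odot>\<^bsub>VW\<^esub> t)"
    if "a \<in> carrier K" "b \<in> carrier K" "t \<in> carrier VW" for a b t
    using that(3)
  proof (induction t rule: tensor_induct)
    case (add v w t)
    have "(a \<otimes>\<^bsub>K\<^esub> b) \<odot>\<^bsub>VW\<^esub> pure v w = a \<odot>\<^bsub>VW\<^esub> (b \<odot>\<^bsub>VW\<^esub> pure v w)"
      using add that by (simp add: V.smult_assoc1 flip: pure_smult_left)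
    then show ?case
      using add that by (simp add: smult_add pure_closed smult_closed)
  qed (use that in \<open>simp add: smult_zero\<close>)
  have one: "\<one>\<^bsub>K\<^esub> \<odot>\<^bsub>VW\<^esub> t = t" if "t \<in> carrier VW" for t
    using that
  proof (induction t rule: tensor_induct)
    case (add v w t)
    have "\<one>\<^bsub>K\<^esub> \<odot>\<^bsub>VW\<^esub> pure v w = pure v w" using add by (simp flip: pure_smult_left)
    then show ?case using add by (simp add: smult_add pure_closed)
  qed (simp add: smult_zero)
  have "abelian_group VW"
  proof (rule abelian_groupI)
    fix t assume t: "t \<in> carrier VW"
    have "(\<ominus>\<^bsub>K\<^esub> \<one>\<^bsub>K\<^esub>) \<odot>\<^bsub>VW\<^esub> t \<oplus>\<^bsub>VW\<^esub> t = (\<ominus>\<^bsub>K\<^esub> \<one>\<^bsub>K\<^esub> \<oplus>\<^bsub>K\<^esub> \<one>\<^bsub>K\<^esub>) \<odot>\<^bsub>VW\<^esub> t"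
      using t by (subst l_distr) (auto simp: one)
    also have "\<dots> = \<zero>\<^bsub>VW\<^esub>" using t by (simp add: V.R.l_neg zero_smult)
    finally show "\<exists>s\<in>carrier VW. s \<oplus>\<^bsub>VW\<^esub> t = \<zero>\<^bsub>VW\<^esub>"
      using smult_closed[OF _ t, of "\<ominus>\<^bsub>K\<^esub> \<one>\<^bsub>K\<^esub>"] by auto
  qed (auto simp: T.a_ac)
  then have "module K VW"
    by (intro moduleI V.is_cring) (auto simp: smult_closed smult_add l_distr assoc one)
  then show ?thesis by (rule vspace.intro) (rule V.field_axioms)
qed

text \<open>
  The rule that reduces an identity of linear maps on a tensor product to pure tensors; for triple
  tensor products it is applied twice.
\<close>

lemma linear_eq_on_pure:
  assumes U: "vspace K U" and \<phi>: "\<phi> \<in> linear_maps K VW U" and \<psi>: "\<psi> \<in> linear_maps K VW U"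
    and eq: "\<And>v w. v \<in> carrier V \<Longrightarrow> w \<in> carrier W \<Longrightarrow> \<phi> (pure v w) = \<psi> (pure v w)"
    and t: "t \<in> carrier VW"
  shows "\<phi> t = \<psi> t"
  using t
proof (induction t rule: tensor_induct)
  case zero
  then show ?case
    using linear_map_zero[OF tensor_vspace U \<phi>] linear_map_zero[OF tensor_vspace U \<psi>] by simp
next
  case (add v w t)
  then show ?case
    using linear_map_add[OF \<phi>, of "pure v w" t] linear_map_add[OF \<psi>, of "pure v w" t] eq
    by (simp add: pure_closed)
qed

lemma tensor_lift_cls:
  assumes U: "vspace K U" and \<beta>: "\<beta> \<in> bilinear_maps K V W U" and xs: "xs \<in> reps"
  shows "tensor_lift U \<beta> (cls xs) = tensor_sum U \<beta> xs"
proof -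
  interpret U: vspace K U by (rule U)
  note b = bilinear_mapsD[OF \<beta>]
  show ?thesis
    by (rule tensor_lift_class[OF V.vspace_axioms W.vspace_axioms U.abelian_group_axioms _ _ _ _ xs])
      (simp_all add: b)
qed

lemma tensor_lift_pure:
  assumes "vspace K U" "\<beta> \<in> bilinear_maps K V W U" "v \<in> carrier V" "w \<in> carrier W"
  shows "tensor_lift U \<beta> (pure v w) = \<beta> v w"
proof -
  interpret U: vspace K U by fact
  show ?thesis using assms bilinear_mapsD(1)[OF assms(2-4)]
    by (simp add: pure_tensor_def tensor_lift_cls tensor_sum_def)
qed

lemma tensor_lift_linear:
  assumes U: "vspace K U" and \<beta>: "\<beta> \<in> bilinear_maps K V W U"
  shows "tensor_lift U \<beta> \<in> linear_maps K VW U"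
proof -
  interpret U: vspace K U by (rule U)
  note b = bilinear_mapsD[OF \<beta>]
  have closed: "tensor_sum U \<beta> xs \<in> carrier U" if "xs \<in> reps" for xs
    using that by (intro tensor_sum_closed[OF U.abelian_monoid_axioms, of "carrier V" "carrier W"]) (simp_all add: b)
  show ?thesis
  proof (rule linear_mapsI)
    fix t assume "t \<in> carrier VW"
    then show "tensor_lift U \<beta> t \<in> carrier U"
      by (elim tensorE) (simp add: tensor_lift_cls[OF U \<beta>] closed)
  next
    fix s t assume st: "s \<in> carrier VW" "t \<in> carrier VW"
    obtain xs where xs: "xs \<in> reps" "s = cls xs" using st(1) by (rule tensorE)
    obtain ys where ys: "ys \<in> reps" "t = cls ys" using st(2) by (rule tensorE)
    note * = xs ys
    have "tensor_sum U \<beta> (xs @ ys) = tensor_sum U \<beta> xs \<oplus>\<^bsub>U\<^esub> tensor_sum U \<beta> ys"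
      by (rule tensor_sum_append[OF U.abelian_monoid_axioms b(1) *(1,3)])
    then show "tensor_lift U \<beta> (s \<oplus>\<^bsub>VW\<^esub> t) = tensor_lift U \<beta> s \<oplus>\<^bsub>U\<^esub> tensor_lift U \<beta> t"
      using * by (simp add: tensor_add_cls tensor_lift_cls[OF U \<beta>])
  next
    fix a t assume a: "a \<in> carrier K" and t: "t \<in> carrier VW"
    obtain xs where xs: "xs \<in> reps" "t = cls xs" using t by (rule tensorE)
    let ?m = "map (\<lambda>(v, w). (a \<odot>\<^bsub>V\<^esub> v, w))"
    have "?m xs \<in> reps \<and> tensor_sum U \<beta> (?m xs) = a \<odot>\<^bsub>U\<^esub> tensor_sum U \<beta> xs"
      using xs(1)
    proof (induction xs)
      case (Cons p xs)
      then show ?case using a closed[of xs] by (auto simp: tensor_sum_def b U.smult_r_distr)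
    qed (use a in \<open>simp add: tensor_sum_def\<close>)
    then show "tensor_lift U \<beta> (a \<odot>\<^bsub>VW\<^esub> t) = a \<odot>\<^bsub>U\<^esub> tensor_lift U \<beta> t"
      using xs a by (simp add: tensor_smult_cls tensor_lift_cls[OF U \<beta>])
  qed
qed

lemma cls_in_span_pure:
  assumes "xs \<in> reps" "\<And>v w. (v, w) \<in> set xs \<Longrightarrow> pure v w \<in> S" "S \<subseteq> carrier VW"
  shows "cls xs \<in> lin_span K VW S"
proof -
  interpret T: vspace K VW by (rule tensor_vspace)
  note sub = T.span_submodule[OF assms(3)]
  show ?thesis using assms(1,2)
  proof (induction xs)
    case Nil
    then show ?case using T.submodule_zero[OF sub] by (simp add: tensor_zero)
  next
    case (Cons p xs)
    obtain v w where p: "p = (v, w)" by force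
    then have "pure v w \<in> lin_span K VW S" using Cons T.span_superset by simp
    then show ?case using Cons p T.submoduleE(5)[OF sub] by (simp add: cls_Cons)
  qed
qed

end

section \<open>Independent representations of tensors\<close>

lemma reps_mem: "xs \<in> lists (A \<times> B) \<Longrightarrow> (a, b) \<in> set xs \<Longrightarrow> a \<in> A \<and> b \<in> B"
  by auto

lemma reps_Cons: "(a, b) # xs \<in> lists (A \<times> B) \<longleftrightarrow> a \<in> A \<and> b \<in> B \<and> xs \<in> lists (A \<times> B)"
  by auto

context vspace
begin

lemma smult_left_commute: "a \<in> carrier K \<Longrightarrow> b \<in> carrier K \<Longrightarrow> x \<in> carrier V \<Longrightarrow>
    a \<odot>\<^bsub>V\<^esub> (b \<odot>\<^bsub>V\<^esub> x) = b \<odot>\<^bsub>V\<^esub> (a \<odot>\<^bsub>V\<^esub> x)"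
  by (simp add: R.m_comm flip: smult_assoc1)

lemma dual_functional:
  assumes "indep B" "b \<in> B"
  shows "\<exists>f\<in>functionals. f b = \<one>\<^bsub>K\<^esub> \<and> (\<forall>c\<in>B. c \<noteq> b \<longrightarrow> f c = \<zero>\<^bsub>K\<^esub>)"
proof -
  have B: "B \<subseteq> carrier V" "b \<notin> span (B - {b})" using assms by (auto simp: indep_def)
  then have "submodule (span (B - {b})) K V" "b \<in> carrier V" using assms by (auto intro: span_submodule)
  from separating_functional[OF this B(2)] show ?thesis
    using span_superset[of _ "B - {b}"] by blast
qed

lemma indep_listI:
  assumes "f ` set xs \<subseteq> carrier V"
    "\<And>ys p zs. xs = ys @ p # zs \<Longrightarrow> f p \<notin> span (f ` set (ys @ zs))"
  shows "distinct (map f xs) \<and> indep (f ` set xs)"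
proof
  show "distinct (map f xs)"
  proof (rule ccontr)
    assume "\<not> distinct (map f xs)"
    then obtain as bs cs y where "map f xs = as @ [y] @ bs @ [y] @ cs"
      using not_distinct_decomp by blast
    then obtain ps rest where split: "xs = ps @ rest" "y # bs @ y # cs = map f rest"
      unfolding map_eq_append_conv by auto
    then obtain p qs where rest: "rest = p # qs" "f p = y" "map f qs = bs @ y # cs"
      by (cases rest) auto
    have "y \<in> set (map f qs)" by (simp only: rest) simp
    with split(1) rest(1,2) show False using assms(2)[of ps p qs] span_superset[of y "f ` set (ps @ qs)"] by auto
  qed
next
  have "f p \<notin> span (f ` set xs - {f p})" if "p \<in> set xs" for p
  proof -
    obtain ys zs where xs: "xs = ys @ p # zs" using split_list[OF \<open>p \<in> set xs\<close>] by blast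
    have "span (f ` set xs - {f p}) \<subseteq> span (f ` set (ys @ zs))" by (rule span_mono) (auto simp: xs)
    then show ?thesis using assms(2)[OF xs] by blast
  qed
  then show "indep (f ` set xs)" using assms(1) by (auto simp: indep_def)
qed

end

lemma tensor_lift_scalar_space: "tensor_lift (scalar_space K) = tensor_lift K"
  by (simp add: fun_eq_iff tensor_lift_def tensor_sum_def)

context vspace_pair
begin

lemma pure_zero_right: "v \<in> carrier V \<Longrightarrow> pure v \<zero>\<^bsub>W\<^esub> = \<zero>\<^bsub>VW\<^esub>"
  using pure_smult_right[of "\<zero>\<^bsub>K\<^esub>" v "\<zero>\<^bsub>W\<^esub>"] pure_smult_left[of "\<zero>\<^bsub>K\<^esub>" v "\<zero>\<^bsub>W\<^esub>"]
  by (simp add: pure_zero_left)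

text \<open>
  If \<open>w = a w' + x\<close>, then \<open>v \<otimes> w + v' \<otimes> w' = (a v + v') \<otimes> w' + v \<otimes> x\<close>. Iterating this along \<open>ys\<close> distributes
  a summand whose right factor depends on the other right factors over the other summands.
\<close>

lemma absorb_dependent_right:
  assumes "ys \<in> reps" "v \<in> carrier V" "w \<in> lin_span K W (snd ` set ys)"
  shows "\<exists>zs\<in>reps. length zs = length ys \<and> cls ((v, w) # ys) = cls zs"
  using assms
proof (induction ys arbitrary: w rule: list.induct)
  case Nil
  then have "w = \<zero>\<^bsub>W\<^esub>" using W.span_empty by simp
  then have "cls [(v, w)] = cls []" using Nil pure_zero_right[of v] by (simp add: tensor_zero pure_tensor_def)
  then show ?case by (intro bexI[of _ "[]"]) simp_all
next
  case (Cons p ys)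
  interpret T: vspace K VW by (rule tensor_vspace)
  obtain v' w' where p: "p = (v', w')" by force
  then have vw: "v' \<in> carrier V" "w' \<in> carrier W" "ys \<in> reps" using Cons by auto
  have sub: "insert w' (snd ` set ys) \<subseteq> carrier W" using vw reps_mem[OF vw(3)] by fastforce
  obtain a x where ax: "a \<in> carrier K" "x \<in> lin_span K W (snd ` set ys)" "w = a \<odot>\<^bsub>W\<^esub> w' \<oplus>\<^bsub>W\<^esub> x"
    using Cons.prems(3) W.span_insert[OF sub] by (auto simp: p)
  have x: "x \<in> carrier W" using ax(2) sub W.span_closed by blast
  obtain zs where zs: "zs \<in> reps" "length zs = length ys" "cls ((v, x) # ys) = cls zs"
    using Cons.IH[OF vw(3) Cons.prems(2) ax(2)] by blast
  define u where "u = a \<odot>\<^bsub>V\<^esub> v \<oplus>\<^bsub>V\<^esub> v'"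
  have u: "u \<in> carrier V" using ax Cons.prems(2) vw by (simp add: u_def)
  have w: "w \<in> carrier W" using ax x vw by simp
  have c: "cls ys \<in> carrier VW" using vw(3) by (rule cls_closed)
  have "cls ((v, w) # p # ys) = pure v w \<oplus>\<^bsub>VW\<^esub> (pure v' w' \<oplus>\<^bsub>VW\<^esub> cls ys)"
    using vw w Cons.prems(2) by (simp add: p cls_Cons)
  also have "pure v w = pure (a \<odot>\<^bsub>V\<^esub> v) w' \<oplus>\<^bsub>VW\<^esub> pure v x"
    using ax x vw Cons.prems(2) by (simp add: pure_add_right pure_smult_left pure_smult_right)
  also have "\<dots> \<oplus>\<^bsub>VW\<^esub> (pure v' w' \<oplus>\<^bsub>VW\<^esub> cls ys) = pure u w' \<oplus>\<^bsub>VW\<^esub> (pure v x \<oplus>\<^bsub>VW\<^esub> cls ys)"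
    using ax x vw Cons.prems(2) c by (simp add: u_def pure_add_left pure_closed T.M.a_ac)
  also have "pure v x \<oplus>\<^bsub>VW\<^esub> cls ys = cls zs"
    using x vw Cons.prems(2) zs(3) by (simp add: cls_Cons)
  also have "pure u w' \<oplus>\<^bsub>VW\<^esub> cls zs = cls ((u, w') # zs)"
    using u vw zs by (simp add: cls_Cons)
  finally show ?case using u vw zs by (intro bexI[of _ "(u, w') # zs"]) simp_all
qed

lemma flip_pair: "vspace_pair K W V"
  by (rule vspace_pair.intro) unfold_locales

lemma cls_move_front: "ys @ p # zs \<in> reps \<Longrightarrow> cls (ys @ p # zs) = cls (p # ys @ zs)"
proof -
  assume *: "ys @ p # zs \<in> reps"
  have "teq ((ys @ [p]) @ zs) (([p] @ ys) @ zs)"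
    using * by (intro tensor_eq.append tensor_eq.commute tensor_eq.refl) auto
  then show ?thesis by (simp add: cls_eqI)
qed

text \<open>
  In a shortest representation neither the left nor the right factors are dependent, since a
  dependent factor could be absorbed. The number of summands is the rank of the tensor, which is
  therefore the dimension of the span of the left factors and of the span of the right factors.
\<close>

lemma tensor_independent_rep:
  assumes t: "t \<in> carrier VW"
  obtains xs where "xs \<in> reps" "cls xs = t"
    "distinct (map fst xs)" "V.indep (fst ` set xs)"
    "distinct (map snd xs)" "W.indep (snd ` set xs)"
proof -
  interpret F: vspace_pair K W V by (rule flip_pair)
  define R where "R xs \<longleftrightarrow> xs \<in> reps \<and> cls xs = t" for xs
  obtain xs0 where "R xs0" using t by (auto simp: R_def elim: tensorE)
  then obtain xs where xs: "R xs" and min: "\<And>ys. R ys \<Longrightarrow> length xs \<le> length ys"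
    using ex_has_least_nat[of R xs0 length] by blast
  have reps: "xs \<in> reps" "cls xs = t" using xs by (auto simp: R_def)
  have front: "cls (p # ys @ zs) = t" "p # ys @ zs \<in> reps" if "xs = ys @ p # zs" for ys p zs
    using reps that cls_move_front[of ys p zs] by auto
  have right: "snd p \<notin> lin_span K W (snd ` set (ys @ zs))" if split: "xs = ys @ p # zs" for ys p zs
  proof
    assume "snd p \<in> lin_span K W (snd ` set (ys @ zs))"
    moreover have "fst p \<in> carrier V" "ys @ zs \<in> reps" using front(2)[OF split] by auto
    ultimately obtain zs' where "zs' \<in> reps" "length zs' = length (ys @ zs)" "cls (p # ys @ zs) = cls zs'"
      using absorb_dependent_right[of "ys @ zs" "fst p" "snd p"] by auto
    then show False using min[of zs'] front(1)[OF split] split by (simp add: R_def)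
  qed
  have left: "fst p \<notin> lin_span K V (fst ` set (ys @ zs))" if split: "xs = ys @ p # zs" for ys p zs
  proof
    let ?ys = "map prod.swap (ys @ zs)"
    assume "fst p \<in> lin_span K V (fst ` set (ys @ zs))"
    moreover have "snd ` set ?ys = fst ` set (ys @ zs)" by force
    moreover have "snd p \<in> carrier W" "?ys \<in> F.reps" using front(2)[OF split] by auto
    ultimately obtain zs' where zs': "zs' \<in> F.reps" "length zs' = length ?ys"
        "F.cls (prod.swap p # ?ys) = F.cls zs'"
      using F.absorb_dependent_right[of ?ys "snd p" "fst p"] by (auto simp: prod.swap_def)
    have "F.teq (map prod.swap (p # ys @ zs)) zs'"
      using zs'(3) front(2)[OF split] by (subst F.cls_eq_iff[symmetric]) auto
    then have "teq (map prod.swap (map prod.swap (p # ys @ zs))) (map prod.swap zs')"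
      by (rule tensor_eq_swap) unfold_locales
    then have "R (map prod.swap zs')"
      using front(1)[OF split] cls_eqI teq_reps by (fastforce simp: R_def comp_def)
    then show False using min[of "map prod.swap zs'"] zs'(2) split by simp
  qed
  have "fst ` set xs \<subseteq> carrier V" "snd ` set xs \<subseteq> carrier W" using reps_mem[OF reps(1)] by auto
  then have "distinct (map fst xs) \<and> V.indep (fst ` set xs)" "distinct (map snd xs) \<and> W.indep (snd ` set xs)"
    by (auto intro!: V.indep_listI W.indep_listI simp del: set_append dest: left right)
  then show thesis using reps by (intro that[of xs]) blast+
qed

end

text \<open>
  Contracting the right factors with the functional dual to one of them isolates the left factor
  that belongs to it.
\<close>

lemma tensor_sum_dual_left:
  assumes "vspace K V" "vspace K W" "xs \<in> lists (carrier V \<times> carrier W)" "(u, v) \<in> set xs"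
    "distinct (map snd xs)" "f v = \<one>\<^bsub>K\<^esub>" "\<And>v'. v' \<in> snd ` set xs \<Longrightarrow> v' \<noteq> v \<Longrightarrow> f v' = \<zero>\<^bsub>K\<^esub>"
  shows "tensor_sum V (\<lambda>a b. f b \<odot>\<^bsub>V\<^esub> a) xs = u"
proof -
  interpret V: vspace K V by fact
  have zero: "tensor_sum V (\<lambda>a b. f b \<odot>\<^bsub>V\<^esub> a) ys = \<zero>\<^bsub>V\<^esub>"
    if "ys \<in> lists (carrier V \<times> carrier W)" "\<And>v'. v' \<in> snd ` set ys \<Longrightarrow> f v' = \<zero>\<^bsub>K\<^esub>" for ys
    using that by (induction ys) (auto simp: tensor_sum_def)
  show ?thesis using assms(3-7)
  proof (induction xs rule: list.induct)
    case (Cons p xs)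
    obtain a b where p: "p = (a, b)" by force
    have ab: "a \<in> carrier V" "xs \<in> lists (carrier V \<times> carrier W)"
      using Cons.prems(1) unfolding p reps_Cons by blast+
    have step: "tensor_sum V (\<lambda>a b. f b \<odot>\<^bsub>V\<^esub> a) (p # xs) =
        f b \<odot>\<^bsub>V\<^esub> a \<oplus>\<^bsub>V\<^esub> tensor_sum V (\<lambda>a b. f b \<odot>\<^bsub>V\<^esub> a) xs"
      by (simp add: tensor_sum_def p)
    show ?case
    proof (cases "(u, v) = p")
      case True
      have "tensor_sum V (\<lambda>a b. f b \<odot>\<^bsub>V\<^esub> a) xs = \<zero>\<^bsub>V\<^esub>"
        using Cons.prems(3,5) True by (intro zero[OF ab(2)]) (auto simp: p)
      then show ?thesis using step True Cons.prems(4) ab by (simp add: p)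
    next
      case False
      then have uv: "(u, v) \<in> set xs" using Cons.prems(2) by simp
      then have "b \<noteq> v" using Cons.prems(3) by (force simp: p)
      then have "f b = \<zero>\<^bsub>K\<^esub>" using Cons.prems(5) by (simp add: p)
      moreover have "tensor_sum V (\<lambda>a b. f b \<odot>\<^bsub>V\<^esub> a) xs = u"
        using Cons.prems by (intro Cons.IH[OF ab(2) uv]) auto
      moreover have "u \<in> carrier V" using reps_mem[OF ab(2) uv] by blast
      ultimately show ?thesis using step ab by simp
    qed
  qed simp
qed

lemma tensor_sum_in_submodule:
  assumes "vspace K V" "submodule H K V" "\<And>a b. (a, b) \<in> set xs \<Longrightarrow> \<beta> a b \<in> H"
  shows "tensor_sum V \<beta> xs \<in> H"
proof -
  interpret V: vspace K V by fact
  show ?thesis using assms(3)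
  proof (induction xs)
    case Nil
    then show ?case by (simp add: tensor_sum_def V.submodule_zero[OF assms(2)])
  next
    case (Cons p xs)
    obtain a b where p: "p = (a, b)" by force
    have "\<beta> a b \<in> H" using Cons.prems[of a b] by (simp add: p)
    moreover have "tensor_sum V \<beta> xs \<in> H" using Cons.prems by (intro Cons.IH) simp
    ultimately have "\<beta> a b \<oplus>\<^bsub>V\<^esub> tensor_sum V \<beta> xs \<in> H" by (rule V.submoduleE(5)[OF assms(2)])
    then show ?case by (simp add: tensor_sum_def p)
  qed
qed

context vspace_pair
begin

lemma contract_right_bilinear:
  assumes g: "g \<in> W.functionals"
  shows "(\<lambda>v w. g w \<odot>\<^bsub>V\<^esub> v) \<in> bilinear_maps K V W V"
proof (rule bilinear_mapsI)
  note [simp] = W.functional_closed[OF g]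
  fix a v w assume "a \<in> carrier K" "v \<in> carrier V" "w \<in> carrier W"
  then show "g w \<odot>\<^bsub>V\<^esub> (a \<odot>\<^bsub>V\<^esub> v) = a \<odot>\<^bsub>V\<^esub> (g w \<odot>\<^bsub>V\<^esub> v)"
    by (intro V.smult_left_commute) simp_all
qed (simp_all add: W.functional_closed[OF g] W.functional_add[OF g] W.functional_smult[OF g]
  V.smult_r_distr V.smult_l_distr V.smult_assoc1)

lemma contract_left_bilinear:
  assumes f: "f \<in> V.functionals"
  shows "(\<lambda>v w. f v \<odot>\<^bsub>W\<^esub> w) \<in> bilinear_maps K V W W"
proof (rule bilinear_mapsI)
  note [simp] = V.functional_closed[OF f]
  fix a v w assume "a \<in> carrier K" "v \<in> carrier V" "w \<in> carrier W"
  then show "f v \<odot>\<^bsub>W\<^esub> (a \<odot>\<^bsub>W\<^esub> w) = a \<odot>\<^bsub>W\<^esub> (f v \<odot>\<^bsub>W\<^esub> w)"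
    by (intro W.smult_left_commute) simp_all
qed (simp_all add: V.functional_closed[OF f] V.functional_add[OF f] V.functional_smult[OF f]
  W.smult_r_distr W.smult_l_distr W.smult_assoc1)

lemma functional_product_bilinear:
  assumes f: "f \<in> V.functionals" and g: "g \<in> W.functionals"
  shows "(\<lambda>v w. f v \<otimes>\<^bsub>K\<^esub> g w) \<in> bilinear_maps K V W (scalar_space K)"
proof (rule bilinear_mapsI)
  fix a v w assume "a \<in> carrier K" "v \<in> carrier V" "w \<in> carrier W"
  then show "f v \<otimes>\<^bsub>K\<^esub> g (a \<odot>\<^bsub>W\<^esub> w) = a \<odot>\<^bsub>scalar_space K\<^esub> (f v \<otimes>\<^bsub>K\<^esub> g w)"
    using f g by (simp add: W.functional_smult V.R.m_lcomm)
qed (simp_all add: V.functional_closed[OF f] V.functional_add[OF f] V.functional_smult[OF f]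
  W.functional_closed[OF g] W.functional_add[OF g] V.R.l_distr V.R.r_distr V.R.m_assoc)

lemma functional_contract_right:
  assumes f: "f \<in> V.functionals" and g: "g \<in> W.functionals" and t: "t \<in> carrier VW"
  shows "f (tensor_lift V (\<lambda>v w. g w \<odot>\<^bsub>V\<^esub> v) t) = tensor_lift K (\<lambda>v w. f v \<otimes>\<^bsub>K\<^esub> g w) t"
proof -
  note R = contract_right_bilinear[OF g] and P = functional_product_bilinear[OF f g]
  have lin: "(\<lambda>t. f (tensor_lift V (\<lambda>v w. g w \<odot>\<^bsub>V\<^esub> v) t)) \<in> linear_maps K VW (scalar_space K)"
    by (rule linear_maps_comp[OF tensor_lift_linear[OF V.vspace_axioms R] V.functional_linear[OF f]])
  have lin_prod: "tensor_lift (scalar_space K) (\<lambda>v w. f v \<otimes>\<^bsub>K\<^esub> g w) \<in> linear_maps K VW (scalar_space K)"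
    by (rule tensor_lift_linear[OF V.scalars P])
  have eq: "f (tensor_lift V (\<lambda>v w. g w \<odot>\<^bsub>V\<^esub> v) (pure v w)) =
      tensor_lift (scalar_space K) (\<lambda>v w. f v \<otimes>\<^bsub>K\<^esub> g w) (pure v w)"
    if "v \<in> carrier V" "w \<in> carrier W" for v w
    using f g that by (simp add: tensor_lift_pure[OF V.vspace_axioms R] tensor_lift_pure[OF V.scalars P]
        V.functional_smult V.R.m_comm)
  show ?thesis
    using linear_eq_on_pure[OF V.scalars lin lin_prod eq t] by (simp add: tensor_lift_scalar_space)
qed

lemma functional_contract_left:
  assumes f: "f \<in> V.functionals" and g: "g \<in> W.functionals" and t: "t \<in> carrier VW"
  shows "g (tensor_lift W (\<lambda>v w. f v \<odot>\<^bsub>W\<^esub> w) t) = tensor_lift K (\<lambda>v w. f v \<otimes>\<^bsub>K\<^esub> g w) t"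
proof -
  note R = contract_left_bilinear[OF f] and P = functional_product_bilinear[OF f g]
  have lin: "(\<lambda>t. g (tensor_lift W (\<lambda>v w. f v \<odot>\<^bsub>W\<^esub> w) t)) \<in> linear_maps K VW (scalar_space K)"
    by (rule linear_maps_comp[OF tensor_lift_linear[OF W.vspace_axioms R] W.functional_linear[OF g]])
  have lin_prod: "tensor_lift (scalar_space K) (\<lambda>v w. f v \<otimes>\<^bsub>K\<^esub> g w) \<in> linear_maps K VW (scalar_space K)"
    by (rule tensor_lift_linear[OF V.scalars P])
  have eq: "g (tensor_lift W (\<lambda>v w. f v \<odot>\<^bsub>W\<^esub> w) (pure v w)) =
      tensor_lift (scalar_space K) (\<lambda>v w. f v \<otimes>\<^bsub>K\<^esub> g w) (pure v w)"
    if "v \<in> carrier V" "w \<in> carrier W" for v w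
    using f g that by (simp add: tensor_lift_pure[OF W.vspace_axioms R] tensor_lift_pure[OF V.scalars P]
        W.functional_smult)
  show ?thesis
    using linear_eq_on_pure[OF V.scalars lin lin_prod eq t] by (simp add: tensor_lift_scalar_space)
qed

text \<open>
  Contract an independent representation with a functional dual to one right factor: what remains is
  a left factor that every functional kills, although it is part of an independent set.
\<close>

lemma tensor_separate_zero:
  assumes t: "t \<in> carrier VW"
    and zero: "\<And>f g. f \<in> V.functionals \<Longrightarrow> g \<in> W.functionals \<Longrightarrow>
      tensor_lift K (\<lambda>v w. f v \<otimes>\<^bsub>K\<^esub> g w) t = \<zero>\<^bsub>K\<^esub>"
  shows "t = \<zero>\<^bsub>VW\<^esub>"
proof -
  obtain xs where xs: "xs \<in> reps" "cls xs = t" "V.indep (fst ` set xs)"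
    "distinct (map snd xs)" "W.indep (snd ` set xs)"
    using t by (rule tensor_independent_rep)
  have "xs = []"
  proof (rule ccontr)
    assume "xs \<noteq> []"
    then obtain p where "p \<in> set xs" by (cases xs) auto
    moreover obtain u v where "p = (u, v)" by force
    ultimately have uv: "(u, v) \<in> set xs" by simp
    then have "v \<in> snd ` set xs" by force
    from W.dual_functional[OF xs(5) this] obtain g where g: "g \<in> W.functionals" "g v = \<one>\<^bsub>K\<^esub>"
      "\<And>v'. v' \<in> snd ` set xs \<Longrightarrow> v' \<noteq> v \<Longrightarrow> g v' = \<zero>\<^bsub>K\<^esub>" by blast
    have "tensor_lift V (\<lambda>v w. g w \<odot>\<^bsub>V\<^esub> v) t = tensor_sum V (\<lambda>v w. g w \<odot>\<^bsub>V\<^esub> v) xs"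
      using tensor_lift_cls[OF V.vspace_axioms contract_right_bilinear[OF g(1)] xs(1)] xs(2) by simp
    also have "\<dots> = u"
      by (rule tensor_sum_dual_left[where f = g, OF V.vspace_axioms W.vspace_axioms xs(1) uv xs(4) g(2,3)])
    finally have "f u = \<zero>\<^bsub>K\<^esub>" if "f \<in> V.functionals" for f
      using functional_contract_right[OF that g(1) t] zero[OF that g(1)] by simp
    moreover have "u \<in> carrier V" using reps_mem[OF xs(1) uv] by blast
    ultimately have "u = \<zero>\<^bsub>V\<^esub>" by (intro V.functionals_separate_zero)
    moreover have "u \<in> fst ` set xs" using uv by force
    moreover have "\<zero>\<^bsub>V\<^esub> \<in> lin_span K V (fst ` set xs - {u})"
      using xs(3) by (intro V.submodule_zero V.span_submodule) (auto simp: V.indep_def)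
    ultimately show False using xs(3) by (auto simp: V.indep_def)
  qed
  then show ?thesis using xs(2) by (simp add: tensor_zero)
qed

lemma tensor_separate:
  assumes s: "s \<in> carrier VW" and t: "t \<in> carrier VW"
    and eq: "\<And>f g. f \<in> V.functionals \<Longrightarrow> g \<in> W.functionals \<Longrightarrow>
      tensor_lift K (\<lambda>v w. f v \<otimes>\<^bsub>K\<^esub> g w) s = tensor_lift K (\<lambda>v w. f v \<otimes>\<^bsub>K\<^esub> g w) t"
  shows "s = t"
proof -
  interpret T: vspace K VW by (rule tensor_vspace)
  interpret S: vspace K "scalar_space K" by (rule V.scalars)
  have "s \<ominus>\<^bsub>VW\<^esub> t = \<zero>\<^bsub>VW\<^esub>"
  proof (rule tensor_separate_zero)
    show "s \<ominus>\<^bsub>VW\<^esub> t \<in> carrier VW" using s t by (rule T.M.minus_closed)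
    fix f g assume fg: "f \<in> V.functionals" "g \<in> W.functionals"
    note lin = tensor_lift_linear[OF V.scalars functional_product_bilinear[OF fg],
        unfolded tensor_lift_scalar_space]
    have "tensor_lift K (\<lambda>v w. f v \<otimes>\<^bsub>K\<^esub> g w) (s \<ominus>\<^bsub>VW\<^esub> t) = \<zero>\<^bsub>scalar_space K\<^esub>"
      unfolding linear_map_minus[OF tensor_vspace V.scalars lin s t] eq[OF fg]
      using S.M.diff_eq_zero_iff linear_map_closed[OF lin t] by blast
    then show "tensor_lift K (\<lambda>v w. f v \<otimes>\<^bsub>K\<^esub> g w) (s \<ominus>\<^bsub>VW\<^esub> t) = \<zero>\<^bsub>K\<^esub>" by simp
  qed
  then show ?thesis using s t by (simp add: T.M.diff_eq_zero_iff)
qed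

end

section \<open>Induced maps between tensor products\<close>

lemma tensor_map_bilinear:
  assumes "vspace_pair K V W" "f \<in> linear_maps K A V" "g \<in> linear_maps K B W"
  shows "(\<lambda>a b. pure_tensor K V W (f a) (g b)) \<in> bilinear_maps K A B (tensor K V W)"
proof -
  interpret vspace_pair K V W by fact
  note [simp] = linear_map_closed[OF assms(2)] linear_map_closed[OF assms(3)]
    linear_map_add[OF assms(2)] linear_map_add[OF assms(3)]
    linear_map_smult[OF assms(2)] linear_map_smult[OF assms(3)]
  show ?thesis
    by (rule bilinear_mapsI)
      (simp_all add: pure_closed pure_add_left pure_add_right pure_smult_left pure_smult_right)
qed

lemma tensor_map_linear:
  assumes "vspace_pair K A B" "vspace_pair K V W" "f \<in> linear_maps K A V" "g \<in> linear_maps K B W"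
  shows "tensor_map K V W f g \<in> linear_maps K (tensor K A B) (tensor K V W)"
  unfolding tensor_map_def
  by (rule vspace_pair.tensor_lift_linear[OF assms(1) vspace_pair.tensor_vspace[OF assms(2)]
        tensor_map_bilinear[OF assms(2-4)]])

lemma tensor_map_pure:
  assumes "vspace_pair K A B" "vspace_pair K V W" "f \<in> linear_maps K A V" "g \<in> linear_maps K B W"
    "a \<in> carrier A" "b \<in> carrier B"
  shows "tensor_map K V W f g (pure_tensor K A B a b) = pure_tensor K V W (f a) (g b)"
  unfolding tensor_map_def
  by (rule vspace_pair.tensor_lift_pure[OF assms(1) vspace_pair.tensor_vspace[OF assms(2)]
        tensor_map_bilinear[OF assms(2-4)] assms(5,6)])

lemma linear_maps_sum:
  assumes "vspace K U" "f \<in> linear_maps K V U" "g \<in> linear_maps K V U"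
  shows "(\<lambda>x. f x \<oplus>\<^bsub>U\<^esub> g x) \<in> linear_maps K V U"
proof -
  interpret U: vspace K U by fact
  note [simp] = linear_map_closed[OF assms(2)] linear_map_closed[OF assms(3)]
    linear_map_add[OF assms(2)] linear_map_add[OF assms(3)]
    linear_map_smult[OF assms(2)] linear_map_smult[OF assms(3)]
  show ?thesis by (rule linear_mapsI) (simp_all add: U.M.a_ac U.smult_r_distr)
qed

lemma linear_maps_scale:
  assumes "vspace K U" "f \<in> linear_maps K V U" "c \<in> carrier K"
  shows "(\<lambda>x. c \<odot>\<^bsub>U\<^esub> f x) \<in> linear_maps K V U"
proof -
  interpret U: vspace K U by fact
  note [simp] = linear_map_closed[OF assms(2)] linear_map_add[OF assms(2)] linear_map_smult[OF assms(2)]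
  show ?thesis using assms(3)
    by (intro linear_mapsI) (simp_all add: U.smult_r_distr U.R.m_comm flip: U.smult_assoc1)
qed

text \<open>
  In the associator the lift over the first two factors has the third factor as a parameter. The outer
  lift needs it to be bilinear in the tensor of the first two factors and that parameter.
\<close>

lemma tensor_lift_bilinear_parameter:
  assumes "vspace_pair K V W" and T: "vspace K T"
    and b: "\<And>p. p \<in> carrier P \<Longrightarrow> \<beta> p \<in> bilinear_maps K V W T"
    and l: "\<And>v w. v \<in> carrier V \<Longrightarrow> w \<in> carrier W \<Longrightarrow> (\<lambda>p. \<beta> p v w) \<in> linear_maps K P T"
    and P: "vspace K P"
  shows "(\<lambda>s p. tensor_lift T (\<beta> p) s) \<in> bilinear_maps K (tensor K V W) P T"
proof -
  interpret vspace_pair K V W by fact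
  interpret T: vspace K T by (rule T)
  interpret P: vspace K P by (rule P)
  have lin: "tensor_lift T (\<beta> p) \<in> linear_maps K VW T" if "p \<in> carrier P" for p
    by (rule tensor_lift_linear[OF T b[OF that]])
  have [simp]: "tensor_lift T (\<beta> p) (pure v w) = \<beta> p v w"
    if "p \<in> carrier P" "v \<in> carrier V" "w \<in> carrier W" for p v w
    by (rule tensor_lift_pure[OF T b[OF that(1)] that(2,3)])
  show ?thesis
  proof (rule bilinear_mapsI)
    fix s p q assume s: "s \<in> carrier VW" and p: "p \<in> carrier P" and q: "q \<in> carrier P"
    have "tensor_lift T (\<beta> (p \<oplus>\<^bsub>P\<^esub> q)) (pure v w) =
        tensor_lift T (\<beta> p) (pure v w) \<oplus>\<^bsub>T\<^esub> tensor_lift T (\<beta> q) (pure v w)"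
      if "v \<in> carrier V" "w \<in> carrier W" for v w
      using that p q linear_map_add[OF l[OF that] p q] by simp
    from linear_eq_on_pure[OF T lin linear_maps_sum[OF T lin[OF p] lin[OF q]] this s]
    show "tensor_lift T (\<beta> (p \<oplus>\<^bsub>P\<^esub> q)) s = tensor_lift T (\<beta> p) s \<oplus>\<^bsub>T\<^esub> tensor_lift T (\<beta> q) s"
      using p q by simp
  next
    fix a s p assume a: "a \<in> carrier K" and s: "s \<in> carrier VW" and p: "p \<in> carrier P"
    have "tensor_lift T (\<beta> (a \<odot>\<^bsub>P\<^esub> p)) (pure v w) = a \<odot>\<^bsub>T\<^esub> tensor_lift T (\<beta> p) (pure v w)"
      if "v \<in> carrier V" "w \<in> carrier W" for v w
      using that a p linear_map_smult[OF l[OF that] a p] by simp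
    from linear_eq_on_pure[OF T lin linear_maps_scale[OF T lin[OF p] a] this s]
    show "tensor_lift T (\<beta> (a \<odot>\<^bsub>P\<^esub> p)) s = a \<odot>\<^bsub>T\<^esub> tensor_lift T (\<beta> p) s"
      using a p by simp
  qed (simp_all add: linear_map_closed[OF lin] linear_map_add[OF lin] linear_map_smult[OF lin])
qed

locale vspace_triple = U: vspace K U + V: vspace K V + W: vspace K W
  for K (structure) and U and V and W
begin

sublocale UV: vspace_pair K U V ..
sublocale VW: vspace_pair K V W ..
sublocale U_VW: vspace_pair K U "tensor K V W"
  by (rule vspace_pair.intro[OF U.vspace_axioms VW.tensor_vspace])
sublocale UV_W: vspace_pair K "tensor K U V" W
  by (rule vspace_pair.intro[OF UV.tensor_vspace W.vspace_axioms])

abbreviation "T \<equiv> tensor K U (tensor K V W)"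

lemma assoc_inner_bilinear: "w \<in> carrier W \<Longrightarrow>
    (\<lambda>u v. pure_tensor K U (tensor K V W) u (pure_tensor K V W v w)) \<in> bilinear_maps K U V T"
  by (rule bilinear_mapsI)
    (simp_all add: U_VW.pure_closed VW.pure_closed U_VW.pure_add_left U_VW.pure_add_right
      U_VW.pure_smult_left U_VW.pure_smult_right VW.pure_add_left VW.pure_smult_left)

lemma assoc_outer_bilinear:
  "(\<lambda>s w. tensor_lift T (\<lambda>u v. pure_tensor K U (tensor K V W) u (pure_tensor K V W v w)) s)
    \<in> bilinear_maps K (tensor K U V) W T"
  by (rule tensor_lift_bilinear_parameter[OF UV.vspace_pair_axioms U_VW.tensor_vspace _ _ W.vspace_axioms])
    (auto intro!: linear_mapsI simp: assoc_inner_bilinear U_VW.pure_closed VW.pure_closed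
      U_VW.pure_add_right U_VW.pure_smult_right VW.pure_add_right VW.pure_smult_right)

lemma tensor_assoc_linear: "tensor_assoc K U V W \<in> linear_maps K (tensor K (tensor K U V) W) T"
  unfolding tensor_assoc_def Let_def
  by (rule UV_W.tensor_lift_linear[OF U_VW.tensor_vspace assoc_outer_bilinear])

lemma tensor_assoc_pure:
  assumes "u \<in> carrier U" "v \<in> carrier V" "w \<in> carrier W"
  shows "tensor_assoc K U V W (pure_tensor K (tensor K U V) W (pure_tensor K U V u v) w) =
    pure_tensor K U (tensor K V W) u (pure_tensor K V W v w)"
  unfolding tensor_assoc_def Let_def
  by (subst UV_W.tensor_lift_pure[OF U_VW.tensor_vspace assoc_outer_bilinear])
    (simp_all add: assms UV.pure_closed UV.tensor_lift_pure[OF U_VW.tensor_vspace assoc_inner_bilinear])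

end

context vspace_pair
begin

lemma tensor_lift_cong:
  assumes "t \<in> carrier VW" "\<And>v w. v \<in> carrier V \<Longrightarrow> w \<in> carrier W \<Longrightarrow> \<beta> v w = \<gamma> v w"
  shows "tensor_lift U \<beta> t = tensor_lift U \<gamma> t"
proof -
  obtain xs where xs: "xs \<in> reps" "t = cls xs" using assms(1) by (rule tensorE)
  then have "xs \<in> t" by (simp add: tensor_class_def tensor_eq.refl)
  then have "(SOME ys. ys \<in> t) \<in> t" by (rule someI)
  then have "(SOME ys. ys \<in> t) \<in> reps" using xs(2) teq_reps by (auto simp: tensor_class_def)
  moreover have "tensor_sum U \<beta> ys = tensor_sum U \<gamma> ys" if "ys \<in> reps" for ys
    using that by induction (auto simp: tensor_sum_def assms(2))
  ultimately show ?thesis by (simp add: tensor_lift_def)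
qed

text \<open>
  The functional \<open>f \<otimes> g\<close> on \<open>V \<otimes> W\<close>, restricted to the carrier so that it is an element of the dual space
  and can be a factor of a further product.
\<close>

definition tensor_functional
  where "tensor_functional f g =
    restrict (tensor_lift K (\<lambda>v w. f v \<otimes>\<^bsub>K\<^esub> g w)) (carrier VW)"

lemma tensor_functional_closed:
  assumes "f \<in> V.functionals" "g \<in> W.functionals"
  shows "tensor_functional f g \<in> carrier (dual_space K VW)"
proof -
  interpret T: vspace K VW by (rule tensor_vspace)
  show ?thesis
    using T.functional_restrict[OF tensor_lift_linear[OF V.scalars functional_product_bilinear[OF assms]]]
    by (simp add: tensor_functional_def tensor_lift_scalar_space)
qed

lemma tensor_functional_pure:
  assumes "f \<in> V.functionals" "g \<in> W.functionals" "v \<in> carrier V" "w \<in> carrier W"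
  shows "tensor_functional f g (pure v w) = f v \<otimes>\<^bsub>K\<^esub> g w"
  using tensor_lift_pure[OF V.scalars functional_product_bilinear[OF assms(1,2)] assms(3,4)] assms(3,4)
  by (simp add: tensor_functional_def tensor_lift_scalar_space pure_closed)

lemma tensor_functional_apply: "t \<in> carrier VW \<Longrightarrow>
    tensor_functional f g t = tensor_lift K (\<lambda>v w. f v \<otimes>\<^bsub>K\<^esub> g w) t"
  by (simp add: tensor_functional_def)

end

context vspace_triple
begin

lemma tensor_functional_assoc:
  assumes f: "f \<in> U.functionals" and g: "g \<in> V.functionals" and h: "h \<in> W.functionals"
    and t: "t \<in> carrier (tensor K (tensor K U V) W)"
  shows "U_VW.tensor_functional f (VW.tensor_functional g h) (tensor_assoc K U V W t) =
    UV_W.tensor_functional (UV.tensor_functional f g) h t"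
proof -
  note gh = VW.tensor_functional_closed[OF g h] and fg = UV.tensor_functional_closed[OF f g]
  have T: "vspace K T" by (rule U_VW.tensor_vspace)
  have T': "vspace K (tensor K (tensor K U V) W)" by (rule UV_W.tensor_vspace)
  note F = U_VW.tensor_functional_closed[OF f gh]
  note G = UV_W.tensor_functional_closed[OF fg h]
  have lin: "(\<lambda>t. U_VW.tensor_functional f (VW.tensor_functional g h) (tensor_assoc K U V W t))
      \<in> linear_maps K (tensor K (tensor K U V) W) (scalar_space K)"
    by (rule linear_maps_comp[OF tensor_assoc_linear vspace.functional_linear[OF T F]])
  have eq: "U_VW.tensor_functional f (VW.tensor_functional g h)
        (tensor_assoc K U V W (pure_tensor K (tensor K U V) W s w)) =
      UV_W.tensor_functional (UV.tensor_functional f g) h (pure_tensor K (tensor K U V) W s w)"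
    if s: "s \<in> carrier (tensor K U V)" and w: "w \<in> carrier W" for s w
  proof -
    have slin: "(\<lambda>s. pure_tensor K (tensor K U V) W s w)
        \<in> linear_maps K (tensor K U V) (tensor K (tensor K U V) W)"
      using w by (intro linear_mapsI)
        (simp_all add: UV_W.pure_closed UV_W.pure_add_left UV_W.pure_smult_left)
    have pure_eq: "U_VW.tensor_functional f (VW.tensor_functional g h)
          (tensor_assoc K U V W (pure_tensor K (tensor K U V) W (pure_tensor K U V u v) w)) =
        UV_W.tensor_functional (UV.tensor_functional f g) h
          (pure_tensor K (tensor K U V) W (pure_tensor K U V u v) w)"
      if uv: "u \<in> carrier U" "v \<in> carrier V" for u v
      unfolding tensor_assoc_pure[OF uv w]
        U_VW.tensor_functional_pure[OF f gh uv(1) VW.pure_closed[OF uv(2) w]]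
        VW.tensor_functional_pure[OF g h uv(2) w]
        UV_W.tensor_functional_pure[OF fg h UV.pure_closed[OF uv] w]
        UV.tensor_functional_pure[OF f g uv]
      using uv w f g h by (simp add: U.R.m_assoc)
    from UV.linear_eq_on_pure[OF U.scalars linear_maps_comp[OF slin lin]
        linear_maps_comp[OF slin vspace.functional_linear[OF T' G]] this s]
    show ?thesis .
  qed
  from UV_W.linear_eq_on_pure[OF U.scalars lin vspace.functional_linear[OF T' G] eq t]
  show ?thesis .
qed

end

lemma tensor_functional_map:
  assumes AB: "vspace_pair K A B" and VW: "vspace_pair K V W"
    and \<phi>: "\<phi> \<in> linear_maps K A V" and \<psi>: "\<psi> \<in> linear_maps K B W"
    and f: "f \<in> carrier (dual_space K V)" and g: "g \<in> carrier (dual_space K W)"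
    and f': "f' \<in> carrier (dual_space K A)" and g': "g' \<in> carrier (dual_space K B)"
    and ff: "\<And>a. a \<in> carrier A \<Longrightarrow> f (\<phi> a) = f' a" and gg: "\<And>b. b \<in> carrier B \<Longrightarrow> g (\<psi> b) = g' b"
    and t: "t \<in> carrier (tensor K A B)"
  shows "vspace_pair.tensor_functional K V W f g (tensor_map K V W \<phi> \<psi> t) =
    vspace_pair.tensor_functional K A B f' g' t"
proof -
  interpret P: vspace_pair K A B by (rule AB)
  interpret Q: vspace_pair K V W by (rule VW)
  note F = Q.tensor_functional_closed[OF f g] and F' = P.tensor_functional_closed[OF f' g']
  note m = tensor_map_linear[OF AB VW \<phi> \<psi>]
  have "Q.tensor_functional f g (tensor_map K V W \<phi> \<psi> (P.pure a b)) = P.tensor_functional f' g' (P.pure a b)"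
    if "a \<in> carrier A" "b \<in> carrier B" for a b
    unfolding tensor_map_pure[OF AB VW \<phi> \<psi> that] P.tensor_functional_pure[OF f' g' that]
      Q.tensor_functional_pure[OF f g linear_map_closed[OF \<phi> that(1)] linear_map_closed[OF \<psi> that(2)]]
    by (simp add: ff gg that)
  from P.linear_eq_on_pure[OF P.V.scalars
      linear_maps_comp[OF m vspace.functional_linear[OF Q.tensor_vspace F]]
      vspace.functional_linear[OF P.tensor_vspace F'] this t]
  show ?thesis .
qed

section \<open>The actions of the dual algebra on a coalgebra\<close>

lemma dual_algebra_simps [simp]:
  "carrier (dual_algebra K C) = carrier (dual_space K C)"
  "zero (dual_algebra K C) = zero (dual_space K C)"
  "add (dual_algebra K C) = add (dual_space K C)"
  "smult (dual_algebra K C) = smult (dual_space K C)"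
  by (simp_all add: dual_algebra_def)

context coalgebra
begin

sublocale CC: vspace_pair K C C ..
sublocale CCC: vspace_triple K C C C ..

abbreviation conv (infixl "\<star>" 70) where "f \<star> g \<equiv> f \<otimes>\<^bsub>dual_algebra K C\<^esub> g"
abbreviation counit_functional ("\<epsilon>") where "\<epsilon> \<equiv> \<one>\<^bsub>dual_algebra K C\<^esub>"

text \<open>
  In Sweedler notation \<open>left_action f x\<close> is the sum of \<open>f x\<^sub>2 \<cdot> x\<^sub>1\<close> and \<open>right_action f x\<close> the sum of \<open>f x\<^sub>1 \<cdot> x\<^sub>2\<close>.
  They make \<open>C\<close> a bimodule over its dual algebra; right coideals are the left submodules and left
  coideals the right submodules.
\<close>

definition left_action
  where "left_action f x = tensor_lift C (\<lambda>u v. f v \<odot>\<^bsub>C\<^esub> u) (comult C x)"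

definition right_action
  where "right_action f x = tensor_lift C (\<lambda>u v. f u \<odot>\<^bsub>C\<^esub> v) (comult C x)"

lemma comult_closed: "x \<in> carrier C \<Longrightarrow> comult C x \<in> carrier (tensor K C C)"
  by (rule linear_map_closed[OF comult_linear])

lemma left_action_linear: "f \<in> functionals \<Longrightarrow> left_action f \<in> linear_maps K C C"
  unfolding left_action_def
  by (rule linear_maps_comp[OF comult_linear CC.tensor_lift_linear[OF vspace_axioms CC.contract_right_bilinear]])

lemma right_action_linear: "f \<in> functionals \<Longrightarrow> right_action f \<in> linear_maps K C C"
  unfolding right_action_def
  by (rule linear_maps_comp[OF comult_linear CC.tensor_lift_linear[OF vspace_axioms CC.contract_left_bilinear]])

lemma left_action_closed [simp]: "f \<in> functionals \<Longrightarrow> x \<in> carrier C \<Longrightarrow> left_action f x \<in> carrier C"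
  by (rule linear_map_closed[OF left_action_linear])

lemma right_action_closed [simp]: "f \<in> functionals \<Longrightarrow> x \<in> carrier C \<Longrightarrow> right_action f x \<in> carrier C"
  by (rule linear_map_closed[OF right_action_linear])

lemma conv_apply: "x \<in> carrier C \<Longrightarrow> (f \<star> g) x = CC.tensor_functional f g (comult C x)"
  by (simp add: dual_algebra_def CC.tensor_functional_apply comult_closed)

lemma conv_left_action: "f \<in> functionals \<Longrightarrow> g \<in> functionals \<Longrightarrow> x \<in> carrier C \<Longrightarrow>
    (f \<star> g) x = f (left_action g x)"
  by (simp add: conv_apply CC.tensor_functional_apply comult_closed left_action_def CC.functional_contract_right)

lemma conv_right_action: "f \<in> functionals \<Longrightarrow> g \<in> functionals \<Longrightarrow> x \<in> carrier C \<Longrightarrow>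
    (f \<star> g) x = g (right_action f x)"
  by (simp add: conv_apply CC.tensor_functional_apply comult_closed right_action_def CC.functional_contract_left)

lemma conv_closed [simp]:
  assumes "f \<in> functionals" "g \<in> functionals" shows "f \<star> g \<in> functionals"
proof -
  have "restrict (\<lambda>x. f (left_action g x)) (carrier C) \<in> functionals"
    using assms by (intro functional_restrict linear_maps_comp[OF left_action_linear functional_linear])
  moreover have "restrict (\<lambda>x. f (left_action g x)) (carrier C) = f \<star> g"
    using assms conv_left_action by (auto simp: fun_eq_iff restrict_def) (simp add: dual_algebra_def)
  ultimately show ?thesis by simp
qed

text \<open>
  Coassociativity of \<open>\<Delta>\<close>, paired with \<open>f \<otimes> (g \<otimes> h)\<close>.
\<close>

lemma conv_assoc:
  assumes f: "f \<in> functionals" and g: "g \<in> functionals" and h: "h \<in> functionals"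
  shows "f \<star> g \<star> h = f \<star> (g \<star> h)"
proof (rule functional_ext)
  note fg = CC.tensor_functional_closed[OF f g] and gh = CC.tensor_functional_closed[OF g h]
  fix x assume x: "x \<in> carrier C"
  note \<Delta> = comult_closed[OF x]
  have "(f \<star> g \<star> h) x = CCC.UV_W.tensor_functional (CC.tensor_functional f g) h
      (tensor_map K (tensor K C C) C (comult C) id (comult C x))"
    unfolding conv_apply[OF x]
    by (rule tensor_functional_map[symmetric, OF CC.vspace_pair_axioms CCC.UV_W.vspace_pair_axioms
          comult_linear id_linear fg h conv_closed[OF f g] h _ _ \<Delta>]) (simp_all add: conv_apply)
  also have "\<dots> = CCC.U_VW.tensor_functional f (CC.tensor_functional g h)
      (tensor_assoc K C C C (tensor_map K (tensor K C C) C (comult C) id (comult C x)))"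
    by (rule CCC.tensor_functional_assoc[symmetric, OF f g h])
      (rule linear_map_closed[OF tensor_map_linear[OF CC.vspace_pair_axioms CCC.UV_W.vspace_pair_axioms
          comult_linear id_linear] \<Delta>])
  also have "\<dots> = CCC.U_VW.tensor_functional f (CC.tensor_functional g h)
      (tensor_map K C (tensor K C C) id (comult C) (comult C x))"
    by (simp only: coassoc[OF x])
  also have "\<dots> = (f \<star> (g \<star> h)) x"
    unfolding conv_apply[OF x]
    by (rule tensor_functional_map[OF CC.vspace_pair_axioms CCC.U_VW.vspace_pair_axioms
          id_linear comult_linear f gh f conv_closed[OF g h] _ _ \<Delta>]) (simp_all add: conv_apply)
  finally show "(f \<star> g \<star> h) x = (f \<star> (g \<star> h)) x" .
qed (use assms in simp_all)

lemma counit_functional_closed [simp]: "\<epsilon> \<in> functionals"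
  using functional_restrict[OF counit_linear] by (simp add: dual_algebra_def)

lemma counit_functional_apply: "x \<in> carrier C \<Longrightarrow> \<epsilon> x = counit C x"
  by (simp add: dual_algebra_def)

lemma left_action_counit [simp]: "x \<in> carrier C \<Longrightarrow> left_action \<epsilon> x = x"
  unfolding left_action_def
  by (subst CC.tensor_lift_cong[OF comult_closed, where \<gamma> = "\<lambda>u v. counit C v \<odot>\<^bsub>C\<^esub> u"])
    (simp_all add: counit_functional_apply counit_right)

lemma right_action_counit [simp]: "x \<in> carrier C \<Longrightarrow> right_action \<epsilon> x = x"
  unfolding right_action_def
  by (subst CC.tensor_lift_cong[OF comult_closed, where \<gamma> = "\<lambda>u v. counit C u \<odot>\<^bsub>C\<^esub> v"])
    (simp_all add: counit_functional_apply counit_left)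

text \<open>
  Both sides are \<open>(h \<star> f) x\<close>. As functionals separate points, this reduces linearity of one action in its
  functional to the pointwise definition of the sum of functionals.
\<close>

lemma left_right_adjoint: "f \<in> functionals \<Longrightarrow> h \<in> functionals \<Longrightarrow> x \<in> carrier C \<Longrightarrow>
    h (left_action f x) = f (right_action h x)"
  by (simp flip: conv_left_action add: conv_right_action)

lemma conv_counit_left: "f \<in> functionals \<Longrightarrow> \<epsilon> \<star> f = f"
  by (rule functional_ext) (simp_all add: conv_right_action)

lemma conv_counit_right: "f \<in> functionals \<Longrightarrow> f \<star> \<epsilon> = f"
  by (rule functional_ext) (simp_all add: conv_left_action)

sublocale D: vspace K "dual_space K C" by (rule dual_space_vspace)

lemma dual_algebra_assoc_algebra: "assoc_algebra K (dual_algebra K C)"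
proof -
  have A: "vspace K (dual_algebra K C)"
    by (rule vspace_cong[OF dual_space_vspace]) simp_all
  interpret A: vspace K "dual_algebra K C" by (rule A)
  have add [simp]: "f \<oplus>\<^bsub>dual_space K C\<^esub> g \<in> functionals" if "f \<in> functionals" "g \<in> functionals" for f g
    using that by (rule D.M.a_closed)
  have smult [simp]: "a \<odot>\<^bsub>dual_space K C\<^esub> f \<in> functionals" if "a \<in> carrier K" "f \<in> functionals" for a f
    using that by (rule D.smult_closed)
  have "monoid (dual_algebra K C)"
    by (rule monoidI)
      (simp_all add: conv_assoc conv_counit_left conv_counit_right)
  moreover have "f \<star> h \<oplus>\<^bsub>dual_space K C\<^esub> g \<star> h = (f \<oplus>\<^bsub>dual_space K C\<^esub> g) \<star> h"
    if "f \<in> functionals" "g \<in> functionals" "h \<in> functionals" for f g h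
    using that by (intro functional_ext) (simp_all add: conv_left_action)
  moreover have "h \<star> f \<oplus>\<^bsub>dual_space K C\<^esub> h \<star> g = h \<star> (f \<oplus>\<^bsub>dual_space K C\<^esub> g)"
    if "f \<in> functionals" "g \<in> functionals" "h \<in> functionals" for f g h
    using that by (intro functional_ext) (simp_all add: conv_right_action)
  ultimately have "ring (dual_algebra K C)"
    by (intro ringI A.abelian_group_axioms) simp_all
  moreover have "(a \<odot>\<^bsub>dual_space K C\<^esub> f) \<star> g = a \<odot>\<^bsub>dual_space K C\<^esub> (f \<star> g)"
    if "a \<in> carrier K" "f \<in> functionals" "g \<in> functionals" for a f g
    using that by (intro functional_ext) (simp_all add: conv_left_action)
  moreover have "f \<star> (a \<odot>\<^bsub>dual_space K C\<^esub> g) = a \<odot>\<^bsub>dual_space K C\<^esub> (f \<star> g)"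
    if "a \<in> carrier K" "f \<in> functionals" "g \<in> functionals" for a f g
    using that by (intro functional_ext) (simp_all add: conv_right_action)
  ultimately show ?thesis
    by (intro assoc_algebra.intro A assoc_algebra_axioms.intro) simp_all
qed

sublocale A: assoc_algebra K "dual_algebra K C"
  by (rule dual_algebra_assoc_algebra)

lemma left_action_conv:
  "f \<in> functionals \<Longrightarrow> g \<in> functionals \<Longrightarrow> x \<in> carrier C \<Longrightarrow>
    left_action (f \<star> g) x = left_action f (left_action g x)"
  by (rule functionals_separate) (simp_all add: conv_assoc flip: conv_left_action)

lemma actions_commute:
  assumes "f \<in> functionals" "g \<in> functionals" "x \<in> carrier C"
  shows "left_action f (right_action g x) = right_action g (left_action f x)"
proof (rule functionals_separate)
  fix h assume h: "h \<in> functionals"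
  have "h (left_action f (right_action g x)) = (h \<star> f) (right_action g x)"
    using assms h by (simp add: conv_left_action)
  also have "\<dots> = (g \<star> (h \<star> f)) x" using assms h by (simp add: conv_right_action[of g "h \<star> f"])
  also have "\<dots> = (g \<star> h \<star> f) x" using assms h by (simp add: conv_assoc)
  also have "\<dots> = (g \<star> h) (left_action f x)" using assms h by (simp add: conv_left_action[of "g \<star> h" f])
  also have "\<dots> = h (right_action g (left_action f x))" using assms h by (simp add: conv_right_action)
  finally show "h (left_action f (right_action g x)) = h (right_action g (left_action f x))" .
qed (use assms in simp_all)

lemma left_action_in_functional:
  assumes x: "x \<in> carrier C"
  shows "(\<lambda>f. left_action f x) \<in> linear_maps K (dual_space K C) C"
proof (rule linear_mapsI)
  fix f g assume fg: "f \<in> functionals" "g \<in> functionals"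
  have "f \<oplus>\<^bsub>dual_space K C\<^esub> g \<in> functionals" using fg by (rule D.M.a_closed)
  then show "left_action (f \<oplus>\<^bsub>dual_space K C\<^esub> g) x = left_action f x \<oplus>\<^bsub>C\<^esub> left_action g x"
    using x fg by (intro functionals_separate) (simp_all add: functional_add left_right_adjoint)
next
  fix a f assume af: "a \<in> carrier K" "f \<in> functionals"
  have "a \<odot>\<^bsub>dual_space K C\<^esub> f \<in> functionals" using af by (rule D.smult_closed)
  then show "left_action (a \<odot>\<^bsub>dual_space K C\<^esub> f) x = a \<odot>\<^bsub>C\<^esub> left_action f x"
    using x af by (intro functionals_separate) (simp_all add: functional_smult left_right_adjoint)
qed (use x in simp)

lemma right_action_in_functional:
  assumes x: "x \<in> carrier C"
  shows "(\<lambda>f. right_action f x) \<in> linear_maps K (dual_space K C) C"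
proof (rule linear_mapsI)
  fix f g assume fg: "f \<in> functionals" "g \<in> functionals"
  have "f \<oplus>\<^bsub>dual_space K C\<^esub> g \<in> functionals" using fg by (rule D.M.a_closed)
  then show "right_action (f \<oplus>\<^bsub>dual_space K C\<^esub> g) x = right_action f x \<oplus>\<^bsub>C\<^esub> right_action g x"
    using x fg by (intro functionals_separate) (simp_all add: functional_add flip: left_right_adjoint)
next
  fix a f assume af: "a \<in> carrier K" "f \<in> functionals"
  have "a \<odot>\<^bsub>dual_space K C\<^esub> f \<in> functionals" using af by (rule D.smult_closed)
  then show "right_action (a \<odot>\<^bsub>dual_space K C\<^esub> f) x = a \<odot>\<^bsub>C\<^esub> right_action f x"
    using x af by (intro functionals_separate) (simp_all add: functional_smult flip: left_right_adjoint)
qed (use x in simp)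

end

section \<open>Orbits and one-sided coideals\<close>

lemma linear_preimage_submodule:
  assumes "vspace K V" "vspace K W" "f \<in> linear_maps K V W" "submodule H K W"
  shows "submodule {x \<in> carrier V. f x \<in> H} K V"
proof -
  interpret V: vspace K V by fact
  interpret W: vspace K W by fact
  show ?thesis
    by (rule V.submodule_minus_freeI)
      (use W.submodule_zero[OF assms(4)] W.submoduleE(4,5)[OF assms(4)] in
        \<open>auto simp: linear_map_zero[OF assms(1-3)] linear_map_add[OF assms(3)] linear_map_smult[OF assms(3)]\<close>)
qed

lemma linear_image_submodule:
  assumes "vspace K V" "vspace K W" "f \<in> linear_maps K V W"
  shows "submodule (f ` carrier V) K W"
proof -
  interpret V: vspace K V by fact
  interpret W: vspace K W by fact
  show ?thesis
  proof (rule W.submodule_minus_freeI)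
    show "\<zero>\<^bsub>W\<^esub> \<in> f ` carrier V"
      by (rule image_eqI[of _ _ "\<zero>\<^bsub>V\<^esub>"]) (simp_all add: linear_map_zero[OF assms])
  next
    fix a y assume "a \<in> carrier K" "y \<in> f ` carrier V"
    then show "a \<odot>\<^bsub>W\<^esub> y \<in> f ` carrier V"
      by (auto simp flip: linear_map_smult[OF assms(3)])
  next
    fix y z assume "y \<in> f ` carrier V" "z \<in> f ` carrier V"
    then show "y \<oplus>\<^bsub>W\<^esub> z \<in> f ` carrier V"
      by (auto simp flip: linear_map_add[OF assms(3)])
  qed (use linear_map_closed[OF assms(3)] in auto)
qed

lemma linear_image_span:
  assumes "vspace K V" "vspace K W" "f \<in> linear_maps K V W" "S \<subseteq> carrier V"
  shows "f ` lin_span K V S \<subseteq> lin_span K W (f ` S)"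
proof -
  interpret V: vspace K V by fact
  interpret W: vspace K W by fact
  have "f ` S \<subseteq> carrier W" using assms(4) linear_map_closed[OF assms(3)] by auto
  then have "submodule {x \<in> carrier V. f x \<in> lin_span K W (f ` S)} K V"
    by (intro linear_preimage_submodule[OF assms(1-3)] W.span_submodule)
  moreover have "S \<subseteq> {x \<in> carrier V. f x \<in> lin_span K W (f ` S)}"
    using assms(4) W.span_superset by auto
  ultimately show ?thesis using V.span_least by blast
qed

context vspace
begin

lemma zero_submodule: "submodule {\<zero>\<^bsub>V\<^esub>} K V"
  using span_submodule[of "{}"] span_empty by simp

text \<open>
  Finitely many functionals \<open>s\<close> separate the points of \<open>span T2\<close>, so the kernel of \<open>R\<close> is the common kernel of the
  finitely many functionals \<open>s \<circ> R\<close> and has finite codimension.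
\<close>

lemma finite_dimensional_if_kernel_image:
  assumes R: "R \<in> linear_maps K V V"
    and T1: "finite T1" "T1 \<subseteq> carrier V" "\<And>x. x \<in> carrier V \<Longrightarrow> R x = \<zero>\<^bsub>V\<^esub> \<Longrightarrow> x \<in> span T1"
    and T2: "finite T2" "T2 \<subseteq> carrier V" "R ` carrier V \<subseteq> span T2"
  shows "finite_dimensional K V"
proof -
  interpret D: vspace K "dual_space K V" by (rule dual_space_vspace)
  have ev: "(\<lambda>t f. f t) ` T2 \<subseteq> linear_maps K (dual_space K V) (scalar_space K)"
    using T2(2) eval_linear by blast
  have "finite ((\<lambda>t f. f t) ` T2 :: (('c \<Rightarrow> 'a) \<Rightarrow> 'a) set)" using T2(1) by simp
  from D.finite_functionals_interpolate[OF this ev] obtain S where S: "finite S" "S \<subseteq> functionals"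
    and S_interp: "\<And>g. g \<in> functionals \<Longrightarrow> \<exists>s\<in>D.span S. \<forall>t\<in>T2. g t = s t" by auto
  have zero: "w = \<zero>\<^bsub>V\<^esub>" if w: "w \<in> span T2" "\<And>s. s \<in> S \<Longrightarrow> s w = \<zero>\<^bsub>K\<^esub>" for w
  proof (rule functionals_separate_zero)
    show wc: "w \<in> carrier V" using w(1) T2(2) span_closed by blast
    fix g assume g: "g \<in> functionals"
    obtain s where s: "s \<in> D.span S" "\<forall>t\<in>T2. g t = s t" using S_interp[OF g] by blast
    have sf: "s \<in> functionals" using s(1) S(2) D.span_closed by blast
    have gs: "g w = s w"
      using linear_eq_on_span[OF vspace_axioms scalars functional_linear[OF g] functional_linear[OF sf] T2(2) _ w(1)]
        s(2) by blast
    have "s w = \<zero>\<^bsub>scalar_space K\<^esub>"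
      by (rule linear_vanishes_on_span[OF dual_space_vspace scalars eval_linear[OF wc] S(2) _ s(1)]) (simp add: w(2))
    then show "g w = \<zero>\<^bsub>K\<^esub>" using gs by simp
  qed
  have sR: "(\<lambda>s x. s (R x)) ` S \<subseteq> linear_maps K V (scalar_space K)"
    using S(2) linear_maps_comp[OF R functional_linear] by blast
  have "finite ((\<lambda>s x. s (R x)) ` S)" using S(1) by simp
  from finite_functionals_interpolate[OF this sR] obtain T3 where T3: "finite T3" "T3 \<subseteq> carrier V"
    and T3_interp: "\<And>x. x \<in> carrier V \<Longrightarrow> \<exists>z\<in>span T3. \<forall>s\<in>S. s (R x) = s (R z)" by auto
  have T13: "T1 \<union> T3 \<subseteq> carrier V" using T1(2) T3(2) by blast
  have "x \<in> span (T1 \<union> T3)" if x: "x \<in> carrier V" for x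
  proof -
    obtain z where z: "z \<in> span T3" "\<forall>s\<in>S. s (R x) = s (R z)" using T3_interp[OF x] by blast
    have zc: "z \<in> carrier V" using z(1) T3(2) span_closed by blast
    have xz: "x \<ominus>\<^bsub>V\<^esub> z \<in> carrier V" using x zc by (rule M.minus_closed)
    have eq: "R (x \<ominus>\<^bsub>V\<^esub> z) = R x \<ominus>\<^bsub>V\<^esub> R z"
      by (rule linear_map_minus[OF vspace_axioms vspace_axioms R x zc])
    have "R (x \<ominus>\<^bsub>V\<^esub> z) = \<zero>\<^bsub>V\<^esub>"
    proof (rule zero)
      show "R (x \<ominus>\<^bsub>V\<^esub> z) \<in> span T2" using xz T2(3) by blast
      fix s assume s: "s \<in> S"
      then have sf: "s \<in> functionals" using S(2) by blast
      have "s (R x) = s (R z)" using z(2) s by blast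
      then show "s (R (x \<ominus>\<^bsub>V\<^esub> z)) = \<zero>\<^bsub>K\<^esub>"
        unfolding eq using sf linear_map_closed[OF R x] linear_map_closed[OF R zc]
        by (simp add: functional_minus R.diff_eq_zero_iff)
    qed
    then have "x \<ominus>\<^bsub>V\<^esub> z \<in> span (T1 \<union> T3)" using T1(3)[OF xz] span_mono[of T1 "T1 \<union> T3"] by blast
    moreover have "z \<in> span (T1 \<union> T3)" using z(1) span_mono[of T3 "T1 \<union> T3"] by blast
    ultimately have "(x \<ominus>\<^bsub>V\<^esub> z) \<oplus>\<^bsub>V\<^esub> z \<in> span (T1 \<union> T3)" by (rule submoduleE(5)[OF span_submodule[OF T13]])
    then show ?thesis using x zc by (simp add: a_minus_def M.a_assoc M.l_neg)
  qed
  then have "span (T1 \<union> T3) = carrier V" using span_closed[OF T13] by blast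
  then show ?thesis using T1(1) T3(1) T13 unfolding finite_dimensional_def by blast
qed

text \<open>
  The dimension of a subspace of a finitely spanned space, as a measure for a descent argument.
\<close>

definition rank where "rank W = Max (card ` {B. indep B \<and> B \<subseteq> W})"

lemma rank_strict_mono:
  assumes T: "finite T" "T \<subseteq> carrier V" and W: "submodule W K V" and W': "W' \<subseteq> span T" and less: "W \<subset> W'"
  shows "rank W < rank W'"
proof -
  have fin: "finite (card ` {B. indep B \<and> B \<subseteq> X})" if X: "X \<subseteq> span T" for X
  proof (rule finite_subset)
    show "card ` {B. indep B \<and> B \<subseteq> X} \<subseteq> {..card T}"
    proof
      fix n assume "n \<in> card ` {B. indep B \<and> B \<subseteq> X}"
      then obtain B where B: "indep B" "B \<subseteq> X" "n = card B" by blast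
      have "B \<subseteq> span T" using B(2) X by (rule order_trans)
      from indep_card_le(2)[OF T B(1) this] show "n \<in> {..card T}" using B(3) by simp
    qed
  qed simp
  have "{} \<in> {B. indep B \<and> B \<subseteq> W}" by (simp add: indep_def)
  then have ne: "card ` {B. indep B \<and> B \<subseteq> W} \<noteq> {}" by blast
  have "W \<subseteq> span T" using W' less by blast
  from Max_in[OF fin[OF this] ne] have "rank W \<in> card ` {B. indep B \<and> B \<subseteq> W}" by (simp add: rank_def)
  then obtain B where B: "indep B" "B \<subseteq> W" "card B = rank W" by auto
  obtain x where x: "x \<in> W'" "x \<notin> W" using less by blast
  have "B \<subseteq> span T" using B(2) W' less by blast
  then have finB: "finite B" using indep_card_le(1)[OF T B(1)] by blast
  have "x \<notin> span B" using x(2) span_least[OF W B(2)] by blast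
  moreover have "x \<in> carrier V" using x(1) W' T span_closed by blast
  ultimately have "indep (insert x B)" by (intro indep_insert B(1))
  moreover have "insert x B \<subseteq> W'" using x B less by blast
  ultimately have "card (insert x B) \<le> rank W'"
    unfolding rank_def by (intro Max_ge fin W') blast
  moreover have "x \<notin> B" using B x by blast
  ultimately show ?thesis using B(3) finB by simp
qed

end

lemma tensor_sum_dual_right:
  assumes "vspace K V" "vspace K W" "xs \<in> lists (carrier V \<times> carrier W)" "(u, v) \<in> set xs"
    "distinct (map fst xs)" "f u = \<one>\<^bsub>K\<^esub>" "\<And>u'. u' \<in> fst ` set xs \<Longrightarrow> u' \<noteq> u \<Longrightarrow> f u' = \<zero>\<^bsub>K\<^esub>"
  shows "tensor_sum W (\<lambda>a b. f a \<odot>\<^bsub>W\<^esub> b) xs = v"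
proof -
  let ?ys = "map prod.swap xs"
  have "tensor_sum W (\<lambda>a b. f a \<odot>\<^bsub>W\<^esub> b) xs = tensor_sum W (\<lambda>b a. f a \<odot>\<^bsub>W\<^esub> b) ?ys"
    by (induction xs) (auto simp: tensor_sum_def)
  also have "tensor_sum W (\<lambda>b a. f a \<odot>\<^bsub>W\<^esub> b) ?ys = v"
  proof (rule tensor_sum_dual_left[OF assms(2,1)])
    show "?ys \<in> lists (carrier W \<times> carrier V)" using assms(3) by auto
    show "(v, u) \<in> set ?ys" using assms(4) by force
    show "distinct (map snd ?ys)" using assms(5) by (simp add: comp_def)
    show "f u = \<one>\<^bsub>K\<^esub>" by fact
    fix u' assume "u' \<in> snd ` set ?ys" "u' \<noteq> u"
    moreover have "snd ` set ?ys = fst ` set xs" by force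
    ultimately show "f u' = \<zero>\<^bsub>K\<^esub>" using assms(7)[of u'] by simp
  qed
  finally show ?thesis .
qed

context coalgebra
begin

definition "left_orbit x = (\<lambda>f. left_action f x) ` functionals"

definition "right_orbit x = (\<lambda>f. right_action f x) ` functionals"

definition "left_stable I \<longleftrightarrow> submodule I K C \<and> (\<forall>f\<in>functionals. \<forall>x\<in>I. left_action f x \<in> I)"

definition "right_stable I \<longleftrightarrow> submodule I K C \<and> (\<forall>f\<in>functionals. \<forall>x\<in>I. right_action f x \<in> I)"

lemma left_orbit_self: "x \<in> carrier C \<Longrightarrow> x \<in> left_orbit x"
  unfolding left_orbit_def by (rule image_eqI[of _ _ \<epsilon>]) simp_all

lemma left_orbit_submodule: "x \<in> carrier C \<Longrightarrow> submodule (left_orbit x) K C"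
  unfolding left_orbit_def
  using linear_image_submodule[OF dual_space_vspace vspace_axioms left_action_in_functional] by simp

lemma right_orbit_submodule: "x \<in> carrier C \<Longrightarrow> submodule (right_orbit x) K C"
  unfolding right_orbit_def
  using linear_image_submodule[OF dual_space_vspace vspace_axioms right_action_in_functional] by simp

lemma left_orbit_stable: "x \<in> carrier C \<Longrightarrow> left_stable (left_orbit x)"
  by (auto simp: left_stable_def left_orbit_submodule)
    (auto simp: left_orbit_def simp flip: left_action_conv)

lemma left_orbit_least: "left_stable I \<Longrightarrow> x \<in> I \<Longrightarrow> left_orbit x \<subseteq> I"
  by (auto simp: left_stable_def left_orbit_def)

text \<open>
  Write \<open>\<Delta> x\<close> as a sum of \<open>u\<^sub>i \<otimes> v\<^sub>i\<close> with independent factors. Acting from the left with a functional dual to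
  \<open>v\<^sub>i\<close> gives \<open>u\<^sub>i\<close>, so the \<open>u\<^sub>i\<close> are a basis of the left orbit, and likewise the \<open>v\<^sub>i\<close> are a basis of the right
  orbit. Hence orbits are finite-dimensional, and the two orbits of \<open>x\<close> have the same dimension.
\<close>

lemma orbits_rep:
  assumes x: "x \<in> carrier C"
  obtains xs where "xs \<in> lists (carrier C \<times> carrier C)" "comult C x = tensor_class K C C xs"
    "indep (fst ` set xs)" "indep (snd ` set xs)" "card (fst ` set xs) = card (snd ` set xs)"
    "span (fst ` set xs) = left_orbit x" "span (snd ` set xs) = right_orbit x"
proof -
  obtain xs where xs: "xs \<in> lists (carrier C \<times> carrier C)" "tensor_class K C C xs = comult C x"
    "distinct (map fst xs)" "indep (fst ` set xs)" "distinct (map snd xs)" "indep (snd ` set xs)"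
    using comult_closed[OF x] by (rule CC.tensor_independent_rep)
  have sub: "fst ` set xs \<subseteq> carrier C" "snd ` set xs \<subseteq> carrier C"
    using xs(4,6) by (auto simp: indep_def)
  have left: "left_action f x = tensor_sum C (\<lambda>u v. f v \<odot>\<^bsub>C\<^esub> u) xs" if "f \<in> functionals" for f
    using CC.tensor_lift_cls[OF vspace_axioms CC.contract_right_bilinear[OF that] xs(1)] xs(2)
    by (simp add: left_action_def)
  have right: "right_action f x = tensor_sum C (\<lambda>u v. f u \<odot>\<^bsub>C\<^esub> v) xs" if "f \<in> functionals" for f
    using CC.tensor_lift_cls[OF vspace_axioms CC.contract_left_bilinear[OF that] xs(1)] xs(2)
    by (simp add: right_action_def)
  have "card (fst ` set xs) = card (snd ` set xs)"
    using distinct_card[OF xs(3)] distinct_card[OF xs(5)] by simp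
  moreover have "span (fst ` set xs) = left_orbit x"
  proof
    show "span (fst ` set xs) \<subseteq> left_orbit x"
    proof (rule span_least[OF left_orbit_submodule[OF x]], rule subsetI)
      fix u assume "u \<in> fst ` set xs"
      then obtain v where uv: "(u, v) \<in> set xs" by force
      then have "v \<in> snd ` set xs" by force
      from dual_functional[OF xs(6) this] obtain f where f: "f \<in> functionals" "f v = \<one>"
        "\<And>v'. v' \<in> snd ` set xs \<Longrightarrow> v' \<noteq> v \<Longrightarrow> f v' = \<zero>" by blast
      have "left_action f x = u"
        unfolding left[OF f(1)]
        by (rule tensor_sum_dual_left[where f = f, OF vspace_axioms vspace_axioms xs(1) uv xs(5) f(2,3)])
      then show "u \<in> left_orbit x" using f(1) by (auto simp: left_orbit_def)
    qed
    show "left_orbit x \<subseteq> span (fst ` set xs)"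
    proof
      fix y assume "y \<in> left_orbit x"
      then obtain f where f: "f \<in> functionals" "y = left_action f x" by (auto simp: left_orbit_def)
      show "y \<in> span (fst ` set xs)"
        unfolding f(2) left[OF f(1)]
      proof (rule tensor_sum_in_submodule[OF vspace_axioms span_submodule[OF sub(1)]])
        fix a b assume ab: "(a, b) \<in> set xs"
        then have "a \<in> span (fst ` set xs)" by (intro span_superset) force
        moreover have "f b \<in> carrier K" using ab reps_mem[OF xs(1) ab] f(1) by simp
        ultimately show "f b \<odot>\<^bsub>C\<^esub> a \<in> span (fst ` set xs)"
          using submoduleE(4)[OF span_submodule[OF sub(1)]] by blast
      qed
    qed
  qed
  moreover have "span (snd ` set xs) = right_orbit x"
  proof
    show "span (snd ` set xs) \<subseteq> right_orbit x"
    proof (rule span_least[OF right_orbit_submodule[OF x]], rule subsetI)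
      fix v assume "v \<in> snd ` set xs"
      then obtain u where uv: "(u, v) \<in> set xs" by force
      then have "u \<in> fst ` set xs" by force
      from dual_functional[OF xs(4) this] obtain f where f: "f \<in> functionals" "f u = \<one>"
        "\<And>u'. u' \<in> fst ` set xs \<Longrightarrow> u' \<noteq> u \<Longrightarrow> f u' = \<zero>" by blast
      have "right_action f x = v"
        unfolding right[OF f(1)]
        by (rule tensor_sum_dual_right[where f = f, OF vspace_axioms vspace_axioms xs(1) uv xs(3) f(2,3)])
      then show "v \<in> right_orbit x" using f(1) by (auto simp: right_orbit_def)
    qed
    show "right_orbit x \<subseteq> span (snd ` set xs)"
    proof
      fix y assume "y \<in> right_orbit x"
      then obtain f where f: "f \<in> functionals" "y = right_action f x" by (auto simp: right_orbit_def)
      show "y \<in> span (snd ` set xs)"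
        unfolding f(2) right[OF f(1)]
      proof (rule tensor_sum_in_submodule[OF vspace_axioms span_submodule[OF sub(2)]])
        fix a b assume ab: "(a, b) \<in> set xs"
        then have "b \<in> span (snd ` set xs)" by (intro span_superset) force
        moreover have "f a \<in> carrier K" using ab reps_mem[OF xs(1) ab] f(1) by simp
        ultimately show "f a \<odot>\<^bsub>C\<^esub> b \<in> span (snd ` set xs)"
          using submoduleE(4)[OF span_submodule[OF sub(2)]] by blast
      qed
    qed
  qed
  ultimately show thesis using that[of xs] xs by simp
qed

lemma left_orbit_finite:
  assumes "x \<in> carrier C"
  shows "\<exists>T. finite T \<and> T \<subseteq> carrier C \<and> left_orbit x = span T"
proof -
  obtain xs where xs: "indep (fst ` set xs)" "span (fst ` set xs) = left_orbit x"
      "xs \<in> lists (carrier C \<times> carrier C)"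
    using assms by (rule orbits_rep) (rule that; assumption)
  then show ?thesis by (intro exI[of _ "fst ` set xs"]) (auto simp: indep_def)
qed

text \<open>
  The left factors of an independent representation of \<open>\<Delta> x\<close> lie in the left orbit of \<open>x\<close>, hence in \<open>I\<close>. This
  brings the chain condition on right coideals to bear on submodules for the left action.
\<close>

lemma left_stable_right_coideal:
  assumes I: "left_stable I"
  shows "right_coideal K C I"
  unfolding right_coideal_def
proof (intro conjI ballI)
  show sub: "submodule I K C" using I by (simp add: left_stable_def)
  fix x assume xI: "x \<in> I"
  then have x: "x \<in> carrier C" using submoduleE(1)[OF sub] by blast
  obtain xs where xs: "xs \<in> lists (carrier C \<times> carrier C)" "comult C x = tensor_class K C C xs"
    "span (fst ` set xs) = left_orbit x"
    using x by (rule orbits_rep) (rule that; assumption)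
  show "comult C x \<in> lin_span K (tensor K C C) {pure_tensor K C C u v | u v. u \<in> I \<and> v \<in> carrier C}"
    unfolding xs(2)
  proof (rule CC.cls_in_span_pure[OF xs(1)])
    fix u v assume uv: "(u, v) \<in> set xs"
    then have "u \<in> span (fst ` set xs)" by (intro span_superset) force
    then have "u \<in> I" using xs(3) left_orbit_least[OF I xI] by blast
    moreover have "v \<in> carrier C" using reps_mem[OF xs(1) uv] by blast
    ultimately show "pure_tensor K C C u v \<in> {pure_tensor K C C u v | u v. u \<in> I \<and> v \<in> carrier C}" by blast
  qed (use submoduleE(1)[OF sub] CC.pure_closed in blast)
qed

end

section \<open>Left and right coideals of a chain coalgebra\<close>

context chain_coalgebra
begin

lemma left_stable_chain: "left_stable I \<Longrightarrow> left_stable J \<Longrightarrow> I \<subseteq> J \<or> J \<subseteq> I"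
  by (intro right_coideals_chain left_stable_right_coideal)

text \<open>
  Acting with \<open>f\<close> from the right maps the left orbit of \<open>x\<close> onto that of \<open>y\<close>, the result of acting on \<open>x\<close>. So
  the orbit of \<open>y\<close> has at most the dimension of the orbit of \<open>x\<close> and, as the two are comparable, cannot
  contain it properly.
\<close>

lemma right_action_in_left_orbit:
  assumes x: "x \<in> carrier C" and f: "f \<in> functionals"
  shows "right_action f x \<in> left_orbit x"
proof -
  let ?y = "right_action f x"
  have y: "?y \<in> carrier C" using x f by simp
  have "left_orbit ?y \<subseteq> left_orbit x"
  proof (rule ccontr)
    assume not: "\<not> left_orbit ?y \<subseteq> left_orbit x"
    then have sub: "left_orbit x \<subseteq> left_orbit ?y"
      using left_stable_chain[OF left_orbit_stable[OF x] left_orbit_stable[OF y]] by blast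
    obtain xs where xs: "indep (fst ` set xs)" "span (fst ` set xs) = left_orbit x"
      "xs \<in> lists (carrier C \<times> carrier C)"
      using x by (rule orbits_rep) (rule that; assumption)
    let ?U = "fst ` set xs"
    have U: "?U \<subseteq> carrier C" using xs(1) by (auto simp: indep_def)
    have fU: "right_action f ` ?U \<subseteq> carrier C" using U f by auto
    have "left_orbit ?y \<subseteq> right_action f ` left_orbit x"
      using x f by (auto simp: left_orbit_def actions_commute)
    also have "\<dots> \<subseteq> span (right_action f ` ?U)"
      using linear_image_span[OF vspace_axioms vspace_axioms right_action_linear[OF f] U] xs(2) by simp
    finally have y_span: "left_orbit ?y \<subseteq> span (right_action f ` ?U)" .
    have "?U \<subseteq> left_orbit x" unfolding xs(2)[symmetric] by (rule subsetI) (rule span_superset)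
    also note sub
    also note y_span
    finally have "?U \<subseteq> span (right_action f ` ?U)" .
    from indep_spans[OF _ fU xs(1) this] have "span ?U = span (right_action f ` ?U)"
      by (simp add: card_image_le)
    then show False using not y_span xs(2) by simp
  qed
  then show ?thesis using left_orbit_self[OF y] by blast
qed

text \<open>
  By the previous lemma one orbit contains the other, and they have the same dimension. This is how
  the chain condition on right coideals passes to left coideals.
\<close>

lemma orbits_equal:
  assumes x: "x \<in> carrier C"
  shows "right_orbit x = left_orbit x"
proof -
  obtain xs where xs: "indep (fst ` set xs)" "indep (snd ` set xs)"
    "card (fst ` set xs) = card (snd ` set xs)"
    "span (fst ` set xs) = left_orbit x" "span (snd ` set xs) = right_orbit x"
    "xs \<in> lists (carrier C \<times> carrier C)"
    using x by (rule orbits_rep) (rule that; assumption)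
  have "right_orbit x \<subseteq> left_orbit x"
    using right_action_in_left_orbit[OF x] by (auto simp: right_orbit_def)
  then have "span (snd ` set xs) \<subseteq> span (fst ` set xs)" by (simp only: xs(4,5))
  moreover have "snd ` set xs \<subseteq> span (snd ` set xs)" by (rule subsetI) (rule span_superset)
  ultimately have "snd ` set xs \<subseteq> span (fst ` set xs)" by (rule order_trans[rotated])
  moreover have "fst ` set xs \<subseteq> carrier C" using xs(1) by (simp add: indep_def)
  ultimately have "span (snd ` set xs) = span (fst ` set xs)"
    using xs by (intro indep_spans) simp_all
  then show ?thesis using xs by simp
qed

lemma right_stable_iff_left_stable: "right_stable I \<longleftrightarrow> left_stable I"
proof (cases "submodule I K C")
  case True
  then have "x \<in> carrier C" if "x \<in> I" for x using submoduleE(1)[OF True] that by blast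
  moreover have "left_stable I \<longleftrightarrow> (\<forall>x\<in>I. left_orbit x \<subseteq> I)"
    using True by (auto simp: left_stable_def left_orbit_def)
  moreover have "right_stable I \<longleftrightarrow> (\<forall>x\<in>I. right_orbit x \<subseteq> I)"
    using True by (auto simp: right_stable_def right_orbit_def)
  ultimately show ?thesis using orbits_equal by auto
qed (simp_all add: left_stable_def right_stable_def)

text \<open>
  A proper left submodule is comparable with the orbit of any vector outside it, hence contained in
  that finite-dimensional orbit.
\<close>

lemma proper_stable_finite:
  assumes "left_stable I" "I \<noteq> carrier C"
  shows "\<exists>T. finite T \<and> T \<subseteq> carrier C \<and> I \<subseteq> span T"
proof -
  have "I \<subseteq> carrier C" using assms(1) submoduleE(1) by (auto simp: left_stable_def)
  then obtain x where x: "x \<in> carrier C" "x \<notin> I" using assms(2) by blast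
  then have "I \<subseteq> left_orbit x"
    using left_stable_chain[OF assms(1) left_orbit_stable[OF x(1)]] left_orbit_self by blast
  then show ?thesis using left_orbit_finite[OF x(1)] by blast
qed

text \<open>
  This kernel is the largest left coideal on which \<open>f\<close> vanishes, and its annihilator will turn out to be
  the left ideal generated by \<open>f\<close>.
\<close>

definition "kernel_of f = {x \<in> carrier C. left_action f x = \<zero>\<^bsub>C\<^esub>}"

lemma kernel_of_left_stable:
  assumes f: "f \<in> functionals" shows "left_stable (kernel_of f)"
proof -
  have "submodule (kernel_of f) K C"
    using linear_preimage_submodule[OF vspace_axioms vspace_axioms left_action_linear[OF f] zero_submodule]
    by (simp add: kernel_of_def)
  moreover have "right_action g x \<in> kernel_of f" if "g \<in> functionals" "x \<in> kernel_of f" for g x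
    using that f linear_map_zero[OF vspace_axioms vspace_axioms right_action_linear]
    by (simp add: kernel_of_def actions_commute)
  ultimately have "right_stable (kernel_of f)" by (simp add: right_stable_def)
  then show ?thesis by (simp add: right_stable_iff_left_stable)
qed

lemma functional_vanishes_on_kernel:
  assumes f: "f \<in> functionals" and x: "x \<in> kernel_of f"
  shows "f x = \<zero>"
proof -
  have "f x = \<epsilon> (left_action f x)"
    using f x conv_counit_left[OF f] conv_left_action[of \<epsilon> f x] by (simp add: kernel_of_def)
  then show ?thesis using x functional_zero[of \<epsilon>] by (simp add: kernel_of_def)
qed

lemma kernel_of_proper:
  assumes f: "f \<in> functionals" "f \<noteq> \<zero>\<^bsub>dual_space K C\<^esub>"
  shows "kernel_of f \<noteq> carrier C"
proof
  assume "kernel_of f = carrier C"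
  then have "f = \<zero>\<^bsub>dual_space K C\<^esub>"
    using functional_vanishes_on_kernel[OF f(1)] D.M.zero_closed
    by (intro functional_ext f(1)) simp_all
  then show False using f(2) by blast
qed

lemma kernel_of_finite:
  assumes "f \<in> functionals" "f \<noteq> \<zero>\<^bsub>dual_space K C\<^esub>"
  shows "\<exists>T. finite T \<and> T \<subseteq> carrier C \<and> kernel_of f \<subseteq> span T"
  by (rule proper_stable_finite[OF kernel_of_left_stable kernel_of_proper]) (use assms in simp_all)

end

section \<open>The dual algebra of an infinite-dimensional chain coalgebra\<close>

locale infinite_chain_coalgebra = chain_coalgebra +
  assumes infinite_dimensional: "\<not> finite_dimensional K C"
begin

text \<open>
  Kernel and image of the left action of \<open>f\<close> are right submodules, because the two actions commute. Both
  cannot be finite-dimensional, the kernel is since \<open>f \<noteq> 0\<close>, and so the image is everything.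
\<close>

lemma left_action_surj:
  assumes f: "f \<in> functionals" "f \<noteq> \<zero>\<^bsub>dual_space K C\<^esub>"
  shows "left_action f ` carrier C = carrier C"
proof (rule ccontr)
  assume proper: "left_action f ` carrier C \<noteq> carrier C"
  have "submodule (left_action f ` carrier C) K C"
    by (rule linear_image_submodule[OF vspace_axioms vspace_axioms left_action_linear[OF f(1)]])
  moreover have "right_action g y \<in> left_action f ` carrier C"
    if "g \<in> functionals" "y \<in> left_action f ` carrier C" for g y
    using that f by (auto simp flip: actions_commute)
  ultimately have "right_stable (left_action f ` carrier C)" by (simp add: right_stable_def)
  then obtain T2 where T2: "finite T2" "T2 \<subseteq> carrier C" "left_action f ` carrier C \<subseteq> span T2"
    using proper_stable_finite[OF _ proper] by (auto simp: right_stable_iff_left_stable)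
  obtain T1 where T1: "finite T1" "T1 \<subseteq> carrier C" "kernel_of f \<subseteq> span T1"
    using kernel_of_finite[OF f] by blast
  have "finite_dimensional K C"
    by (rule finite_dimensional_if_kernel_image[OF left_action_linear[OF f(1)] T1(1,2) _ T2])
      (use T1(3) in \<open>auto simp: kernel_of_def\<close>)
  then show False using infinite_dimensional by blast
qed

text \<open>
  Since the left action of \<open>f\<close> is onto, \<open>h\<close> factors as \<open>h x = g (left_action f x)\<close> if it vanishes on the
  kernel. Thus the left ideal of a nonzero \<open>f\<close> is the annihilator of a finite-dimensional coideal, and
  inclusions between principal left ideals are reversed inclusions between kernels.
\<close>

lemma principal_left_ideal:
  assumes f: "f \<in> functionals" "f \<noteq> \<zero>\<^bsub>dual_space K C\<^esub>" and h: "h \<in> functionals"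
    and van: "\<And>x. x \<in> kernel_of f \<Longrightarrow> h x = \<zero>"
  shows "\<exists>g\<in>functionals. h = g \<star> f"
proof -
  define s where "s y = (SOME x. x \<in> carrier C \<and> left_action f x = y)" for y
  have s: "s y \<in> carrier C \<and> left_action f (s y) = y" if y: "y \<in> carrier C" for y
  proof -
    have "y \<in> left_action f ` carrier C" using y left_action_surj[OF f] by simp
    then obtain x where "x \<in> carrier C \<and> left_action f x = y" by auto
    then show ?thesis unfolding s_def by (rule someI)
  qed
  have h_eq: "h x = h x'" if x: "x \<in> carrier C" "x' \<in> carrier C" "left_action f x = left_action f x'" for x x'
  proof -
    have "left_action f (x \<ominus>\<^bsub>C\<^esub> x') = \<zero>\<^bsub>C\<^esub>"
      unfolding linear_map_minus[OF vspace_axioms vspace_axioms left_action_linear[OF f(1)] x(1,2)]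
      using x f(1) by (simp add: M.diff_eq_zero_iff)
    then have "h (x \<ominus>\<^bsub>C\<^esub> x') = \<zero>" using x by (intro van) (simp add: kernel_of_def)
    then show ?thesis using x h by (simp add: functional_minus R.diff_eq_zero_iff)
  qed
  define g where "g = restrict (\<lambda>y. h (s y)) (carrier C)"
  have g: "g \<in> functionals"
    unfolding g_def
  proof (rule functionalI)
    fix y assume "y \<in> carrier C"
    then show "h (s y) \<in> carrier K" using s h by simp
  next
    fix y z assume yz: "y \<in> carrier C" "z \<in> carrier C"
    have "h (s (y \<oplus>\<^bsub>C\<^esub> z)) = h (s y \<oplus>\<^bsub>C\<^esub> s z)"
      using s[OF yz(1)] s[OF yz(2)] s[OF M.a_closed[OF yz]] linear_map_add[OF left_action_linear[OF f(1)]]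
      by (intro h_eq) simp_all
    then show "h (s (y \<oplus>\<^bsub>C\<^esub> z)) = h (s y) \<oplus> h (s z)"
      using s[OF yz(1)] s[OF yz(2)] h by (simp add: functional_add)
  next
    fix a y assume ay: "a \<in> carrier K" "y \<in> carrier C"
    have "h (s (a \<odot>\<^bsub>C\<^esub> y)) = h (a \<odot>\<^bsub>C\<^esub> s y)"
      using s[OF ay(2)] s[OF smult_closed[OF ay]] linear_map_smult[OF left_action_linear[OF f(1)] ay(1)] ay
      by (intro h_eq) simp_all
    then show "h (s (a \<odot>\<^bsub>C\<^esub> y)) = a \<otimes> h (s y)"
      using s[OF ay(2)] ay h by (simp add: functional_smult)
  qed
  have "h = g \<star> f"
  proof (rule functional_ext[OF h conv_closed[OF g f(1)]])
    fix x assume x: "x \<in> carrier C"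
    then have y: "left_action f x \<in> carrier C" using f(1) by simp
    have "(g \<star> f) x = h (s (left_action f x))" using x y g f(1) by (simp add: conv_left_action g_def)
    also have "\<dots> = h x" using s[OF y] x by (intro h_eq) simp_all
    finally show "h x = (g \<star> f) x" by simp
  qed
  then show ?thesis using g by blast
qed

lemma left_ideal_zero: "left_ideal J (dual_algebra K C) \<Longrightarrow> \<zero>\<^bsub>dual_space K C\<^esub> \<in> J"
  using additive_subgroup.zero_closed[of J "dual_algebra K C"] by (simp add: left_ideal_def)

lemma left_ideal_subset: "left_ideal J (dual_algebra K C) \<Longrightarrow> J \<subseteq> functionals"
  using additive_subgroup.a_subset[of J "dual_algebra K C"] by (simp add: left_ideal_def)

lemma left_ideal_absorb:
  assumes J: "left_ideal J (dual_algebra K C)" and f: "f \<in> J" "f \<noteq> \<zero>\<^bsub>dual_space K C\<^esub>"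
    and h: "h \<in> functionals" "kernel_of f \<subseteq> kernel_of h"
  shows "h \<in> J"
proof -
  have fc: "f \<in> functionals" using left_ideal_subset[OF J] f by blast
  obtain g where "g \<in> functionals" "h = g \<star> f"
    using principal_left_ideal[OF fc f(2) h(1)] functional_vanishes_on_kernel[OF h(1)] h(2) by blast
  then show ?thesis using left_ideal.left_closed[OF J, of g f] f by simp
qed

lemma kernel_of_chain:
  "f \<in> functionals \<Longrightarrow> g \<in> functionals \<Longrightarrow> kernel_of f \<subseteq> kernel_of g \<or> kernel_of g \<subseteq> kernel_of f"
  by (intro left_stable_chain kernel_of_left_stable)

text \<open>
  A nonzero element of the union of the ideals whose kernel has the least dimension generates that
  union, because kernels form a chain.
\<close>

lemma dual_algebra_left_noetherian:
  assumes I: "\<And>n::nat. left_ideal (I n) (dual_algebra K C)" and inc: "\<And>n. I n \<subseteq> I (Suc n)"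
  shows "\<exists>m. \<forall>n\<ge>m. I n = I m"
proof -
  let ?P = "\<lambda>f. f \<noteq> \<zero>\<^bsub>dual_space K C\<^esub> \<and> (\<exists>n. f \<in> I n)"
  have mono: "I m \<subseteq> I n" if "m \<le> n" for m n using inc that by (rule lift_Suc_mono_le)
  show ?thesis
  proof (cases "\<exists>f. ?P f")
    case False
    then have "I n = {\<zero>\<^bsub>dual_space K C\<^esub>}" for n using left_ideal_zero[OF I] by blast
    then show ?thesis by simp
  next
    case True
    then obtain f0 where "?P f0" by blast
    from ex_has_least_nat[of ?P f0 "\<lambda>f. rank (kernel_of f)", OF this] obtain f m
      where f: "f \<noteq> \<zero>\<^bsub>dual_space K C\<^esub>" "f \<in> I m"
      and least: "\<And>g. ?P g \<Longrightarrow> rank (kernel_of f) \<le> rank (kernel_of g)" by blast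
    have fc: "f \<in> functionals" using left_ideal_subset[OF I] f(2) by blast
    obtain T where T: "finite T" "T \<subseteq> carrier C" "kernel_of f \<subseteq> span T"
      using kernel_of_finite[OF fc f(1)] by blast
    have "I n \<subseteq> I m" for n
    proof
      fix g assume g: "g \<in> I n"
      have gc: "g \<in> functionals" using left_ideal_subset[OF I] g by blast
      show "g \<in> I m"
      proof (cases "g = \<zero>\<^bsub>dual_space K C\<^esub>")
        case True
        then show ?thesis using left_ideal_zero[OF I] by simp
      next
        case False
        have "\<not> kernel_of g \<subset> kernel_of f"
        proof
          assume less: "kernel_of g \<subset> kernel_of f"
          have "submodule (kernel_of g) K C" using kernel_of_left_stable[OF gc] by (simp add: left_stable_def)
          from rank_strict_mono[OF T(1,2) this T(3) less] least[of g] show False using False g by auto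
        qed
        then have "kernel_of f \<subseteq> kernel_of g" using kernel_of_chain[OF fc gc] by blast
        then show ?thesis by (rule left_ideal_absorb[OF I f(2,1) gc])
      qed
    qed
    then have "\<forall>n\<ge>m. I n = I m" using mono by blast
    then show ?thesis by blast
  qed
qed

text \<open>
  There are no zero divisors because \<open>(f \<star> g) x = f (left_action g x)\<close> and nonzero elements act
  surjectively.
\<close>

lemma dual_algebra_chain_domain: "left_noetherian_chain_domain (dual_algebra K C)"
proof (intro left_noetherian_chain_domain.intro left_noetherian_chain_domain_axioms.intro A.ring_axioms)
  show "\<epsilon> \<noteq> \<zero>\<^bsub>dual_algebra K C\<^esub>"
  proof
    assume "\<epsilon> = \<zero>\<^bsub>dual_algebra K C\<^esub>"
    then have zero: "\<epsilon> = \<zero>\<^bsub>dual_space K C\<^esub>" by simp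
    have "x \<in> span {}" if x: "x \<in> carrier C" for x
    proof -
      have "x = left_action \<zero>\<^bsub>dual_space K C\<^esub> x" using left_action_counit[OF x] zero by simp
      also have "\<dots> = \<zero>\<^bsub>C\<^esub>"
        by (rule linear_map_zero[OF dual_space_vspace vspace_axioms left_action_in_functional[OF x]])
      finally show ?thesis using span_empty by simp
    qed
    then have "span {} = carrier C" using span_closed[of "{}"] by auto
    then have "finite_dimensional K C" unfolding finite_dimensional_def by blast
    then show False using infinite_dimensional by blast
  qed
next
  fix f g assume "f \<in> carrier (dual_algebra K C)" "g \<in> carrier (dual_algebra K C)"
    and "f \<star> g = \<zero>\<^bsub>dual_algebra K C\<^esub>"
  then have fg: "f \<in> functionals" "g \<in> functionals" and zero: "f \<star> g = \<zero>\<^bsub>dual_space K C\<^esub>" by simp_all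
  have "f = \<zero>\<^bsub>dual_space K C\<^esub>" if g0: "g \<noteq> \<zero>\<^bsub>dual_space K C\<^esub>"
  proof (rule functional_ext[OF fg(1) D.M.zero_closed])
    fix y assume y: "y \<in> carrier C"
    then have "y \<in> left_action g ` carrier C" using left_action_surj[OF fg(2) g0] by simp
    then obtain x where x: "x \<in> carrier C" "y = left_action g x" by auto
    then have "f y = (f \<star> g) x" using fg by (simp add: conv_left_action)
    then show "f y = \<zero>\<^bsub>dual_space K C\<^esub> y" using zero x y by simp
  qed
  then show "f = \<zero>\<^bsub>dual_algebra K C\<^esub> \<or> g = \<zero>\<^bsub>dual_algebra K C\<^esub>" by auto
next
  fix I :: "nat \<Rightarrow> _"
  assume "\<And>n. left_ideal (I n) (dual_algebra K C)" "\<And>n. I n \<subseteq> I (Suc n)"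
  then show "\<exists>m. \<forall>n\<ge>m. I n = I m" by (rule dual_algebra_left_noetherian)
next
  fix J L assume J: "left_ideal J (dual_algebra K C)" and L: "left_ideal L (dual_algebra K C)"
  show "J \<subseteq> L \<or> L \<subseteq> J"
  proof (rule ccontr)
    assume "\<not> (J \<subseteq> L \<or> L \<subseteq> J)"
    then obtain f g where fg: "f \<in> J" "f \<notin> L" "g \<in> L" "g \<notin> J" by blast
    then have c: "f \<in> functionals" "g \<in> functionals" using left_ideal_subset J L by blast+
    have nz: "f \<noteq> \<zero>\<^bsub>dual_space K C\<^esub>" "g \<noteq> \<zero>\<^bsub>dual_space K C\<^esub>"
      using fg left_ideal_zero[OF J] left_ideal_zero[OF L] by auto
    from kernel_of_chain[OF c] show False
      using left_ideal_absorb[OF J fg(1) nz(1) c(2)] left_ideal_absorb[OF L fg(3) nz(2) c(1)] fg by blast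
  qed
qed

end

section \<open>Transport of coalgebra structures\<close>

lemma bilinear_maps_cong:
  assumes "\<beta> \<in> bilinear_maps K V W U" "vspace K V" "vspace K W"
    "\<And>v w. v \<in> carrier V \<Longrightarrow> w \<in> carrier W \<Longrightarrow> \<gamma> v w = \<beta> v w"
  shows "\<gamma> \<in> bilinear_maps K V W U"
proof -
  interpret V: vspace K V by fact
  interpret W: vspace K W by fact
  show ?thesis by (rule bilinear_mapsI) (simp_all add: assms(4) bilinear_mapsD[OF assms(1)])
qed

lemma tensor_map_comp:
  assumes P: "vspace_pair K A B" and Q: "vspace_pair K V W" and R: "vspace_pair K X Y"
    and f: "f1 \<in> linear_maps K A V" "f2 \<in> linear_maps K B W"
    and g: "g1 \<in> linear_maps K V X" "g2 \<in> linear_maps K W Y"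
    and h: "h1 \<in> linear_maps K A X" "h2 \<in> linear_maps K B Y"
    and eq: "\<And>a. a \<in> carrier A \<Longrightarrow> g1 (f1 a) = h1 a" "\<And>b. b \<in> carrier B \<Longrightarrow> g2 (f2 b) = h2 b"
    and t: "t \<in> carrier (tensor K A B)"
  shows "tensor_map K X Y g1 g2 (tensor_map K V W f1 f2 t) = tensor_map K X Y h1 h2 t"
proof -
  interpret P: vspace_pair K A B by (rule P)
  have "tensor_map K X Y g1 g2 (tensor_map K V W f1 f2 (P.pure a b)) = tensor_map K X Y h1 h2 (P.pure a b)"
    if ab: "a \<in> carrier A" "b \<in> carrier B" for a b
    unfolding tensor_map_pure[OF P Q f ab] tensor_map_pure[OF P R h ab]
      tensor_map_pure[OF Q R g linear_map_closed[OF f(1) ab(1)] linear_map_closed[OF f(2) ab(2)]]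
    by (simp add: eq ab)
  from P.linear_eq_on_pure[OF vspace_pair.tensor_vspace[OF R]
      linear_maps_comp[OF tensor_map_linear[OF P Q f] tensor_map_linear[OF Q R g]]
      tensor_map_linear[OF P R h] this t]
  show ?thesis .
qed

lemma tensor_map_surj:
  assumes P: "vspace_pair K A B" and Q: "vspace_pair K V W"
    and f: "f \<in> linear_maps K A V" "g \<in> linear_maps K B W"
    and surj: "f ` carrier A = carrier V" "g ` carrier B = carrier W"
    and t: "t \<in> carrier (tensor K V W)"
  shows "\<exists>s\<in>carrier (tensor K A B). t = tensor_map K V W f g s"
proof -
  interpret P: vspace_pair K A B by (rule P)
  interpret Q: vspace_pair K V W by (rule Q)
  interpret PT: vspace K "tensor K A B" by (rule P.tensor_vspace)
  note lin = tensor_map_linear[OF P Q f]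
  show ?thesis using t
  proof (induction t rule: Q.tensor_induct)
    case zero
    then show ?case
      using linear_map_zero[OF P.tensor_vspace Q.tensor_vspace lin] PT.M.zero_closed by metis
  next
    case (add v w t)
    then obtain s where s: "s \<in> carrier (tensor K A B)" "t = tensor_map K V W f g s" by blast
    have "v \<in> f ` carrier A" "w \<in> g ` carrier B" using add surj by simp_all
    then obtain a b where ab: "a \<in> carrier A" "b \<in> carrier B" "v = f a" "w = g b" by blast
    have "Q.pure v w \<oplus>\<^bsub>tensor K V W\<^esub> t = tensor_map K V W f g (P.pure a b \<oplus>\<^bsub>tensor K A B\<^esub> s)"
      unfolding linear_map_add[OF lin P.pure_closed[OF ab(1,2)] s(1)] tensor_map_pure[OF P Q f ab(1,2)]
      using s(2) ab by simp
    then show ?case using PT.M.a_closed[OF P.pure_closed[OF ab(1,2)] s(1)] by blast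
  qed
qed

lemma tensor_assoc_natural:
  assumes C: "vspace K C" and D: "vspace K D" and F: "F \<in> linear_maps K C D"
    and s: "s \<in> carrier (tensor K (tensor K C C) C)"
  shows "tensor_assoc K D D D (tensor_map K (tensor K D D) D (tensor_map K D D F F) F s) =
    tensor_map K D (tensor K D D) F (tensor_map K D D F F) (tensor_assoc K C C C s)"
proof -
  interpret C: vspace_triple K C C C by (intro vspace_triple.intro C)
  interpret D: vspace_triple K D D D by (intro vspace_triple.intro D)
  note FF = tensor_map_linear[OF C.UV.vspace_pair_axioms D.UV.vspace_pair_axioms F F]
  note FFF = tensor_map_linear[OF C.UV_W.vspace_pair_axioms D.UV_W.vspace_pair_axioms FF F]
  note FFF' = tensor_map_linear[OF C.U_VW.vspace_pair_axioms D.U_VW.vspace_pair_axioms F FF]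
  note lin = linear_maps_comp[OF FFF D.tensor_assoc_linear]
  note lin' = linear_maps_comp[OF C.tensor_assoc_linear FFF']
  note Fc = linear_map_closed[OF F]
  have eq: "tensor_assoc K D D D (tensor_map K (tensor K D D) D (tensor_map K D D F F) F (C.UV_W.pure t w)) =
      tensor_map K D (tensor K D D) F (tensor_map K D D F F) (tensor_assoc K C C C (C.UV_W.pure t w))"
    if t: "t \<in> carrier (tensor K C C)" and w: "w \<in> carrier C" for t w
  proof -
    have tlin: "(\<lambda>t. C.UV_W.pure t w) \<in> linear_maps K (tensor K C C) (tensor K (tensor K C C) C)"
      using w by (intro linear_mapsI)
        (simp_all add: C.UV_W.pure_closed C.UV_W.pure_add_left C.UV_W.pure_smult_left)
    have "tensor_assoc K D D D (tensor_map K (tensor K D D) D (tensor_map K D D F F) F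
          (C.UV_W.pure (C.UV.pure u v) w)) =
        tensor_map K D (tensor K D D) F (tensor_map K D D F F)
          (tensor_assoc K C C C (C.UV_W.pure (C.UV.pure u v) w))"
      if uv: "u \<in> carrier C" "v \<in> carrier C" for u v
      unfolding C.tensor_assoc_pure[OF uv w]
        tensor_map_pure[OF C.UV_W.vspace_pair_axioms D.UV_W.vspace_pair_axioms FF F C.UV.pure_closed[OF uv] w]
        tensor_map_pure[OF C.U_VW.vspace_pair_axioms D.U_VW.vspace_pair_axioms F FF uv(1) C.UV.pure_closed[OF uv(2) w]]
        tensor_map_pure[OF C.UV.vspace_pair_axioms D.UV.vspace_pair_axioms F F uv]
        tensor_map_pure[OF C.UV.vspace_pair_axioms D.UV.vspace_pair_axioms F F uv(2) w]
        D.tensor_assoc_pure[OF Fc[OF uv(1)] Fc[OF uv(2)] Fc[OF w]]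
      by simp
    from C.UV.linear_eq_on_pure[OF D.U_VW.tensor_vspace linear_maps_comp[OF tlin lin]
        linear_maps_comp[OF tlin lin'] this t]
    show ?thesis .
  qed
  from C.UV_W.linear_eq_on_pure[OF D.U_VW.tensor_vspace lin lin' eq s] show ?thesis .
qed

lemma linear_if_comp_surj:
  assumes C: "vspace K C" and F: "F \<in> linear_maps K C D" and surj: "F ` carrier C = carrier D"
    and h: "h \<in> linear_maps K C U" and gF: "\<And>x. x \<in> carrier C \<Longrightarrow> g (F x) = h x"
  shows "g \<in> linear_maps K D U"
proof -
  interpret C: vspace K C by (rule C)
  have cases: thesis if "y \<in> carrier D" "\<And>x. x \<in> carrier C \<Longrightarrow> y = F x \<Longrightarrow> thesis" for y thesis
    using that unfolding surj[symmetric] by blast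
  show ?thesis
  proof (rule linear_mapsI)
    fix y assume "y \<in> carrier D"
    then show "g y \<in> carrier U" by (elim cases) (simp add: gF linear_map_closed[OF h])
  next
    fix y z assume "y \<in> carrier D" "z \<in> carrier D"
    then show "g (y \<oplus>\<^bsub>D\<^esub> z) = g y \<oplus>\<^bsub>U\<^esub> g z"
      by (elim cases) (simp add: gF linear_map_add[OF h] flip: linear_map_add[OF F])
  next
    fix a y assume a: "a \<in> carrier K" and y: "y \<in> carrier D"
    show "g (a \<odot>\<^bsub>D\<^esub> y) = a \<odot>\<^bsub>U\<^esub> g y"
      using y a by (elim cases) (simp add: gF linear_map_smult[OF h] flip: linear_map_smult[OF F])
  qed
qed

text \<open>
  The axioms hold for \<open>F x\<close> because they are the images of the axioms for \<open>x\<close> under maps induced by \<open>F\<close>.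
\<close>

lemma coalgebra_transport:
  assumes C: "coalgebra K C" and D: "vspace K D" and F: "F \<in> linear_maps K C D"
    and surj: "F ` carrier C = carrier D"
    and comult: "\<And>x. x \<in> carrier C \<Longrightarrow> comult D (F x) = tensor_map K D D F F (comult C x)"
    and counit: "\<And>x. x \<in> carrier C \<Longrightarrow> counit D (F x) = counit C x"
  shows "coalgebra K D"
proof -
  interpret C: coalgebra K C by (rule C)
  interpret D: vspace_triple K D D D by (intro vspace_triple.intro D)
  note CC = C.CC.vspace_pair_axioms and DD = D.UV.vspace_pair_axioms
  note FF = tensor_map_linear[OF CC DD F F]
  have cases: "\<exists>x\<in>carrier C. y = F x" if "y \<in> carrier D" for y
  proof -
    have "y \<in> F ` carrier C" using that surj by simp
    then show ?thesis by blast
  qed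
  have comult_linear: "comult D \<in> linear_maps K D (tensor K D D)"
    by (rule linear_if_comp_surj[OF C.vspace_axioms F surj linear_maps_comp[OF C.comult_linear FF] comult])
  have counit_linear: "counit D \<in> linear_maps K D (scalar_space K)"
    by (rule linear_if_comp_surj[OF C.vspace_axioms F surj C.counit_linear counit])
  have contract_left: "(\<lambda>u v. e u \<odot>\<^bsub>V\<^esub> v) \<in> bilinear_maps K V V V"
    and contract_right: "(\<lambda>u v. e v \<odot>\<^bsub>V\<^esub> u) \<in> bilinear_maps K V V V"
    if V: "vspace_pair K V V" and e: "e \<in> linear_maps K V (scalar_space K)" for V e
  proof -
    interpret V: vspace_pair K V V by (rule V)
    have e': "restrict e (carrier V) \<in> V.V.functionals" using e by (rule V.V.functional_restrict)
    show "(\<lambda>u v. e u \<odot>\<^bsub>V\<^esub> v) \<in> bilinear_maps K V V V"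
      by (rule bilinear_maps_cong[OF V.contract_left_bilinear[OF e'] V.V.vspace_axioms V.V.vspace_axioms]) simp
    show "(\<lambda>u v. e v \<odot>\<^bsub>V\<^esub> u) \<in> bilinear_maps K V V V"
      by (rule bilinear_maps_cong[OF V.contract_right_bilinear[OF e'] V.V.vspace_axioms V.V.vspace_axioms]) simp
  qed
  have contract: "tensor_lift D \<gamma> (tensor_map K D D F F t) = F (tensor_lift C \<beta> t)"
    if \<beta>: "\<beta> \<in> bilinear_maps K C C C" and \<gamma>: "\<gamma> \<in> bilinear_maps K D D D" and t: "t \<in> carrier (tensor K C C)"
      and eq: "\<And>u v. u \<in> carrier C \<Longrightarrow> v \<in> carrier C \<Longrightarrow> \<gamma> (F u) (F v) = F (\<beta> u v)" for \<beta> \<gamma> t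
  proof -
    have "tensor_lift D \<gamma> (tensor_map K D D F F (C.CC.pure u v)) = F (tensor_lift C \<beta> (C.CC.pure u v))"
      if uv: "u \<in> carrier C" "v \<in> carrier C" for u v
      unfolding tensor_map_pure[OF CC DD F F uv] C.CC.tensor_lift_pure[OF C.vspace_axioms \<beta> uv]
        D.UV.tensor_lift_pure[OF D \<gamma> linear_map_closed[OF F uv(1)] linear_map_closed[OF F uv(2)]]
      by (rule eq[OF uv])
    from C.CC.linear_eq_on_pure[OF D linear_maps_comp[OF FF D.UV.tensor_lift_linear[OF D \<gamma>]]
        linear_maps_comp[OF C.CC.tensor_lift_linear[OF C.vspace_axioms \<beta>] F] this t]
    show ?thesis .
  qed
  note smult = linear_map_smult[OF F]
  note ce = linear_map_closed[OF C.counit_linear]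
  show ?thesis
  proof (intro coalgebra.intro coalgebra_axioms.intro D comult_linear counit_linear)
    fix y assume "y \<in> carrier D"
    then obtain x where x: "x \<in> carrier C" "y = F x" using cases by blast
    note \<Delta> = C.comult_closed[OF x(1)]
    have "tensor_lift D (\<lambda>u v. counit D u \<odot>\<^bsub>D\<^esub> v) (tensor_map K D D F F (comult C x)) =
        F (tensor_lift C (\<lambda>u v. counit C u \<odot>\<^bsub>C\<^esub> v) (comult C x))"
      using ce by (intro contract contract_left CC DD C.counit_linear counit_linear \<Delta>)
        (simp add: counit smult)
    then show "tensor_lift D (\<lambda>u v. counit D u \<odot>\<^bsub>D\<^esub> v) (comult D y) = y"
      using x C.counit_left[OF x(1)] by (simp add: comult)
    have "tensor_lift D (\<lambda>u v. counit D v \<odot>\<^bsub>D\<^esub> u) (tensor_map K D D F F (comult C x)) =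
        F (tensor_lift C (\<lambda>u v. counit C v \<odot>\<^bsub>C\<^esub> u) (comult C x))"
      using ce by (intro contract contract_right CC DD C.counit_linear counit_linear \<Delta>)
        (simp add: counit smult)
    then show "tensor_lift D (\<lambda>u v. counit D v \<odot>\<^bsub>D\<^esub> u) (comult D y) = y"
      using x C.counit_right[OF x(1)] by (simp add: comult)
    have h: "(\<lambda>u. comult D (F u)) \<in> linear_maps K C (tensor K D D)"
      by (rule linear_maps_comp[OF F comult_linear])
    note CCC = C.CCC.UV_W.vspace_pair_axioms and DDD = D.UV_W.vspace_pair_axioms
    note CCC' = C.CCC.U_VW.vspace_pair_axioms and DDD' = D.U_VW.vspace_pair_axioms
    have 1: "tensor_map K (tensor K D D) D (comult D) id (comult D y) =
        tensor_map K (tensor K D D) D (tensor_map K D D F F) F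
          (tensor_map K (tensor K C C) C (comult C) id (comult C x))"
      unfolding x(2) comult[OF x(1)]
      using tensor_map_comp[OF CC DD DDD F F comult_linear id_linear h F _ _ \<Delta>]
        tensor_map_comp[OF CC CCC DDD C.comult_linear id_linear FF F h F _ _ \<Delta>]
      by (simp add: comult)
    have 2: "tensor_map K D (tensor K D D) id (comult D) (comult D y) =
        tensor_map K D (tensor K D D) F (tensor_map K D D F F)
          (tensor_map K C (tensor K C C) id (comult C) (comult C x))"
      unfolding x(2) comult[OF x(1)]
      using tensor_map_comp[OF CC DD DDD' F F id_linear comult_linear F h _ _ \<Delta>]
        tensor_map_comp[OF CC CCC' DDD' id_linear C.comult_linear F FF F h _ _ \<Delta>]
      by (simp add: comult)
    show "tensor_assoc K D D D (tensor_map K (tensor K D D) D (comult D) id (comult D y)) =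
        tensor_map K D (tensor K D D) id (comult D) (comult D y)"
      unfolding 1 2 C.coassoc[OF x(1), symmetric]
      by (rule tensor_assoc_natural[OF C.vspace_axioms D F
            linear_map_closed[OF tensor_map_linear[OF CC CCC C.comult_linear id_linear] \<Delta>]])
  qed
qed

lemma tensor_eq_cong:
  assumes "tensor_eq K V V xs ys"
    and "carrier W = carrier V" "add W = add V" "zero W = zero V" "smult W = smult V"
  shows "tensor_eq K W W xs ys"
  using assms(1)
proof induction
  case (refl xs)
  then show ?case using tensor_eq.refl[of xs W W K] assms(2-) by simp
next
  case (commute xs ys)
  then show ?case using tensor_eq.commute[of xs W W ys K] assms(2-) by simp
next
  case (add_left v v' w)
  then show ?case using tensor_eq.add_left[of v W v' w W K] assms(2-) by simp
next
  case (add_right v w w')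
  then show ?case using tensor_eq.add_right[of v W w W w' K] assms(2-) by simp
next
  case (balanced a v w)
  then show ?case using tensor_eq.balanced[of a K v W w W] assms(2-) by simp
next
  case (zero_left w)
  then show ?case using tensor_eq.zero_left[of w W K W] assms(2-) by simp
qed (auto simp: assms(2-) intro: tensor_eq.intros)

lemma tensor_class_cong:
  assumes "carrier W = carrier V" "add W = add V" "zero W = zero V" "smult W = smult V"
  shows "tensor_class K W W = tensor_class K V V"
  using tensor_eq_cong[of K V _ _ W] tensor_eq_cong[of K W _ _ V] assms
  by (auto simp: fun_eq_iff tensor_class_def)

section \<open>The finite dual of the dual algebra\<close>

context infinite_chain_coalgebra
begin

abbreviation "A \<equiv> dual_algebra K C"
abbreviation "D \<equiv> finite_dual_space K A"
abbreviation "FD \<equiv> finite_dual K A"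
abbreviation "ev \<equiv> evaluation_map K C"

lemma ev_apply: "f \<in> functionals \<Longrightarrow> ev c f = f c"
  by (simp add: evaluation_map_def)

lemma ev_functional: "c \<in> carrier C \<Longrightarrow> ev c \<in> A.functionals"
proof -
  assume c: "c \<in> carrier C"
  have "restrict (\<lambda>f. f c) (carrier A) \<in> A.functionals" by (rule A.functionalI) (use c in simp_all)
  then show ?thesis by (simp add: evaluation_map_def)
qed

lemma ev_linear: "ev \<in> linear_maps K C (dual_space K A)"
proof (rule linear_mapsI)
  interpret DA: vspace K "dual_space K A" by (rule A.dual_space_vspace)
  show "ev x \<in> A.functionals" if "x \<in> carrier C" for x using that by (rule ev_functional)
  fix x assume x: "x \<in> carrier C"
  {
    fix y assume y: "y \<in> carrier C"
    show "ev (x \<oplus>\<^bsub>C\<^esub> y) = ev x \<oplus>\<^bsub>dual_space K A\<^esub> ev y"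
      by (rule A.functional_ext)
        (use x y in \<open>simp_all add: ev_functional DA.M.a_closed ev_apply functional_add\<close>)
  }
  fix a assume a: "a \<in> carrier K"
  show "ev (a \<odot>\<^bsub>C\<^esub> x) = a \<odot>\<^bsub>dual_space K A\<^esub> ev x"
    by (rule A.functional_ext)
      (use x a in \<open>simp_all add: ev_functional DA.smult_closed ev_apply functional_smult\<close>)
qed

text \<open>
  The left orbit of \<open>c\<close> is stable under both actions; stability under the left action makes the
  annihilator a right ideal, stability under the right action a left ideal.
\<close>

lemma annihilator_ideal:
  assumes c: "c \<in> carrier C"
  shows "ideal {f \<in> functionals. \<forall>y\<in>left_orbit c. f y = \<zero>} A" (is "ideal ?I A")
proof (rule idealI)
  show "ring A" by (rule A.ring_axioms)
  have orb: "y \<in> carrier C" if "y \<in> left_orbit c" for y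
    using submoduleE(1)[OF left_orbit_submodule[OF c]] that by blast
  have "submodule ?I K A"
  proof (rule A.submodule_minus_freeI)
    show "\<zero>\<^bsub>A\<^esub> \<in> ?I" using orb D.M.zero_closed by simp
  next
    fix f g assume fg: "f \<in> ?I" "g \<in> ?I"
    then have "f \<oplus>\<^bsub>dual_space K C\<^esub> g \<in> functionals" by (intro D.M.a_closed) simp_all
    then show "f \<oplus>\<^bsub>A\<^esub> g \<in> ?I" using fg orb by simp
  next
    fix a f assume af: "a \<in> carrier K" "f \<in> ?I"
    then have "a \<odot>\<^bsub>dual_space K C\<^esub> f \<in> functionals" by (intro D.smult_closed) simp_all
    then show "a \<odot>\<^bsub>A\<^esub> f \<in> ?I" using af orb by simp
  qed simp
  then show "subgroup ?I (add_monoid A)" by (simp add: submodule_def)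
next
  fix f g assume f: "f \<in> ?I" and g: "g \<in> carrier A"
  have stable: "left_stable (left_orbit c)" "right_stable (left_orbit c)"
    using left_orbit_stable[OF c] by (simp_all add: right_stable_iff_left_stable)
  have orb: "y \<in> carrier C" if "y \<in> left_orbit c" for y
    using submoduleE(1)[OF left_orbit_submodule[OF c]] that by blast
  show "g \<star> f \<in> ?I"
    using f g stable orb by (simp add: right_stable_def conv_right_action)
  show "f \<star> g \<in> ?I"
    using f g stable orb by (simp add: left_stable_def conv_left_action)
qed

lemma finite_codimension_annihilator:
  assumes T: "finite T" "T \<subseteq> carrier C"
  shows "finite_codimension K A {f \<in> functionals. \<forall>y\<in>span T. f y = \<zero>}" (is "finite_codimension K A ?I")
proof -
  have ev: "(\<lambda>t f. f t) ` T \<subseteq> linear_maps K A (scalar_space K)"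
    using T(2) eval_linear by (auto simp: linear_maps_def)
  have "finite ((\<lambda>t f. f t) ` T :: (('c \<Rightarrow> 'a) \<Rightarrow> 'a) set)" using T(1) by simp
  from A.finite_functionals_interpolate[OF this ev] obtain S where S: "finite S" "S \<subseteq> carrier A"
    and S_interp: "\<And>g. g \<in> functionals \<Longrightarrow> \<exists>s\<in>A.span S. \<forall>t\<in>T. g t = s t" by auto
  have span_c: "s \<in> functionals" if "s \<in> A.span S" for s using A.span_closed[OF S(2) that] by simp
  have "f \<in> ?I <+>\<^bsub>A\<^esub> A.span S" if f: "f \<in> functionals" for f
  proof -
    obtain s where s: "s \<in> A.span S" "\<forall>t\<in>T. f t = s t" using S_interp[OF f] by blast
    have sc: "s \<in> functionals" using span_c s by blast
    let ?d = "f \<ominus>\<^bsub>dual_space K C\<^esub> s"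
    have d: "?d \<in> functionals" using f sc by (rule D.M.minus_closed)
    have deq: "?d \<oplus>\<^bsub>dual_space K C\<^esub> s = f"
      using f sc by (simp add: a_minus_def D.M.a_assoc D.M.l_neg)
    have "?d y = \<zero>" if y: "y \<in> span T" for y
    proof -
      have yc: "y \<in> carrier C" using y T(2) span_closed by blast
      have "f y = s y"
        using linear_eq_on_span[OF vspace_axioms scalars functional_linear[OF f] functional_linear[OF sc] T(2) _ y]
          s(2) by blast
      moreover have "f y = ?d y \<oplus> s y" using yc by (subst deq[symmetric]) simp
      ultimately show ?thesis using d sc yc by (simp add: R.add.r_cancel_one')
    qed
    then have "?d \<in> ?I" using d by simp
    then show ?thesis
      unfolding set_add_def' using s(1) deq by (intro UN_I[of ?d] UN_I[of s]) simp_all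
  qed
  moreover have "?I <+>\<^bsub>A\<^esub> A.span S \<subseteq> functionals"
    using span_c D.M.a_closed by (auto simp: set_add_def')
  ultimately have "?I <+>\<^bsub>A\<^esub> A.span S = carrier A" by auto
  then show ?thesis using S unfolding finite_codimension_def by blast
qed

lemma ev_in_finite_dual:
  assumes c: "c \<in> carrier C" shows "ev c \<in> carrier D"
proof -
  obtain T where T: "finite T" "T \<subseteq> carrier C" "left_orbit c = span T"
    using left_orbit_finite[OF c] by blast
  let ?I = "{f \<in> functionals. \<forall>y\<in>left_orbit c. f y = \<zero>}"
  have "finite_codimension K A ?I" unfolding T(3) by (rule finite_codimension_annihilator[OF T(1,2)])
  moreover have "\<forall>f\<in>?I. ev c f = \<zero>" using left_orbit_self[OF c] by (simp add: ev_apply)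
  ultimately show ?thesis
    using annihilator_ideal[OF c] ev_functional[OF c] by (auto simp: finite_dual_space_def)
qed

text \<open>
  If the zero ideal had finite codimension, the dual would be spanned by finitely many functionals,
  whose common kernel is zero and has finite codimension in \<open>C\<close>.
\<close>

lemma finite_codimension_nonzero:
  assumes cod: "finite_codimension K A I" and sub: "I \<subseteq> functionals"
  shows "\<exists>f\<in>I. f \<noteq> \<zero>\<^bsub>dual_space K C\<^esub>"
proof (rule ccontr)
  assume "\<not> ?thesis"
  then have I: "I \<subseteq> {\<zero>\<^bsub>dual_space K C\<^esub>}" by blast
  obtain S where S: "finite S" "S \<subseteq> functionals" "I <+>\<^bsub>A\<^esub> A.span S = functionals"
    using cod by (auto simp: finite_codimension_def)
  have span_c: "s \<in> functionals" if "s \<in> A.span S" for s using A.span_closed[of S] S(2) that by simp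
  have all: "f \<in> A.span S" if f: "f \<in> functionals" for f
  proof -
    have "f \<in> I <+>\<^bsub>A\<^esub> A.span S" using S(3) f by simp
    then obtain i s where "i \<in> I" "s \<in> A.span S" "f = i \<oplus>\<^bsub>dual_space K C\<^esub> s" by (auto simp: set_add_def')
    then show ?thesis using I span_c[of s] by auto
  qed
  have "S \<subseteq> linear_maps K C (scalar_space K)" using S(2) functional_linear by blast
  from finite_functionals_interpolate[OF S(1) this] obtain T where T: "finite T" "T \<subseteq> carrier C"
    and T_interp: "\<And>x. x \<in> carrier C \<Longrightarrow> \<exists>z\<in>span T. \<forall>f\<in>S. f x = f z"
    by auto
  have "x \<in> span T" if x: "x \<in> carrier C" for x
  proof -
    obtain z where z: "z \<in> span T" "\<forall>f\<in>S. f x = f z" using T_interp[OF x] by blast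
    have zc: "z \<in> carrier C" using z(1) T(2) span_closed by blast
    have d: "x \<ominus>\<^bsub>C\<^esub> z \<in> carrier C" using x zc by (rule M.minus_closed)
    have evd: "(\<lambda>f. f (x \<ominus>\<^bsub>C\<^esub> z)) \<in> linear_maps K A (scalar_space K)"
      using eval_linear[OF d] by (simp add: linear_maps_def)
    have SA: "S \<subseteq> carrier A" using S(2) by simp
    have van: "f (x \<ominus>\<^bsub>C\<^esub> z) = \<zero>\<^bsub>scalar_space K\<^esub>" if f: "f \<in> S" for f
    proof -
      have fc: "f \<in> functionals" using S(2) f by blast
      have "f x = f z" using z(2) f by blast
      then show ?thesis using fc x zc by (simp add: functional_minus R.diff_eq_zero_iff)
    qed
    have "f (x \<ominus>\<^bsub>C\<^esub> z) = \<zero>\<^bsub>scalar_space K\<^esub>" if "f \<in> functionals" for f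
      by (rule linear_vanishes_on_span[where f = "\<lambda>f. f (x \<ominus>\<^bsub>C\<^esub> z)",
            OF A.vspace_axioms scalars evd SA _ all[OF that]]) (rule van)
    then have "f (x \<ominus>\<^bsub>C\<^esub> z) = \<zero>" if "f \<in> functionals" for f using that by simp
    then have "x \<ominus>\<^bsub>C\<^esub> z = \<zero>\<^bsub>C\<^esub>" by (intro functionals_separate_zero d)
    then show ?thesis using z(1) x zc by (simp add: M.diff_eq_zero_iff)
  qed
  then have "span T = carrier C" using span_closed[OF T(2)] by blast
  then have "finite_dimensional K C" using T unfolding finite_dimensional_def by blast
  then show False using infinite_dimensional by blast
qed

text \<open>
  The kernel of a functional in the finite dual contains a nonzero ideal, hence the left ideal of
  some \<open>f \<noteq> 0\<close>, which consists of all functionals vanishing on a finite-dimensional space. So it is a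
  finitely supported functional on the dual of \<open>C\<close>, that is, an evaluation.
\<close>

lemma finite_dual_is_evaluation:
  assumes \<phi>: "\<phi> \<in> carrier D" shows "\<exists>c\<in>carrier C. \<phi> = ev c"
proof -
  obtain I where I: "ideal I A" "finite_codimension K A I" "\<And>f. f \<in> I \<Longrightarrow> \<phi> f = \<zero>"
    and \<phi>f: "\<phi> \<in> A.functionals"
    using \<phi> by (auto simp: finite_dual_space_def)
  interpret I: ideal I A by (rule I(1))
  have Ic: "I \<subseteq> functionals" using I.a_subset by simp
  obtain f where f: "f \<in> I" "f \<noteq> \<zero>\<^bsub>dual_space K C\<^esub>" using finite_codimension_nonzero[OF I(2) Ic] by blast
  have fc: "f \<in> functionals" using f(1) Ic by blast
  obtain T where T: "finite T" "T \<subseteq> carrier C" "kernel_of f \<subseteq> span T"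
    using kernel_of_finite[OF fc f(2)] by blast
  have van: "\<phi> h = \<zero>" if h: "h \<in> functionals" "\<And>t. t \<in> T \<Longrightarrow> h t = \<zero>" for h
  proof -
    have "h x = \<zero>\<^bsub>scalar_space K\<^esub>" if "x \<in> span T" for x
      by (rule linear_vanishes_on_span[OF vspace_axioms scalars functional_linear[OF h(1)] T(2) _ that])
        (simp add: h(2))
    then have "h x = \<zero>" if "x \<in> kernel_of f" for x using T(3) that by auto
    then obtain g where "g \<in> functionals" "h = g \<star> f" using principal_left_ideal[OF fc f(2) h(1)] by blast
    then have "h \<in> I" using I.I_l_closed[OF f(1), of g] by simp
    then show ?thesis by (rule I(3))
  qed
  have "\<phi> \<in> linear_maps K (dual_space K C) (scalar_space K)"
    using A.functional_linear[OF \<phi>f] by (simp add: linear_maps_def)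
  from evaluation_of_finitely_supported[OF T(1,2) this van] obtain c
    where c: "c \<in> carrier C" "\<forall>f\<in>functionals. \<phi> f = f c" by blast
  then have "\<phi> = ev c" by (intro A.functional_ext \<phi>f ev_functional) (simp_all add: ev_apply)
  then show ?thesis using c(1) by blast
qed

lemma finite_dual_carrier: "carrier D = ev ` carrier C"
  using ev_in_finite_dual finite_dual_is_evaluation by blast

lemma finite_dual_space_simps:
  "zero D = zero (dual_space K A)" "add D = add (dual_space K A)" "smult D = smult (dual_space K A)"
  by (simp_all add: finite_dual_space_def)

lemma finite_dual_space_vspace: "vspace K D"
proof -
  have sub: "submodule (carrier D) K (dual_space K A)"
    unfolding finite_dual_carrier
    by (rule linear_image_submodule[OF vspace_axioms A.dual_space_vspace ev_linear])
  interpret DA: vspace K "dual_space K A" by (rule A.dual_space_vspace)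
  have "module K ((dual_space K A)\<lparr>carrier := carrier D\<rparr>)"
    by (rule submodule.submodule_is_module[OF sub DA.module_axioms])
  then have "vspace K ((dual_space K A)\<lparr>carrier := carrier D\<rparr>)"
    by (rule vspace.intro) (rule field_axioms)
  then show ?thesis by (rule vspace_cong) (simp_all add: finite_dual_space_simps)
qed

lemma finite_dual_simps:
  "carrier FD = carrier D" "zero FD = zero D" "add FD = add D" "smult FD = smult D"
  "counit FD = (\<lambda>f. f \<epsilon>)"
  by (simp_all add: finite_dual_def Let_def)

lemma finite_dual_vspace: "vspace K FD"
  by (rule vspace_cong[OF finite_dual_space_vspace]) (simp_all add: finite_dual_simps)

lemma ev_linear_D: "ev \<in> linear_maps K C D"
  using ev_linear ev_in_finite_dual by (auto simp: linear_maps_def finite_dual_space_simps)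

lemma ev_linear_FD: "ev \<in> linear_maps K C FD"
  using ev_linear_D by (simp add: linear_maps_def finite_dual_simps)

lemma tensor_class_FD: "tensor_class K FD FD = tensor_class K D D"
  by (rule tensor_class_cong) (simp_all add: finite_dual_simps)

lemma tensor_FD: "tensor K FD FD = tensor K D D"
  by (simp add: tensor_def tensor_class_FD finite_dual_simps)

lemma tensor_map_FD: "tensor_map K FD FD = tensor_map K D D"
  by (simp add: fun_eq_iff tensor_map_def tensor_FD pure_tensor_def tensor_class_FD)

text \<open>
  On tensors of evaluations the pairing that defines the comultiplication of the finite dual is the
  pairing of \<open>C \<otimes> C\<close> with products of functionals, which separates points.
\<close>

lemma pairing_tensor_map:
  assumes fg: "f \<in> functionals" "g \<in> functionals" and t: "t \<in> carrier (tensor K C C)"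
  shows "tensor_lift K (\<lambda>\<phi> \<psi>. \<phi> f \<otimes> \<psi> g) (tensor_map K D D ev ev t) = CC.tensor_functional f g t"
proof -
  interpret E: vspace K D by (rule finite_dual_space_vspace)
  interpret DD: vspace_pair K D D ..
  have D_sub: "\<phi> \<in> A.functionals" if "\<phi> \<in> carrier D" for \<phi>
    using that ev_functional by (auto simp: finite_dual_carrier)
  have at: "restrict (\<lambda>\<phi>. \<phi> h) (carrier D) \<in> E.functionals" if h: "h \<in> functionals" for h
    by (rule E.functionalI) (use h D_sub in \<open>auto simp: finite_dual_space_simps\<close>)
  have at_ev: "restrict (\<lambda>\<phi>. \<phi> h) (carrier D) (ev c) = h c" if "h \<in> functionals" "c \<in> carrier C" for h c
    using that by (simp add: ev_in_finite_dual ev_apply)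
  note m = linear_map_closed[OF tensor_map_linear[OF CC.vspace_pair_axioms DD.vspace_pair_axioms ev_linear_D ev_linear_D] t]
  have "tensor_lift K (\<lambda>\<phi> \<psi>. \<phi> f \<otimes> \<psi> g) (tensor_map K D D ev ev t) =
      DD.tensor_functional (restrict (\<lambda>\<phi>. \<phi> f) (carrier D)) (restrict (\<lambda>\<phi>. \<phi> g) (carrier D))
        (tensor_map K D D ev ev t)"
    unfolding DD.tensor_functional_apply[OF m] by (rule DD.tensor_lift_cong[OF m]) simp
  also have "\<dots> = CC.tensor_functional f g t"
    by (rule tensor_functional_map[OF CC.vspace_pair_axioms DD.vspace_pair_axioms ev_linear_D ev_linear_D
          at[OF fg(1)] at[OF fg(2)] fg _ _ t]) (simp_all add: at_ev fg del: restrict_apply)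
  finally show ?thesis .
qed

lemma comult_finite_dual:
  assumes c: "c \<in> carrier C"
  shows "comult FD (ev c) = tensor_map K FD FD ev ev (comult C c)"
proof -
  interpret E: vspace K D by (rule finite_dual_space_vspace)
  interpret DD: vspace_pair K D D ..
  note pairs = CC.vspace_pair_axioms DD.vspace_pair_axioms ev_linear_D ev_linear_D
  note \<Delta> = comult_closed[OF c]
  have pairing: "CC.tensor_functional f g (comult C c) = ev c (f \<star> g)"
    if "f \<in> functionals" "g \<in> functionals" for f g
    using that c by (simp add: ev_apply conv_apply)
  have "(THE t. t \<in> carrier (tensor K D D) \<and>
      (\<forall>f\<in>carrier A. \<forall>g\<in>carrier A. tensor_lift K (\<lambda>\<phi> \<psi>. \<phi> f \<otimes> \<psi> g) t = ev c (f \<star> g))) =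
    tensor_map K D D ev ev (comult C c)"
  proof (rule the_equality, intro conjI ballI)
    show "tensor_map K D D ev ev (comult C c) \<in> carrier (tensor K D D)"
      by (rule linear_map_closed[OF tensor_map_linear[OF pairs] \<Delta>])
    fix f g assume "f \<in> carrier A" "g \<in> carrier A"
    then show "tensor_lift K (\<lambda>\<phi> \<psi>. \<phi> f \<otimes> \<psi> g) (tensor_map K D D ev ev (comult C c)) = ev c (f \<star> g)"
      by (simp add: pairing_tensor_map \<Delta> pairing)
  next
    fix t assume t: "t \<in> carrier (tensor K D D) \<and>
      (\<forall>f\<in>carrier A. \<forall>g\<in>carrier A. tensor_lift K (\<lambda>\<phi> \<psi>. \<phi> f \<otimes> \<psi> g) t = ev c (f \<star> g))"
    obtain s where s: "s \<in> carrier (tensor K C C)" "t = tensor_map K D D ev ev s"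
      using tensor_map_surj[OF pairs finite_dual_carrier[symmetric] finite_dual_carrier[symmetric]] t by blast
    have "s = comult C c"
    proof (rule CC.tensor_separate[OF s(1) \<Delta>])
      fix f g assume fg: "f \<in> functionals" "g \<in> functionals"
      have "tensor_lift K (\<lambda>\<phi> \<psi>. \<phi> f \<otimes> \<psi> g) t = ev c (f \<star> g)" using t fg by simp
      then have "CC.tensor_functional f g s = ev c (f \<star> g)"
        unfolding s(2) pairing_tensor_map[OF fg s(1)] .
      also have "\<dots> = CC.tensor_functional f g (comult C c)" by (simp add: pairing[OF fg])
      finally show "tensor_lift K (\<lambda>v w. f v \<otimes> g w) s = tensor_lift K (\<lambda>v w. f v \<otimes> g w) (comult C c)"
        using s(1) \<Delta> by (simp add: CC.tensor_functional_apply)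
    qed
    then show "t = tensor_map K D D ev ev (comult C c)" using s(2) by simp
  qed
  then show ?thesis unfolding tensor_map_FD by (simp add: finite_dual_def Let_def)
qed

lemma counit_finite_dual: "c \<in> carrier C \<Longrightarrow> counit FD (ev c) = counit C c"
  by (simp add: finite_dual_simps ev_apply counit_functional_apply)

lemma coreflexive_dual_evaluation: "coreflexive K C"
  unfolding coreflexive_def
proof (intro coalgebra_iso.intro coalgebra_iso_axioms.intro coalgebra_axioms ev_linear_FD)
  show "coalgebra K FD"
    by (rule coalgebra_transport[OF coalgebra_axioms finite_dual_vspace ev_linear_FD])
      (simp_all add: finite_dual_simps(1) finite_dual_carrier comult_finite_dual counit_finite_dual)
  have "inj_on ev (carrier C)"
  proof (rule inj_onI)
    fix c d assume cd: "c \<in> carrier C" "d \<in> carrier C" "ev c = ev d"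
    have "f c = f d" if "f \<in> functionals" for f
      using ev_apply[OF that, of c] ev_apply[OF that, of d] cd(3) by simp
    then show "c = d" by (rule functionals_separate[OF cd(1,2)])
  qed
  then show "bij_betw ev (carrier C) (carrier FD)"
    by (simp add: bij_betw_def finite_dual_simps(1) finite_dual_carrier)
qed (simp_all add: comult_finite_dual counit_finite_dual)

end

theorem proposition5p3:
  fixes K :: "('k, 'e) ring_scheme" and C :: "('k, 'c) coalgebra"
  assumes "field K"
    and "chain_coalgebra K C"
    and "\<not> finite_dimensional K C"
  shows "coreflexive K C \<and>
    (\<exists>(A :: ('k, 'c \<Rightarrow> 'k) module) F.
       assoc_algebra K A \<and> left_noetherian_chain_domain A \<and>
       coalgebra_iso K C (finite_dual K A) F)"
proof -
  interpret infinite_chain_coalgebra K C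
    by (intro infinite_chain_coalgebra.intro infinite_chain_coalgebra_axioms.intro assms)
  show ?thesis
    using coreflexive_dual_evaluation dual_algebra_assoc_algebra dual_algebra_chain_domain
    unfolding coreflexive_def by blast
qed

end
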